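(* Let $G$ be a quasireductive supergroup and let $X$ be an affine $G$-supervariety. If $X$ is spherical, then the socle of $\mathbb{C}[X]$ as a $G$-module is multiplicity-free, i.e. each irreducible representation of $G$ occurs in it with multiplicity at most one.
   Context: Everything is over $\mathbb{C}$. A supervariety is an irreducible superscheme $X=(|X|,\mathcal{O}_X)$ over $\mathbb{C}$ such that: (i) $X$ has a finite cover by open affine subschemes $\operatorname{Spec}A$ with $A$ a finitely generated (supercommutative) superalgebra; (ii) for every open $U$ the map $\Gamma(U,\mathcal{O}_X)\to\mathbb{C}(X)$ is injective, where $\mathbb{C}(X)$ is the stalk of $\mathcal{O}_X$ at the generic point; (iii) the zero divisors of $\mathbb{C}(X)$ are exactly the ideal generated by $\mathbb{C}(X)_{\overline 1}$; (iv) $X$ is separated. $X$ is affine if $X=\operatorname{Spec}A$. Write $\mathbb{C}[X]=\Gamma(X,\mathcal{O}_X)$. An algebraic supergroup is a group object $G$ in supervarieties, always assumed affine; $\mathfrak{g}=\operatorname{Lie}G$; $G_0$ is the underlying even algebraic group, with Lie algebra $\mathfrak{g}_{\overline 0}$. A $G$-supervariety is a supervariety with an action of $G$. The group has an open orbit on $X$ if for some $x\in X(\mathbb{C})$ the orbit map $a_x$ is a submersion at the identity, equivalently the evaluation map $\mathfrak{g}\to T_xX$ is surjective. $G$ is quasireductive if $G_0$ is reductive. A hyperborel subalgebra of $\mathfrak{g}$ is a subalgebra $\mathfrak{b}$ such that $\mathfrak{b}_{\overline 0}$ is a Borel subalgebra of $\mathfrak{g}_{\overline 0}$, $[\mathfrak{b}_{\overline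 1},\mathfrak{b}_{\overline 1}]\subseteq[\mathfrak{b}_{\overline 0},\mathfrak{b}_{\overline 0}]$, and $\mathfrak{b}$ is maximal with these properties. A hyperborel subgroup of $G$ is the connected subgroup integrating a hyperborel subalgebra. $X$ is spherical if some hyperborel subgroup $B$ of $G$ has an open orbit on $X$. The socle of a $G$-module is the sum of its irreducible submodules. *)

theory Defs
  imports
    "HOL-Analysis.Analysis"
    "HOL-Algebra.Coset"
    "HOL-Algebra.Ideal"
    "HOL-Library.Multiset"
    "HOL-Library.Extended_Nat"
    "HOL-Library.Function_Algebras"
    "HOL-Library.Z2"
begin

section \<open>Super vector spaces and superalgebras over the complex numbers\<close>

class complex_vector = ab_group_add +
  fixes cscale :: "complex \<Rightarrow> 'a \<Rightarrow> 'a"  (infixr \<open>*\<^sub>C\<close> 75)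
  assumes cscale_add_right: "c *\<^sub>C (x + y) = c *\<^sub>C x + c *\<^sub>C y"
    and cscale_add_left: "(c + d) *\<^sub>C x = c *\<^sub>C x + d *\<^sub>C x"
    and cscale_cscale: "c *\<^sub>C d *\<^sub>C x = (c * d) *\<^sub>C x"
    and cscale_one: "1 *\<^sub>C x = x"

interpretation cvs: vector_space "cscale :: complex \<Rightarrow> 'a \<Rightarrow> 'a::complex_vector"
  by standard (simp_all add: cscale_add_right cscale_add_left cscale_cscale cscale_one)

abbreviation cspan :: "'a::complex_vector set \<Rightarrow> 'a set" where
  "cspan \<equiv> module.span cscale"

abbreviation csubspace :: "'a::complex_vector set \<Rightarrow> bool" where
  "csubspace \<equiv> module.subspace cscale"

abbreviation clinear :: "('a::complex_vector \<Rightarrow> 'b::complex_vector) \<Rightarrow> bool" where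
  "clinear \<equiv> Vector_Spaces.linear cscale cscale"

lemma clinear_iff:
  "clinear f \<longleftrightarrow> (\<forall>x y. f (x + y) = f x + f y) \<and> (\<forall>c x. f (c *\<^sub>C x) = c *\<^sub>C f x)"
  by (simp add: Vector_Spaces.linear_iff cvs.vector_space_axioms)

text \<open>
  A \<open>\<int>/2\<close>-grading is given by the projection \<open>hcomp p\<close> onto the component of parity \<open>p\<close>.
\<close>

class super_vector_space = complex_vector +
  fixes hcomp :: "bit \<Rightarrow> 'a \<Rightarrow> 'a"
  assumes hcomp_add: "hcomp p (x + y) = hcomp p x + hcomp p y"
    and hcomp_cscale: "hcomp p (c *\<^sub>C x) = c *\<^sub>C hcomp p x"
    and hcomp_hcomp: "hcomp p (hcomp q x) = (if p = q then hcomp p x else 0)"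
    and hcomp_sum: "hcomp 0 x + hcomp 1 x = x"

definition homogeneous :: "bit \<Rightarrow> 'a::super_vector_space set" where
  "homogeneous p = {x. hcomp p x = x}"

definition graded :: "'a::super_vector_space set \<Rightarrow> bool" where
  "graded W \<longleftrightarrow> (\<forall>w\<in>W. \<forall>p. hcomp p w \<in> W)"

class super_algebra = super_vector_space + ring_1 +
  assumes cscale_mult_left: "(c *\<^sub>C x) * y = c *\<^sub>C (x * y)"
    and cscale_mult_right: "x * (c *\<^sub>C y) = c *\<^sub>C (x * y)"
    and hcomp_one: "hcomp 0 1 = 1"
    and hcomp_mult: "hcomp p x = x \<Longrightarrow> hcomp q y = y \<Longrightarrow> hcomp (p + q) (x * y) = x * y"

text \<open>\<open>(- 1) ^ (p * q)\<close>\<close>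

definition ksign :: "bit \<Rightarrow> bit \<Rightarrow> complex" where
  "ksign p q = (if p = 1 \<and> q = 1 then - 1 else 1)"

class supercommutative_algebra = super_algebra +
  assumes supercommute:
    "hcomp p x = x \<Longrightarrow> hcomp q y = y \<Longrightarrow> x * y = ksign p q *\<^sub>C (y * x)"

definition superalgebra_hom :: "('a::super_algebra \<Rightarrow> 'b::super_algebra) \<Rightarrow> bool" where
  "superalgebra_hom f \<longleftrightarrow> clinear f \<and> (\<forall>x y. f (x * y) = f x * f y) \<and> f 1 = 1
     \<and> (\<forall>p x. f (hcomp p x) = hcomp p (f x))"

instantiation complex :: supercommutative_algebra
begin
definition cscale_complex :: "complex \<Rightarrow> complex \<Rightarrow> complex" where
  "cscale_complex c z = c * z"
definition hcomp_complex :: "bit \<Rightarrow> complex \<Rightarrow> complex" where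
  "hcomp_complex p z = (if p = 0 then z else 0)"
instance
  by standard (auto simp: cscale_complex_def hcomp_complex_def algebra_simps ksign_def
      split: if_splits)
end

instantiation "fun" :: (type, complex_vector) complex_vector
begin
definition cscale_fun :: "complex \<Rightarrow> ('a \<Rightarrow> 'b) \<Rightarrow> 'a \<Rightarrow> 'b" where
  "cscale_fun c f = (\<lambda>x. c *\<^sub>C f x)"
instance
  by standard (simp_all add: cscale_fun_def fun_eq_iff cscale_add_right cscale_add_left
      cscale_cscale cscale_one)
end

lemma hcomp_0 [simp]: "hcomp p (0::'a::super_vector_space) = 0"
  using hcomp_add[of p 0 0] by simp

lemma hcomp_idem [simp]: "hcomp p (hcomp p x) = hcomp p (x::'a::super_vector_space)"
  by (simp add: hcomp_hcomp)

lemma hcomp_homogeneous: "hcomp p x = x \<Longrightarrow> hcomp q x = (if p = q then x else 0)"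
  for x :: "'a::super_vector_space"
  using hcomp_hcomp[of q p x] by auto


section \<open>Tensor products\<close>

text \<open>
  \<open>V \<otimes> W\<close> is the set of finite formal sums of pairs modulo the congruence generated by
  bilinearity.  Scalars and negatives act through the first entry of a pair, so the quotient is
  a vector space although formal sums form only a monoid.
\<close>

inductive tensor_rel ::
  "('a::complex_vector \<times> 'b::complex_vector) multiset \<Rightarrow> ('a \<times> 'b) multiset \<Rightarrow> bool" where
  tensor_refl: "tensor_rel M M"
| tensor_sym: "tensor_rel M N \<Longrightarrow> tensor_rel N M"
| tensor_trans: "tensor_rel M N \<Longrightarrow> tensor_rel N K \<Longrightarrow> tensor_rel M K"
| tensor_cong: "tensor_rel M N \<Longrightarrow> tensor_rel (add_mset x M) (add_mset x N)"
| tensor_zero: "tensor_rel {#(0, b)#} {#}"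
| tensor_add_left: "tensor_rel {#(a + a', b)#} {#(a, b), (a', b)#}"
| tensor_add_right: "tensor_rel {#(a, b + b')#} {#(a, b), (a, b')#}"
| tensor_scale: "tensor_rel {#(c *\<^sub>C a, b)#} {#(a, c *\<^sub>C b)#}"

lemma tensor_rel_equivp: "equivp tensor_rel"
  by (rule equivpI)
    (auto simp: reflp_def symp_def transp_def intro: tensor_refl tensor_sym tensor_trans)

quotient_type (overloaded) ('a, 'b) tensor =
  "('a::complex_vector \<times> 'b::complex_vector) multiset" / tensor_rel
  by (rule tensor_rel_equivp)

lemma tensor_rel_add_left: "tensor_rel M N \<Longrightarrow> tensor_rel (K + M) (K + N)"
  by (induction K) (auto intro: tensor_cong)

lemma tensor_rel_add: "tensor_rel M N \<Longrightarrow> tensor_rel M' N' \<Longrightarrow> tensor_rel (M + M') (N + N')"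
  by (metis tensor_rel_add_left add.commute tensor_trans)

lemma tensor_rel_scale:
  "tensor_rel M N \<Longrightarrow> tensor_rel (image_mset (\<lambda>(a, b). (c *\<^sub>C a, b)) M)
     (image_mset (\<lambda>(a, b). (c *\<^sub>C a, b)) N)"
proof (induction rule: tensor_rel.induct)
  case (tensor_scale d a b)
  have "tensor_rel {#(d *\<^sub>C (c *\<^sub>C a), b)#} {#(c *\<^sub>C a, d *\<^sub>C b)#}"
    by (rule tensor_rel.tensor_scale)
  then show ?case by (simp add: cscale_cscale mult.commute)
qed (auto intro: tensor_rel.intros simp: cscale_add_right)

instantiation tensor :: (complex_vector, complex_vector) complex_vector
begin

lift_definition zero_tensor :: "('a, 'b) tensor" is "{#}" .

lift_definition plus_tensor :: "('a, 'b) tensor \<Rightarrow> ('a, 'b) tensor \<Rightarrow> ('a, 'b) tensor" is "(+)"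
  by (rule tensor_rel_add)

lift_definition cscale_tensor :: "complex \<Rightarrow> ('a, 'b) tensor \<Rightarrow> ('a, 'b) tensor" is
  "\<lambda>c. image_mset (\<lambda>(a, b). (c *\<^sub>C a, b))"
  by (rule tensor_rel_scale)

definition uminus_tensor :: "('a, 'b) tensor \<Rightarrow> ('a, 'b) tensor" where
  "uminus_tensor t = (- 1) *\<^sub>C t"

definition minus_tensor :: "('a, 'b) tensor \<Rightarrow> ('a, 'b) tensor \<Rightarrow> ('a, 'b) tensor" where
  "minus_tensor t s = t + - s"

instance
proof
  fix s t u :: "('a, 'b) tensor" and c d :: complex
  show "s + t + u = s + (t + u)" "s + t = t + s" "0 + t = t"
    by (transfer, simp add: tensor_refl ac_simps)+
  show cr: "c *\<^sub>C (s + t) = c *\<^sub>C s + c *\<^sub>C t" by (transfer, simp add: tensor_refl)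
  show cl: "(c + d) *\<^sub>C t = c *\<^sub>C t + d *\<^sub>C t" for c d and t :: "('a, 'b) tensor"
  proof (transfer, goal_cases)
    case (1 c d t)
    show ?case
    proof (induction t)
      case (add x t)
      obtain a b where x: "x = (a, b)" by force
      have "tensor_rel {#((c + d) *\<^sub>C a, b)#} {#(c *\<^sub>C a, b), (d *\<^sub>C a, b)#}"
        by (simp add: cscale_add_left tensor_add_left)
      from tensor_rel_add[OF this add] show ?case by (simp add: x add_mset_commute)
    qed (simp add: tensor_refl)
  qed
  show "c *\<^sub>C d *\<^sub>C t = (c * d) *\<^sub>C t"
    by (transfer, simp add: image_mset.compositionality o_def case_prod_unfold cscale_cscale
        tensor_refl)
  show one: "1 *\<^sub>C t = t" for t :: "('a, 'b) tensor"
    by (transfer, simp add: cscale_one tensor_refl case_prod_unfold)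
  have zero: "0 *\<^sub>C t = 0" for t :: "('a, 'b) tensor"
  proof (transfer, goal_cases)
    case (1 t)
    show ?case
    proof (induction t)
      case (add x t)
      obtain a b where x: "x = (a, b)" by force
      from tensor_rel_add[OF tensor_zero[of b] add] show ?case by (simp add: x)
    qed (simp add: tensor_refl)
  qed
  show "- t + t = 0"
    using cl[of "-1" 1 t] by (simp add: uminus_tensor_def one zero)
  show "s - t = s + - t" by (simp add: minus_tensor_def)
qed

end

lift_definition pure_tensor :: "'a::complex_vector \<Rightarrow> 'b::complex_vector \<Rightarrow> ('a, 'b) tensor"
    (infixr \<open>\<otimes>\<^sub>C\<close> 76)
  is "\<lambda>a b. {#(a, b)#}" .

definition cbilinear :: "('a::complex_vector \<Rightarrow> 'b::complex_vector \<Rightarrow> 'c::complex_vector) \<Rightarrow> bool"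
  where "cbilinear f \<longleftrightarrow> (\<forall>b. clinear (\<lambda>a. f a b)) \<and> (\<forall>a. clinear (f a))"

text \<open>
  The linear map on the tensor product that corresponds to \<open>f\<close>; it is computed on a
  representative, so it is meaningful for bilinear \<open>f\<close> only.
\<close>

definition tlift :: "('a::complex_vector \<Rightarrow> 'b::complex_vector \<Rightarrow> 'c::complex_vector)
    \<Rightarrow> ('a, 'b) tensor \<Rightarrow> 'c" where
  "tlift f t = (\<Sum>(a, b)\<in>#rep_tensor t. f a b)"

definition tmap :: "('a::complex_vector \<Rightarrow> 'c::complex_vector) \<Rightarrow>
    ('b::complex_vector \<Rightarrow> 'd::complex_vector) \<Rightarrow> ('a, 'b) tensor \<Rightarrow> ('c, 'd) tensor" where
  "tmap f g = tlift (\<lambda>a b. f a \<otimes>\<^sub>C g b)"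

definition tassoc :: "(('a::complex_vector, 'b::complex_vector) tensor, 'c::complex_vector) tensor
    \<Rightarrow> ('a, ('b, 'c) tensor) tensor" where
  "tassoc = tlift (\<lambda>t c. tlift (\<lambda>a b. a \<otimes>\<^sub>C (b \<otimes>\<^sub>C c)) t)"

lemma cbilinear_iff: "cbilinear f \<longleftrightarrow>
   (\<forall>a a' b. f (a + a') b = f a b + f a' b) \<and> (\<forall>a b b'. f a (b + b') = f a b + f a b') \<and>
   (\<forall>c a b. f (c *\<^sub>C a) b = c *\<^sub>C f a b) \<and> (\<forall>c a b. f a (c *\<^sub>C b) = c *\<^sub>C f a b)"
  by (auto simp: cbilinear_def clinear_iff)

lemma tensor_rel_sum:
  assumes "cbilinear f" "tensor_rel M N"
  shows "(\<Sum>(a, b)\<in>#M. f a b) = (\<Sum>(a, b)\<in>#N. f a b)"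
  using assms(2)
proof induction
  case (tensor_zero b)
  have "f (0 + 0) b = f 0 b + f 0 b" using assms(1) unfolding cbilinear_iff by blast
  then show ?case by simp
qed (use assms(1) in \<open>auto simp: cbilinear_iff\<close>)

lemma rep_abs_tensor: "tensor_rel (rep_tensor (abs_tensor M)) M"
  by (meson Quotient3_tensor rep_abs_rsp tensor_refl tensor_sym)

lemma tlift_abs: "cbilinear f \<Longrightarrow> tlift f (abs_tensor M) = (\<Sum>(a, b)\<in>#M. f a b)"
  unfolding tlift_def by (rule tensor_rel_sum[OF _ rep_abs_tensor])

lemma tlift_pure: "cbilinear f \<Longrightarrow> tlift f (a \<otimes>\<^sub>C b) = f a b"
  by (simp add: pure_tensor.abs_eq tlift_abs)

lemma tlift_0: "cbilinear f \<Longrightarrow> tlift f 0 = 0"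
  by (simp add: zero_tensor.abs_eq tlift_abs)

lemma tlift_add: "cbilinear f \<Longrightarrow> tlift f (s + t) = tlift f s + tlift f t"
  by (induction s rule: tensor.abs_induct, induction t rule: tensor.abs_induct)
    (simp add: plus_tensor.abs_eq tlift_abs)

lemma tlift_cscale:
  assumes "cbilinear f"
  shows "tlift f (c *\<^sub>C t) = c *\<^sub>C tlift f t"
proof (induction t rule: tensor.abs_induct[case_names abs])
  case (abs M)
  have "(\<Sum>(a, b)\<in>#image_mset (\<lambda>(a, b). (c *\<^sub>C a, b)) M. f a b) = c *\<^sub>C (\<Sum>(a, b)\<in>#M. f a b)"
    using assms by (induction M) (auto simp: cbilinear_iff cscale_add_right)
  then show ?case by (simp only: cscale_tensor.abs_eq tlift_abs[OF assms])
qed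

lemma clinear_tlift: "cbilinear f \<Longrightarrow> clinear (tlift f)"
  by (simp add: clinear_iff tlift_add tlift_cscale)

lemma pure_tensor_simps:
  "(a + a') \<otimes>\<^sub>C b = a \<otimes>\<^sub>C b + a' \<otimes>\<^sub>C b"
  "a \<otimes>\<^sub>C (b + b') = a \<otimes>\<^sub>C b + a \<otimes>\<^sub>C b'"
  "(c *\<^sub>C a) \<otimes>\<^sub>C b = c *\<^sub>C (a \<otimes>\<^sub>C b)"
  "a \<otimes>\<^sub>C (c *\<^sub>C b) = c *\<^sub>C (a \<otimes>\<^sub>C b)"
proof -
  have *: "tensor_rel {#(a + a', b)#} ({#(a, b)#} + {#(a', b)#})"
      "tensor_rel {#(d, b + b')#} ({#(d, b)#} + {#(d, b')#})"
    for a a' d :: 'a and b b' :: 'b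
    using tensor_add_left[of a a' b] tensor_add_right[of d b b']
    by (simp_all add: add_mset_commute)
  show "(a + a') \<otimes>\<^sub>C b = a \<otimes>\<^sub>C b + a' \<otimes>\<^sub>C b"
    by transfer (rule *)
  show "a \<otimes>\<^sub>C (b + b') = a \<otimes>\<^sub>C b + a \<otimes>\<^sub>C b'"
    by transfer (rule *)
  show "(c *\<^sub>C a) \<otimes>\<^sub>C b = c *\<^sub>C (a \<otimes>\<^sub>C b)"
    by transfer (simp add: tensor_refl)
  show "a \<otimes>\<^sub>C (c *\<^sub>C b) = c *\<^sub>C (a \<otimes>\<^sub>C b)"
    by transfer (simp add: tensor_sym[OF tensor_scale])
qed

lemma cbilinear_pure_tensor: "cbilinear (\<otimes>\<^sub>C)"
  by (simp add: cbilinear_iff pure_tensor_simps)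

lemma tensor_induct [case_names zero add]:
  assumes "P 0" "\<And>a b t. P t \<Longrightarrow> P (a \<otimes>\<^sub>C b + t)"
  shows "P t"
proof (induction t rule: tensor.abs_induct[case_names abs])
  case (abs M)
  show ?case
  proof (induction M)
    case (add x M)
    obtain a b where x: "x = (a, b)" by force
    have eq: "abs_tensor (add_mset x M) = a \<otimes>\<^sub>C b + abs_tensor M"
      by (simp add: x pure_tensor.abs_eq plus_tensor.abs_eq)
    show ?case unfolding eq by (rule assms(2)) (rule add)
  qed (use assms(1) in \<open>simp add: zero_tensor.abs_eq\<close>)
qed

lemma cbilinear_tlift:
  assumes F: "\<And>a b. cbilinear (F a b)" and G: "\<And>c d. cbilinear (\<lambda>a b. F a b c d)"
  shows "cbilinear (\<lambda>a b. tlift (F a b) s)"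
proof (induction s rule: tensor_induct)
  case zero
  show ?case by (simp add: tlift_0[OF F] cbilinear_iff)
next
  case (add c d s)
  then show ?case
    using G[of c d]
    by (simp add: tlift_add[OF F] tlift_pure[OF F] cbilinear_iff cscale_add_right add_ac)
qed

lemma tensor_homogeneous_induct [case_names zero add]:
  fixes t :: "('a::super_vector_space, 'b::super_vector_space) tensor"
  assumes "P 0"
    "\<And>a b p q t. hcomp p a = a \<Longrightarrow> hcomp q b = b \<Longrightarrow> P t \<Longrightarrow> P (a \<otimes>\<^sub>C b + t)"
  shows "P t"
proof (induction t rule: tensor_induct)
  case (add a b t)
  have "a \<otimes>\<^sub>C b = (hcomp 0 a + hcomp 1 a) \<otimes>\<^sub>C (hcomp 0 b + hcomp 1 b)"
    by (simp add: hcomp_sum)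
  then have eq: "a \<otimes>\<^sub>C b + t = hcomp 0 a \<otimes>\<^sub>C hcomp 0 b + (hcomp 0 a \<otimes>\<^sub>C hcomp 1 b +
      (hcomp 1 a \<otimes>\<^sub>C hcomp 0 b + (hcomp 1 a \<otimes>\<^sub>C hcomp 1 b + t)))"
    by (simp add: pure_tensor_simps add_ac)
  show ?case
    unfolding eq by (intro assms(2)[OF hcomp_idem hcomp_idem] add.IH)
qed (rule assms(1))

instantiation tensor :: (super_vector_space, super_vector_space) super_vector_space
begin

definition hcomp_tensor :: "bit \<Rightarrow> ('a, 'b) tensor \<Rightarrow> ('a, 'b) tensor" where
  "hcomp_tensor p = tlift (\<lambda>a b. \<Sum>q\<in>{0, 1}. hcomp q a \<otimes>\<^sub>C hcomp (p + q) b)"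

lemma hcomp_tensor_bilinear:
  "cbilinear (\<lambda>(a::'a) (b::'b). \<Sum>q\<in>{0, 1}. hcomp q a \<otimes>\<^sub>C hcomp (p + q) b)"
  by (auto simp: cbilinear_iff hcomp_add hcomp_cscale pure_tensor_simps cscale_add_right)

lemma hcomp_pure_tensor:
  "hcomp p ((a::'a) \<otimes>\<^sub>C (b::'b)) = (\<Sum>q\<in>{0, 1}. hcomp q a \<otimes>\<^sub>C hcomp (p + q) b)"
  unfolding hcomp_tensor_def by (rule tlift_pure[OF hcomp_tensor_bilinear])

lemma hcomp_tensor_linear:
  "hcomp p (s + t) = hcomp p s + hcomp p (t :: ('a, 'b) tensor)"
  "hcomp p (c *\<^sub>C t) = c *\<^sub>C hcomp p (t :: ('a, 'b) tensor)"
  "hcomp p (0 :: ('a, 'b) tensor) = 0"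
  unfolding hcomp_tensor_def
  by (simp_all only: tlift_add tlift_cscale tlift_0 hcomp_tensor_bilinear)

lemma pure_tensor_0 [simp]: "(0::'a) \<otimes>\<^sub>C (b::'b) = 0" "(a::'a) \<otimes>\<^sub>C (0::'b) = 0"
  using pure_tensor_simps(1)[of 0 0 b] pure_tensor_simps(2)[of a 0 0] by simp_all

lemma hcomp_pure_homogeneous:
  assumes "hcomp r a = a" "hcomp s b = b"
  shows "hcomp p ((a::'a) \<otimes>\<^sub>C (b::'b)) = (if p = r + s then a \<otimes>\<^sub>C b else 0)"
  by (cases p; cases r; cases s)
    (simp_all add: hcomp_pure_tensor hcomp_homogeneous[OF assms(1)] hcomp_homogeneous[OF assms(2)])

instance
proof
  fix s t :: "('a, 'b) tensor" and p q c
  show "hcomp p (s + t) = hcomp p s + hcomp p t" "hcomp p (c *\<^sub>C t) = c *\<^sub>C hcomp p t"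
    by (rule hcomp_tensor_linear)+
  show "hcomp p (hcomp q t) = (if p = q then hcomp p t else 0)"
    by (induction t rule: tensor_homogeneous_induct)
      (auto simp: hcomp_tensor_linear hcomp_pure_homogeneous)
  show "hcomp 0 t + hcomp 1 t = t"
  proof (induction t rule: tensor_homogeneous_induct)
    case (add a b p q t)
    then show ?case
      by (cases p; cases q)
        (simp_all add: hcomp_tensor_linear hcomp_pure_homogeneous[OF add(1,2)] add_ac
          add.left_commute)
  qed (simp add: hcomp_tensor_linear)
qed

end

text \<open>
  \<open>(a \<otimes> b) (a' \<otimes> b') = (- 1) ^ (|b| |a'|) (a a' \<otimes> b b')\<close> for homogeneous \<open>b\<close> and \<open>a'\<close>,
  extended bilinearly.
\<close>

instantiation tensor :: (super_algebra, super_algebra) super_algebra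
begin

definition one_tensor :: "('a, 'b) tensor" where
  "one_tensor = 1 \<otimes>\<^sub>C 1"

definition times_tensor :: "('a, 'b) tensor \<Rightarrow> ('a, 'b) tensor \<Rightarrow> ('a, 'b) tensor" where
  "times_tensor t s = tlift (\<lambda>a b. tlift (\<lambda>a' b'. \<Sum>p\<in>{0, 1}. \<Sum>q\<in>{0, 1}.
      ksign p q *\<^sub>C ((a * hcomp q a') \<otimes>\<^sub>C (hcomp p b * b'))) s) t"

lemma times_tensor_bilinear1:
  "cbilinear (\<lambda>(a'::'a) (b'::'b). \<Sum>p\<in>{0, 1}. \<Sum>q\<in>{0, 1}.
      ksign p q *\<^sub>C ((a * hcomp q a') \<otimes>\<^sub>C (hcomp p b * b')))"
  by (auto simp: cbilinear_iff hcomp_add hcomp_cscale pure_tensor_simps cscale_add_right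
      distrib_left cscale_mult_right cscale_cscale mult.commute)

lemma times_tensor_bilinear2:
  "cbilinear (\<lambda>(a::'a) (b::'b). tlift (\<lambda>a' b'. \<Sum>p\<in>{0, 1}. \<Sum>q\<in>{0, 1}.
      ksign p q *\<^sub>C ((a * hcomp q a') \<otimes>\<^sub>C (hcomp p b * b'))) s)"
  by (rule cbilinear_tlift[OF times_tensor_bilinear1])
    (auto simp: cbilinear_iff hcomp_add hcomp_cscale pure_tensor_simps cscale_add_right
      distrib_right cscale_mult_left cscale_cscale mult.commute)

lemma times_tensor_linear:
  fixes s t u :: "('a, 'b) tensor"
  shows "(s + t) * u = s * u + t * u" "u * (s + t) = u * s + u * t"
    "(c *\<^sub>C t) * u = c *\<^sub>C (t * u)" "u * (c *\<^sub>C t) = c *\<^sub>C (u * t)"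
    "0 * u = 0" "u * 0 = 0"
proof -
  have left: "(s + t) * u = s * u + t * u" "(c *\<^sub>C t) * u = c *\<^sub>C (t * u)" "0 * u = 0"
    for s t u :: "('a, 'b) tensor"
    unfolding times_tensor_def
    by (rule tlift_add tlift_cscale tlift_0, rule times_tensor_bilinear2)+
  then show "(s + t) * u = s * u + t * u" "(c *\<^sub>C t) * u = c *\<^sub>C (t * u)" "0 * u = 0"
    by blast+
  have pure: "(a \<otimes>\<^sub>C b) * s = tlift (\<lambda>a' b'. \<Sum>p\<in>{0, 1}. \<Sum>q\<in>{0, 1}.
      ksign p q *\<^sub>C ((a * hcomp q a') \<otimes>\<^sub>C (hcomp p b * b'))) s" for a :: 'a and b :: 'b and s
    unfolding times_tensor_def by (rule tlift_pure[OF times_tensor_bilinear2])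
  show "u * (s + t) = u * s + u * t"
    by (induction u rule: tensor_induct)
      (simp_all only: left pure tlift_add[OF times_tensor_bilinear1] add_ac add_0_left)
  show "u * (c *\<^sub>C t) = c *\<^sub>C (u * t)"
    by (induction u rule: tensor_induct)
      (simp_all only: left pure tlift_cscale[OF times_tensor_bilinear1] cscale_add_right
        cvs.scale_zero_right)
  show "u * 0 = 0"
    by (induction u rule: tensor_induct)
      (simp_all only: left pure tlift_0[OF times_tensor_bilinear1] add_0_left)
qed

lemma times_pure_tensor:
  assumes "hcomp p b = b" "hcomp q a' = a'"
  shows "(a \<otimes>\<^sub>C b) * (a' \<otimes>\<^sub>C b') = ksign p q *\<^sub>C (((a::'a) * a') \<otimes>\<^sub>C ((b::'b) * b'))"
proof -
  have "(a \<otimes>\<^sub>C b) * (a' \<otimes>\<^sub>C b') = (\<Sum>p\<in>{0, 1}. \<Sum>q\<in>{0, 1}.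
      ksign p q *\<^sub>C ((a * hcomp q a') \<otimes>\<^sub>C (hcomp p b * b')))"
    unfolding times_tensor_def
    by (subst tlift_pure[OF times_tensor_bilinear2]) (rule tlift_pure[OF times_tensor_bilinear1])
  then show ?thesis
    by (cases p; cases q)
      (simp_all add: hcomp_homogeneous[OF assms(1)] hcomp_homogeneous[OF assms(2)])
qed

lemma pure_one_nonzero: "(1::'a) \<otimes>\<^sub>C (1::'b) \<noteq> 0"
proof
  assume eq: "(1::'a) \<otimes>\<^sub>C (1::'b) = 0"
  have ex: "\<exists>f :: 'c::super_algebra \<Rightarrow> complex. clinear f \<and> f 1 = 1"
  proof -
    interpret pair: vector_space_pair "cscale :: _ \<Rightarrow> 'c \<Rightarrow> _" "cscale :: _ \<Rightarrow> complex \<Rightarrow> _" ..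
    have "\<not> module.dependent cscale {1::'c}" by simp
    from pair.linear_independent_extend[OF this, of "\<lambda>_. 1"] show ?thesis by auto
  qed
  obtain f :: "'a \<Rightarrow> complex" where f: "clinear f" "f 1 = 1" using ex by blast
  obtain g :: "'b \<Rightarrow> complex" where g: "clinear g" "g 1 = 1" using ex by blast
  have bil: "cbilinear (\<lambda>a b. f a * g b)"
    using f(1) g(1)
    by (auto simp: cbilinear_iff clinear_iff algebra_simps cscale_complex_def)
  from tlift_pure[OF bil, of 1 1] eq tlift_0[OF bil] f(2) g(2) show False by simp
qed

lemma times_tensor_assoc: "s * t * u = s * (t * (u :: ('a, 'b) tensor))"
proof (induction s rule: tensor_homogeneous_induct)
  case (add a b p q s)
  note ab = add.hyps
  have "(a \<otimes>\<^sub>C b) * t * u = (a \<otimes>\<^sub>C b) * (t * u)"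
  proof (induction t rule: tensor_homogeneous_induct)
    case (add c d r v t)
    note cd = add.hyps
    have "(a \<otimes>\<^sub>C b) * (c \<otimes>\<^sub>C d) * u = (a \<otimes>\<^sub>C b) * ((c \<otimes>\<^sub>C d) * u)"
    proof (induction u rule: tensor_homogeneous_induct)
      case (add e f w z u)
      note ef = add.hyps
      have sign: "ksign q r * ksign (q + v) w = ksign v w * ksign q (r + w)"
        by (cases q; cases r; cases v; cases w) (simp_all add: ksign_def)
      have "(a \<otimes>\<^sub>C b) * (c \<otimes>\<^sub>C d) * (e \<otimes>\<^sub>C f)
          = (ksign q r * ksign (q + v) w) *\<^sub>C ((a * c * e) \<otimes>\<^sub>C (b * d * f))"
        by (simp only: times_pure_tensor[OF ab(2) cd(1)] times_tensor_linear
            times_pure_tensor[OF hcomp_mult[OF ab(2) cd(2)] ef(1)] cscale_cscale)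
      also have "\<dots> = (a \<otimes>\<^sub>C b) * ((c \<otimes>\<^sub>C d) * (e \<otimes>\<^sub>C f))"
        by (simp only: times_pure_tensor[OF cd(2) ef(1)] times_tensor_linear sign
            times_pure_tensor[OF ab(2) hcomp_mult[OF cd(1) ef(1)]] cscale_cscale mult.assoc)
      finally show ?case by (simp only: times_tensor_linear add.IH)
    qed (simp only: times_tensor_linear)
    then show ?case by (simp only: times_tensor_linear add.IH)
  qed (simp only: times_tensor_linear)
  then show ?case by (simp only: times_tensor_linear add.IH)
qed (simp only: times_tensor_linear)

lemma times_tensor_one: "1 * t = t" "t * 1 = (t :: ('a, 'b) tensor)"
proof -
  have sign: "ksign 0 p = 1" "ksign p 0 = 1" for p
    by (simp_all add: ksign_def)
  show "1 * t = t"
  proof (induction t rule: tensor_homogeneous_induct)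
    case (add a b p q t)
    have "1 * (a \<otimes>\<^sub>C b) = a \<otimes>\<^sub>C b"
      by (simp only: one_tensor_def times_pure_tensor[OF hcomp_one add.hyps(1)] sign cscale_one
          mult_1_left)
    then show ?case by (simp only: times_tensor_linear add.IH)
  qed (simp only: times_tensor_linear)
  show "t * 1 = t"
  proof (induction t rule: tensor_homogeneous_induct)
    case (add a b p q t)
    have "(a \<otimes>\<^sub>C b) * 1 = a \<otimes>\<^sub>C b"
      by (simp only: one_tensor_def times_pure_tensor[OF add.hyps(2) hcomp_one] sign cscale_one
          mult_1_right)
    then show ?case by (simp only: times_tensor_linear add.IH)
  qed (simp only: times_tensor_linear)
qed

lemma hcomp_times_tensor:
  "hcomp r (s * t) = hcomp 0 s * hcomp r t + hcomp 1 s * hcomp (1 + r) (t :: ('a, 'b) tensor)"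
proof (induction s rule: tensor_homogeneous_induct)
  case (add a b p q s)
  note ab = add.hyps
  have "hcomp r ((a \<otimes>\<^sub>C b) * t) =
      hcomp 0 (a \<otimes>\<^sub>C b) * hcomp r t + hcomp 1 (a \<otimes>\<^sub>C b) * hcomp (1 + r) t"
  proof (induction t rule: tensor_homogeneous_induct)
    case (add c d v w t)
    note cd = add.hyps
    have "hcomp r ((a \<otimes>\<^sub>C b) * (c \<otimes>\<^sub>C d)) =
      hcomp 0 (a \<otimes>\<^sub>C b) * hcomp r (c \<otimes>\<^sub>C d) + hcomp 1 (a \<otimes>\<^sub>C b) * hcomp (1 + r) (c \<otimes>\<^sub>C d)"
      unfolding hcomp_pure_homogeneous[OF ab] hcomp_pure_homogeneous[OF cd]
        times_pure_tensor[OF ab(2) cd(1)] hcomp_tensor_linear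
        hcomp_pure_homogeneous[OF hcomp_mult[OF ab(1) cd(1)] hcomp_mult[OF ab(2) cd(2)]]
      by (cases p; cases q; cases v; cases w; cases r)
        (simp_all add: times_tensor_linear times_pure_tensor[OF ab(2) cd(1)])
    then show ?case
      by (simp only: times_tensor_linear hcomp_tensor_linear add.IH add_ac)
  qed (simp only: times_tensor_linear hcomp_tensor_linear add_0_left)
  then show ?case
    by (simp only: times_tensor_linear hcomp_tensor_linear add.IH add_ac)
qed (simp only: times_tensor_linear hcomp_tensor_linear add_0_left)

instance
proof
  fix s t u :: "('a, 'b) tensor" and p q c
  show "(s + t) * u = s * u + t * u" "s * (t + u) = s * t + s * u"
    "(c *\<^sub>C s) * t = c *\<^sub>C (s * t)" "s * (c *\<^sub>C t) = c *\<^sub>C (s * t)"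
    by (rule times_tensor_linear)+
  show "s * t * u = s * (t * u)" by (rule times_tensor_assoc)
  show "1 * t = t" "t * 1 = t" by (rule times_tensor_one)+
  show "(0 :: ('a, 'b) tensor) \<noteq> 1"
    using pure_one_nonzero by (simp add: one_tensor_def)
  show "hcomp 0 (1 :: ('a, 'b) tensor) = 1"
    by (simp add: one_tensor_def hcomp_pure_homogeneous[OF hcomp_one hcomp_one])
  show "hcomp (p + q) (s * t) = s * t" if "hcomp p s = s" "hcomp q t = t"
    using hcomp_homogeneous[OF that(1)] hcomp_homogeneous[OF that(2)]
    by (cases p; cases q) (simp_all add: hcomp_times_tensor times_tensor_linear)
qed

end


section \<open>The spectrum and affine supervarieties\<close>

text \<open>
  The points of \<open>Spec A\<close> are the prime ideals of the even subring, which correspond to the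
  graded prime ideals of \<open>A\<close>.
\<close>

definition even_ring :: "'a::supercommutative_algebra ring" where
  "even_ring = \<lparr>carrier = homogeneous 0, monoid.mult = (*), one = 1, zero = 0, add = (+)\<rparr>"

lemma even_mult:
  "x \<in> homogeneous 0 \<Longrightarrow> y \<in> homogeneous 0 \<Longrightarrow> x * y \<in> homogeneous 0"
  for x :: "'a::super_algebra"
  using hcomp_mult[of 0 x 0 y] by (simp add: homogeneous_def)

lemma even_commute:
  fixes x :: "'a::supercommutative_algebra"
  assumes x: "x \<in> homogeneous 0"
  shows "x * y = y * x"
proof -
  have "x * hcomp p y = hcomp p y * x" for p
    using supercommute[of 0 x p "hcomp p y"] x
    by (simp add: homogeneous_def ksign_def cscale_one)
  then have "x * (hcomp 0 y + hcomp 1 y) = (hcomp 0 y + hcomp 1 y) * x"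
    by (simp only: distrib_left distrib_right)
  then show ?thesis unfolding hcomp_sum .
qed

text \<open>Ordered rewriting that sorts even factors and, in \<open>even_past\<close>, moves them to the left of \<open>x\<close>.\<close>

lemma even_sort:
  "s \<in> homogeneous 0 \<Longrightarrow> t \<in> homogeneous 0 \<Longrightarrow> s * t = t * s"
  "s \<in> homogeneous 0 \<Longrightarrow> t \<in> homogeneous 0 \<Longrightarrow> s * (t * y) = t * (s * y)"
  for s t :: "'a::supercommutative_algebra"
  by (rule even_commute) (metis even_commute mult.assoc)+

lemma even_past:
  "s \<in> homogeneous 0 \<Longrightarrow> x * s = s * x"
  "s \<in> homogeneous 0 \<Longrightarrow> x * (s * y) = s * (x * y)"
  for s x :: "'a::supercommutative_algebra"
  by (metis even_commute mult.assoc)+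

lemma hcomp_uminus: "hcomp p (- x) = - hcomp p (x::'a::super_vector_space)"
  by (metis add.inverse_unique add.right_inverse hcomp_0 hcomp_add)

lemma even_intros:
  "0 \<in> homogeneous 0" "(1::'a) \<in> homogeneous 0"
  "x \<in> homogeneous 0 \<Longrightarrow> y \<in> homogeneous 0 \<Longrightarrow> x + y \<in> homogeneous 0"
  "x \<in> homogeneous 0 \<Longrightarrow> - x \<in> homogeneous 0"
  for x y :: "'a::super_algebra"
  by (simp_all add: homogeneous_def hcomp_one hcomp_add hcomp_uminus)

lemma cring_even_ring: "cring (even_ring :: 'a::supercommutative_algebra ring)"
proof (intro cringI abelian_groupI comm_monoidI)
  fix x :: 'a assume "x \<in> carrier even_ring"
  then show "\<exists>y\<in>carrier even_ring. y \<oplus>\<^bsub>even_ring\<^esub> x = \<zero>\<^bsub>even_ring\<^esub>"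
    by (intro bexI[of _ "- x"]) (auto simp: even_ring_def even_intros)
next
  fix x y :: 'a assume "x \<in> carrier even_ring"
  then show "x \<otimes>\<^bsub>even_ring\<^esub> y = y \<otimes>\<^bsub>even_ring\<^esub> x"
    by (auto simp: even_ring_def intro: even_commute)
qed (auto simp: even_ring_def even_intros even_mult algebra_simps)

definition spec :: "'a::supercommutative_algebra set set" where
  "spec = {P. primeideal P even_ring}"

definition zariski :: "'a::supercommutative_algebra set topology" where
  "zariski = topology (\<lambda>U. \<exists>T\<subseteq>homogeneous 0. U = {P \<in> spec. \<not> T \<subseteq> P})"

lemma specD:
  assumes "P \<in> spec"
  shows "P \<subseteq> homogeneous 0" "0 \<in> P" "1 \<notin> P"
    "x \<in> homogeneous 0 \<Longrightarrow> y \<in> homogeneous 0 \<Longrightarrow> x * y \<in> P \<longleftrightarrow> x \<in> P \<or> y \<in> P"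
proof -
  interpret primeideal P even_ring using assms by (simp add: spec_def)
  show "P \<subseteq> homogeneous 0" "0 \<in> P"
    using a_subset additive_subgroup.zero_closed[OF additive_subgroup_axioms]
    by (auto simp: even_ring_def)
  show "1 \<notin> P"
    using one_imp_carrier I_notcarr by (auto simp: even_ring_def)
  show "x * y \<in> P \<longleftrightarrow> x \<in> P \<or> y \<in> P" if "x \<in> homogeneous 0" "y \<in> homogeneous 0"
    using that I_prime[of x y] I_l_closed[of y x] I_r_closed[of x y]
    by (auto simp: even_ring_def)
qed

lemma openin_zariski:
  "openin zariski U \<longleftrightarrow> (\<exists>T\<subseteq>homogeneous 0. U = {P \<in> spec. \<not> T \<subseteq> P})"
proof -
  let ?open = "\<lambda>U. \<exists>T\<subseteq>homogeneous 0. U = {P \<in> spec :: 'a set set. \<not> T \<subseteq> P}"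
  have "istopology ?open"
    unfolding istopology_def
  proof (intro conjI allI impI)
    fix U V assume "?open U" "?open V"
    then obtain T T' where T: "T \<subseteq> homogeneous 0" "U = {P \<in> spec. \<not> T \<subseteq> P}"
      and T': "T' \<subseteq> homogeneous 0" "V = {P \<in> spec. \<not> T' \<subseteq> P}"
      by blast
    let ?T = "{x * y | x y. x \<in> T \<and> y \<in> T'}"
    have "?T \<subseteq> homogeneous 0" using T(1) T'(1) by (auto intro: even_mult)
    moreover have "\<not> ?T \<subseteq> P \<longleftrightarrow> \<not> T \<subseteq> P \<and> \<not> T' \<subseteq> P" if "P \<in> spec" for P
    proof
      assume "\<not> ?T \<subseteq> P"
      then obtain x y where "x \<in> T" "y \<in> T'" "x * y \<notin> P" by blast
      then show "\<not> T \<subseteq> P \<and> \<not> T' \<subseteq> P"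
        using specD(4)[OF that, of x y] T(1) T'(1) by blast
    next
      assume "\<not> T \<subseteq> P \<and> \<not> T' \<subseteq> P"
      then obtain x y where "x \<in> T" "x \<notin> P" "y \<in> T'" "y \<notin> P" by blast
      then show "\<not> ?T \<subseteq> P"
        using specD(4)[OF that, of x y] T(1) T'(1) by blast
    qed
    moreover have "U \<inter> V = {P \<in> spec. \<not> T \<subseteq> P \<and> \<not> T' \<subseteq> P}"
      unfolding T(2) T'(2) by blast
    ultimately show "?open (U \<inter> V)"
      by (intro exI[of _ ?T] conjI) (simp_all cong: conj_cong)
  next
    fix \<U> assume "\<forall>U\<in>\<U>. ?open U"
    from bchoice[OF this] obtain T
      where T: "\<forall>U\<in>\<U>. T U \<subseteq> homogeneous 0 \<and> U = {P \<in> spec. \<not> T U \<subseteq> P}"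
      by blast
    have "\<Union>\<U> = (\<Union>U\<in>\<U>. {P \<in> spec. \<not> T U \<subseteq> P})"
      using T by auto
    also have "\<dots> = {P \<in> spec. \<not> (\<Union>U\<in>\<U>. T U) \<subseteq> P}"
      by blast
    finally show "?open (\<Union>\<U>)"
      using T by (intro exI[of _ "\<Union>U\<in>\<U>. T U"]) auto
  qed
  then show ?thesis by (simp only: zariski_def topology_inverse')
qed

text \<open>
  \<open>fraction P a s\<close> is the element \<open>a / s\<close> of the localization of \<open>A\<close> at \<open>P\<close>, as an equivalence
  class of pairs; denominators are even, hence central.
\<close>

definition fraction ::
  "'a::supercommutative_algebra set \<Rightarrow> 'a \<Rightarrow> 'a \<Rightarrow> ('a \<times> 'a) set" where
  "fraction P a s = {(b, t). t \<in> homogeneous 0 - P \<and>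
     (\<exists>u\<in>homogeneous 0 - P. u * (t * a - s * b) = 0)}"

definition stalk_ring :: "'a::supercommutative_algebra set \<Rightarrow> ('a \<times> 'a) set ring" where
  "stalk_ring P =
    \<lparr>carrier = {fraction P a s | a s. s \<in> homogeneous 0 - P},
     monoid.mult = (\<lambda>z w. \<Union>(a, s)\<in>z. \<Union>(b, t)\<in>w. fraction P (a * b) (s * t)),
     one = fraction P 1 1,
     zero = fraction P 0 1,
     add = (\<lambda>z w. \<Union>(a, s)\<in>z. \<Union>(b, t)\<in>w. fraction P (t * a + s * b) (s * t))\<rparr>"

lemma fraction_iff:
  "(b, t) \<in> fraction P a s \<longleftrightarrow> t \<in> homogeneous 0 - P \<and>
     (\<exists>u\<in>homogeneous 0 - P. u * (t * a - s * b) = 0)"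
  by (simp add: fraction_def)

lemma denominator_mult:
  "P \<in> spec \<Longrightarrow> s \<in> homogeneous 0 - P \<Longrightarrow> t \<in> homogeneous 0 - P \<Longrightarrow> s * t \<in> homogeneous 0 - P"
  using specD(4)[of P s t] even_mult[of s t] by blast

lemma fraction_eqI:
  assumes P: "P \<in> spec" and s: "s \<in> homogeneous 0 - P" and t: "t \<in> homogeneous 0 - P"
    and u: "u \<in> homogeneous 0 - P" and eq: "u * (t * a - s * b) = 0"
  shows "fraction P a s = fraction P b t"
proof -
  have sub: "fraction P a s \<subseteq> fraction P b t"
    if s: "s \<in> homogeneous 0 - P" and t: "t \<in> homogeneous 0 - P"
      and u: "u \<in> homogeneous 0 - P" and eq: "u * (t * a - s * b) = 0" for a b s t u
  proof (rule subrelI)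
    fix c r assume "(c, r) \<in> fraction P a s"
    then obtain v where r: "r \<in> homogeneous 0 - P" and v: "v \<in> homogeneous 0 - P"
      and eq': "v * (r * a - s * c) = 0"
      by (auto simp: fraction_iff)
    note H = s[THEN DiffD1] t[THEN DiffD1] u[THEN DiffD1] v[THEN DiffD1] r[THEN DiffD1]
    have "(u * v * s) * (r * b - t * c) = (u * t) * (v * (r * a - s * c)) - (v * r) * (u * (t * a - s * b))"
      by (simp add: algebra_simps H even_sort even_past[of _ a] even_past[of _ b] even_past[of _ c])
    then have "(u * v * s) * (r * b - t * c) = 0"
      by (simp add: eq eq')
    moreover have "u * v * s \<in> homogeneous 0 - P"
      by (intro denominator_mult P u v s)
    ultimately show "(c, r) \<in> fraction P b t" using r by (auto simp: fraction_iff)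
  qed
  have "u * (s * b - t * a) = 0"
    using eq by (simp add: algebra_simps)
  with sub[OF s t u eq] sub[OF t s u] show ?thesis by blast
qed

lemma fraction_self: "P \<in> spec \<Longrightarrow> s \<in> homogeneous 0 - P \<Longrightarrow> (a, s) \<in> fraction P a s"
  using specD(3)[of P] even_intros(2) by (auto simp: fraction_iff)

lemma stalk_ring_mult:
  assumes P: "P \<in> spec" and s: "s \<in> homogeneous 0 - P" and t: "t \<in> homogeneous 0 - P"
  shows "fraction P a s \<otimes>\<^bsub>stalk_ring P\<^esub> fraction P b t = fraction P (a * b) (s * t)"
    "fraction P a s \<oplus>\<^bsub>stalk_ring P\<^esub> fraction P b t = fraction P (t * a + s * b) (s * t)"
proof -
  have "fraction P (a' * b') (s' * t') = fraction P (a * b) (s * t) \<and>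
      fraction P (t' * a' + s' * b') (s' * t') = fraction P (t * a + s * b) (s * t)"
    if as: "(a', s') \<in> fraction P a s" and bt: "(b', t') \<in> fraction P b t" for a' s' b' t'
  proof -
    obtain u where s': "s' \<in> homogeneous 0 - P" and u: "u \<in> homogeneous 0 - P"
      and eq1: "u * (s' * a - s * a') = 0"
      using as by (auto simp: fraction_iff)
    obtain v where t': "t' \<in> homogeneous 0 - P" and v: "v \<in> homogeneous 0 - P"
      and eq2: "v * (t' * b - t * b') = 0"
      using bt by (auto simp: fraction_iff)
    note H = s[THEN DiffD1] t[THEN DiffD1] u[THEN DiffD1] v[THEN DiffD1] s'[THEN DiffD1]
      t'[THEN DiffD1]
    note sort = algebra_simps H even_sort even_past[of _ a] even_past[of _ b] even_past[of _ a']
      even_past[of _ b']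
    have m: "(u * v) * ((s' * t') * (a * b) - (s * t) * (a' * b'))
        = t' * v * (u * (s' * a - s * a')) * b + u * s * a' * (v * (t' * b - t * b'))"
      by (simp add: sort)
    have p: "(u * v) * ((s' * t') * (t * a + s * b) - (s * t) * (t' * a' + s' * b'))
        = v * t * t' * (u * (s' * a - s * a')) + u * s * s' * (v * (t' * b - t * b'))"
      by (simp add: sort)
    have d: "u * v \<in> homogeneous 0 - P" "s * t \<in> homogeneous 0 - P" "s' * t' \<in> homogeneous 0 - P"
      by (intro denominator_mult P s t s' t' u v)+
    have "(u * v) * ((s' * t') * (a * b) - (s * t) * (a' * b')) = 0"
      "(u * v) * ((s' * t') * (t * a + s * b) - (s * t) * (t' * a' + s' * b')) = 0"
      unfolding m p eq1 eq2 by simp_all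
    from fraction_eqI[OF P d(2,3,1) this(1)] fraction_eqI[OF P d(2,3,1) this(2)]
    show ?thesis by (intro conjI) (rule sym, assumption)+
  qed
  note eqs = this[THEN conjunct1] this[THEN conjunct2]
  have UN: "(\<Union>x\<in>A. F x) = C" if "x \<in> A" "\<And>x. x \<in> A \<Longrightarrow> F x = C"
    for x :: 'c and A and F :: "'c \<Rightarrow> 'd set" and C
    using that by auto
  note self = fraction_self[OF P s, of a] fraction_self[OF P t, of b]
  show "fraction P a s \<otimes>\<^bsub>stalk_ring P\<^esub> fraction P b t = fraction P (a * b) (s * t)"
    by (simp only: stalk_ring_def monoid.select_convs)
      (rule UN[OF self(1)], clarify, rule UN[OF self(2)], clarify, rule eqs(1))
  show "fraction P a s \<oplus>\<^bsub>stalk_ring P\<^esub> fraction P b t = fraction P (t * a + s * b) (s * t)"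
    by (simp only: stalk_ring_def ring.select_convs)
      (rule UN[OF self(1)], clarify, rule UN[OF self(2)], clarify, rule eqs(2))
qed

lemma ring_stalk_ring:
  assumes P: "P \<in> spec"
  shows "ring (stalk_ring P)"
proof -
  have one: "1 \<in> homogeneous 0 - P" using specD(3)[OF P] even_intros(2) by blast
  have eq: "fraction P a s = fraction P b t"
    if "t * a = s * b" "s \<in> homogeneous 0 - P" "t \<in> homogeneous 0 - P" for a b s t
    using fraction_eqI[OF P that(2,3) one] that(1) by simp
  let ?R = "stalk_ring P"
  have carr: "fraction P a s \<in> carrier ?R" if "s \<in> homogeneous 0 - P" for a s
    using that by (auto simp: stalk_ring_def)
  have E: thesis if "z \<in> carrier ?R"
      "\<And>a s. z = fraction P a s \<Longrightarrow> s \<in> homogeneous 0 - P \<Longrightarrow> thesis" for z thesis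
    using that by (auto simp: stalk_ring_def)
  have one_zero: "\<one>\<^bsub>?R\<^esub> = fraction P 1 1" "\<zero>\<^bsub>?R\<^esub> = fraction P 0 1"
    by (simp_all add: stalk_ring_def)
  note ops = stalk_ring_mult[OF P] denominator_mult[OF P] one carr one_zero
  show ?thesis
  proof (intro ringI abelian_groupI monoidI)
    fix x y assume "x \<in> carrier ?R" "y \<in> carrier ?R"
    then obtain a s b t where x: "x = fraction P a s" "s \<in> homogeneous 0 - P"
      and y: "y = fraction P b t" "t \<in> homogeneous 0 - P"
      by (elim E)
    show "x \<oplus>\<^bsub>?R\<^esub> y \<in> carrier ?R" "x \<otimes>\<^bsub>?R\<^esub> y \<in> carrier ?R"
      by (simp_all only: ops x y)
    have "s * t = t * s" using x(2) even_commute by blast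
    then show "x \<oplus>\<^bsub>?R\<^esub> y = y \<oplus>\<^bsub>?R\<^esub> x"
      by (simp only: ops x y add.commute)
  next
    show "\<zero>\<^bsub>?R\<^esub> \<in> carrier ?R" "\<one>\<^bsub>?R\<^esub> \<in> carrier ?R"
      by (simp_all only: ops)
  next
    fix x assume "x \<in> carrier ?R"
    then obtain a s where x: "x = fraction P a s" "s \<in> homogeneous 0 - P"
      by (elim E)
    have "fraction P 0 (s * s) = fraction P 0 1"
      by (rule eq) (simp_all only: ops x mult_zero_right)
    then have "fraction P (- a) s \<oplus>\<^bsub>?R\<^esub> x = \<zero>\<^bsub>?R\<^esub>"
      by (simp only: ops x mult_minus_right left_minus)
    then show "\<exists>y\<in>carrier ?R. y \<oplus>\<^bsub>?R\<^esub> x = \<zero>\<^bsub>?R\<^esub>"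
      using carr x(2) by blast
    show "\<zero>\<^bsub>?R\<^esub> \<oplus>\<^bsub>?R\<^esub> x = x" "\<one>\<^bsub>?R\<^esub> \<otimes>\<^bsub>?R\<^esub> x = x" "x \<otimes>\<^bsub>?R\<^esub> \<one>\<^bsub>?R\<^esub> = x"
      by (simp_all only: ops x mult_zero_right mult_1_left mult_1_right add_0_left)
  next
    fix x y z assume "x \<in> carrier ?R" "y \<in> carrier ?R" "z \<in> carrier ?R"
    then obtain a s b t c r where x: "x = fraction P a s" "s \<in> homogeneous 0 - P"
      and y: "y = fraction P b t" "t \<in> homogeneous 0 - P"
      and z: "z = fraction P c r" "r \<in> homogeneous 0 - P"
      by (elim E)
    have "t * (s * w) = s * (t * w)" "r * (s * w) = s * (r * w)" "r * (t * w) = t * (r * w)"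
      "c * (s * w) = s * (c * w)" "c * (t * w) = t * (c * w)" for w
      by (rule even_past(2)[OF DiffD1[OF x(2)]] even_past(2)[OF DiffD1[OF y(2)]])+
    note sort = distrib_left distrib_right mult.assoc add.assoc this
    show "x \<oplus>\<^bsub>?R\<^esub> y \<oplus>\<^bsub>?R\<^esub> z = x \<oplus>\<^bsub>?R\<^esub> (y \<oplus>\<^bsub>?R\<^esub> z)"
    proof -
      have "fraction P (r * (t * a + s * b) + s * t * c) (s * t * r) =
          fraction P (t * r * a + s * (r * b + t * c)) (s * (t * r))"
        by (rule eq, simp only: sort) (intro denominator_mult[OF P] x y z)+
      then show ?thesis by (simp only: ops x y z)
    qed
    show "x \<otimes>\<^bsub>?R\<^esub> y \<otimes>\<^bsub>?R\<^esub> z = x \<otimes>\<^bsub>?R\<^esub> (y \<otimes>\<^bsub>?R\<^esub> z)"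
      by (simp only: ops x y z mult.assoc)
    show "(x \<oplus>\<^bsub>?R\<^esub> y) \<otimes>\<^bsub>?R\<^esub> z = x \<otimes>\<^bsub>?R\<^esub> z \<oplus>\<^bsub>?R\<^esub> y \<otimes>\<^bsub>?R\<^esub> z"
    proof -
      have "fraction P ((t * a + s * b) * c) (s * t * r) =
          fraction P (t * r * (a * c) + s * r * (b * c)) (s * r * (t * r))"
        by (rule eq, simp only: sort) (intro denominator_mult[OF P] x y z)+
      then show ?thesis by (simp only: ops x y z)
    qed
    show "z \<otimes>\<^bsub>?R\<^esub> (x \<oplus>\<^bsub>?R\<^esub> y) = z \<otimes>\<^bsub>?R\<^esub> x \<oplus>\<^bsub>?R\<^esub> z \<otimes>\<^bsub>?R\<^esub> y"
    proof -
      have "fraction P (c * (t * a + s * b)) (r * (s * t)) =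
          fraction P (r * t * (c * a) + r * s * (c * b)) (r * s * (r * t))"
        by (rule eq, simp only: sort) (intro denominator_mult[OF P] x y z)+
      then show ?thesis by (simp only: ops x y z)
    qed
  qed
qed

definition stalk_odd :: "'a::supercommutative_algebra set \<Rightarrow> ('a \<times> 'a) set set" where
  "stalk_odd P = {fraction P a s | a s. a \<in> homogeneous 1 \<and> s \<in> homogeneous 0 - P}"

text \<open>Sections of the structure sheaf: families of germs that are locally given by one fraction.\<close>

definition spec_sections :: "'a::supercommutative_algebra set set \<Rightarrow>
    ('a set \<Rightarrow> ('a \<times> 'a) set) set" where
  "spec_sections U = {\<sigma> \<in> extensional U. \<forall>P\<in>U. \<exists>V a s. openin zariski V \<and> P \<in> V \<and> V \<subseteq> U \<and>
     s \<in> homogeneous 0 \<and> (\<forall>Q\<in>V. s \<notin> Q \<and> \<sigma> Q = fraction Q a s)}"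

definition irreducible_space :: "'a topology \<Rightarrow> bool" where
  "irreducible_space X \<longleftrightarrow> topspace X \<noteq> {} \<and>
     (\<forall>U V. openin X U \<longrightarrow> openin X V \<longrightarrow> U \<noteq> {} \<longrightarrow> V \<noteq> {} \<longrightarrow> U \<inter> V \<noteq> {})"

definition generic_point :: "'a topology \<Rightarrow> 'a \<Rightarrow> bool" where
  "generic_point X x \<longleftrightarrow> x \<in> topspace X \<and> X closure_of {x} = topspace X"

definition zero_divisors :: "('a, 'm) ring_scheme \<Rightarrow> 'a set" where
  "zero_divisors R = {z \<in> carrier R. \<exists>w\<in>carrier R. w \<noteq> \<zero>\<^bsub>R\<^esub> \<and>
     (z \<otimes>\<^bsub>R\<^esub> w = \<zero>\<^bsub>R\<^esub> \<or> w \<otimes>\<^bsub>R\<^esub> z = \<zero>\<^bsub>R\<^esub>)}"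

inductive_set subalgebra_generated :: "'a::super_algebra set \<Rightarrow> 'a set" for F where
  "x \<in> F \<Longrightarrow> x \<in> subalgebra_generated F"
| "1 \<in> subalgebra_generated F"
| "x \<in> subalgebra_generated F \<Longrightarrow> y \<in> subalgebra_generated F \<Longrightarrow> x + y \<in> subalgebra_generated F"
| "x \<in> subalgebra_generated F \<Longrightarrow> y \<in> subalgebra_generated F \<Longrightarrow> x * y \<in> subalgebra_generated F"
| "x \<in> subalgebra_generated F \<Longrightarrow> c *\<^sub>C x \<in> subalgebra_generated F"

text \<open>
  \<open>Spec A\<close> is a supervariety, where \<open>A\<close> is the type \<open>'a\<close>.  Every section over a nonempty open
  set has a germ at the generic point \<open>\<eta>\<close>, and the stalk there is the localization of \<open>A\<close> at
  \<open>\<eta>\<close>.  The whole space serves as the finite affine cover, and separatedness is automatic for an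
  affine superscheme.
\<close>

definition affine_supervariety :: "'a::supercommutative_algebra itself \<Rightarrow> bool" where
  "affine_supervariety A \<longleftrightarrow>
     (\<exists>F::'a set. finite F \<and> subalgebra_generated F = UNIV) \<and>
     irreducible_space (zariski :: 'a set topology) \<and>
     (\<exists>\<eta>::'a set. generic_point zariski \<eta> \<and>
        (\<forall>U. openin zariski U \<longrightarrow> U \<noteq> {} \<longrightarrow> inj_on (\<lambda>\<sigma>. \<sigma> \<eta>) (spec_sections U)) \<and>
        zero_divisors (stalk_ring \<eta>) = genideal (stalk_ring \<eta>) (stalk_odd \<eta>))"


section \<open>Algebraic supergroups, actions and modules\<close>

text \<open>
  An affine algebraic supergroup \<open>G\<close> is given by its coordinate superalgebra \<open>\<complex>[G]\<close>, the type
  \<open>'g\<close>, with the pullbacks \<open>\<Delta>\<close>, \<open>\<epsilon>\<close> and \<open>S\<close> along multiplication, unit and inverse.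
\<close>

definition affine_supergroup :: "('g::supercommutative_algebra \<Rightarrow> ('g, 'g) tensor) \<Rightarrow>
    ('g \<Rightarrow> complex) \<Rightarrow> ('g \<Rightarrow> 'g) \<Rightarrow> bool" where
  "affine_supergroup \<Delta> \<epsilon> S \<longleftrightarrow>
     affine_supervariety TYPE('g) \<and>
     superalgebra_hom \<Delta> \<and> superalgebra_hom \<epsilon> \<and> superalgebra_hom S \<and>
     (\<forall>x. tassoc (tmap \<Delta> id (\<Delta> x)) = tmap id \<Delta> (\<Delta> x)) \<and>
     (\<forall>x. tlift (\<lambda>a b. \<epsilon> a *\<^sub>C b) (\<Delta> x) = x) \<and>
     (\<forall>x. tlift (\<lambda>a b. \<epsilon> b *\<^sub>C a) (\<Delta> x) = x) \<and>
     (\<forall>x. tlift (\<lambda>a b. S a * b) (\<Delta> x) = \<epsilon> x *\<^sub>C 1) \<and>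
     (\<forall>x. tlift (\<lambda>a b. a * S b) (\<Delta> x) = \<epsilon> x *\<^sub>C 1)"

text \<open>\<open>\<alpha> : \<complex>[X] \<rightarrow> \<complex>[G] \<otimes> \<complex>[X]\<close> is the pullback along a left action \<open>G \<times> X \<rightarrow> X\<close>.\<close>

definition affine_G_supervariety :: "('g::supercommutative_algebra \<Rightarrow> ('g, 'g) tensor) \<Rightarrow>
    ('g \<Rightarrow> complex) \<Rightarrow> ('x::supercommutative_algebra \<Rightarrow> ('g, 'x) tensor) \<Rightarrow> bool" where
  "affine_G_supervariety \<Delta> \<epsilon> \<alpha> \<longleftrightarrow>
     affine_supervariety TYPE('x) \<and>
     superalgebra_hom \<alpha> \<and>
     (\<forall>f. tassoc (tmap \<Delta> id (\<alpha> f)) = tmap id \<alpha> (\<alpha> f)) \<and>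
     (\<forall>f. tlift (\<lambda>g h. \<epsilon> g *\<^sub>C h) (\<alpha> f) = f)"

text \<open>
  A \<open>G\<close>-module is a right \<open>\<complex>[G]\<close>-comodule \<open>\<tau> : V \<rightarrow> V \<otimes> \<complex>[G]\<close>: if \<open>\<tau> v = \<Sum> v\<^sub>i \<otimes> f\<^sub>i\<close>, then a
  point \<open>g\<close> of \<open>G\<close> maps \<open>v\<close> to \<open>\<Sum> f\<^sub>i(g) v\<^sub>i\<close>.
\<close>

definition G_module :: "('g::supercommutative_algebra \<Rightarrow> ('g, 'g) tensor) \<Rightarrow>
    ('g \<Rightarrow> complex) \<Rightarrow> ('v::super_vector_space \<Rightarrow> ('v, 'g) tensor) \<Rightarrow> bool" where
  "G_module \<Delta> \<epsilon> \<tau> \<longleftrightarrow>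
     clinear \<tau> \<and> (\<forall>p v. \<tau> (hcomp p v) = hcomp p (\<tau> v)) \<and>
     (\<forall>v. tassoc (tmap \<tau> id (\<tau> v)) = tmap id \<Delta> (\<tau> v)) \<and>
     (\<forall>v. tlift (\<lambda>w g. \<epsilon> g *\<^sub>C w) (\<tau> v) = v)"

text \<open>
  \<open>\<complex>[X]\<close> as a \<open>G\<close>-module, \<open>(g \<cdot> f)(x) = f (g\<inverse> x)\<close>: apply \<open>\<alpha>\<close>, exchange the factors with the sign
  rule, and apply the antipode to the factor \<open>\<complex>[G]\<close>.
\<close>

definition function_module :: "('g::supercommutative_algebra \<Rightarrow> 'g) \<Rightarrow>
    ('x::supercommutative_algebra \<Rightarrow> ('g, 'x) tensor) \<Rightarrow> 'x \<Rightarrow> ('x, 'g) tensor" where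
  "function_module S \<alpha> f = tlift (\<lambda>g h. \<Sum>p\<in>{0, 1}. \<Sum>q\<in>{0, 1}.
     ksign p q *\<^sub>C (hcomp q h \<otimes>\<^sub>C S (hcomp p g))) (\<alpha> f)"

definition submodule :: "('v::super_vector_space \<Rightarrow> ('v, 'g::supercommutative_algebra) tensor) \<Rightarrow>
    'v set \<Rightarrow> bool" where
  "submodule \<tau> W \<longleftrightarrow> csubspace W \<and> graded W \<and> (\<forall>w\<in>W. \<tau> w \<in> cspan {v \<otimes>\<^sub>C g | v g. v \<in> W})"

definition irreducible_submodule ::
  "('v::super_vector_space \<Rightarrow> ('v, 'g::supercommutative_algebra) tensor) \<Rightarrow> 'v set \<Rightarrow> bool" where
  "irreducible_submodule \<tau> W \<longleftrightarrow> submodule \<tau> W \<and> W \<noteq> {0} \<and>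
     (\<forall>U. submodule \<tau> U \<longrightarrow> U \<subseteq> W \<longrightarrow> U = {0} \<or> U = W)"

definition irreducible_G_module :: "('g::supercommutative_algebra \<Rightarrow> ('g, 'g) tensor) \<Rightarrow>
    ('g \<Rightarrow> complex) \<Rightarrow> ('v::super_vector_space \<Rightarrow> ('v, 'g) tensor) \<Rightarrow> bool" where
  "irreducible_G_module \<Delta> \<epsilon> \<tau> \<longleftrightarrow> G_module \<Delta> \<epsilon> \<tau> \<and> irreducible_submodule \<tau> UNIV"

definition socle :: "('v::super_vector_space \<Rightarrow> ('v, 'g::supercommutative_algebra) tensor) \<Rightarrow>
    'v set" where
  "socle \<tau> = cspan (\<Union>{W. irreducible_submodule \<tau> W})"

text \<open>
  An isomorphism is an equivariant linear bijection that is homogeneous, of either parity: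
  a module and its parity shift are identified.  For right comodules no signs enter the
  equivariance of an odd map.
\<close>

definition isomorphic_to_submodule ::
  "('v::super_vector_space \<Rightarrow> ('v, 'g::supercommutative_algebra) tensor) \<Rightarrow>
   ('w::super_vector_space \<Rightarrow> ('w, 'g) tensor) \<Rightarrow> 'w set \<Rightarrow> bool" where
  "isomorphic_to_submodule \<tau> \<sigma> W \<longleftrightarrow> submodule \<sigma> W \<and>
     (\<exists>\<phi>. clinear \<phi> \<and> bij_betw \<phi> UNIV W \<and> (\<exists>p. \<forall>q v. \<phi> (hcomp q v) = hcomp (q + p) (\<phi> v)) \<and>
        (\<forall>v. \<sigma> (\<phi> v) = tmap \<phi> id (\<tau> v)))"

definition independent_family :: "nat \<Rightarrow> (nat \<Rightarrow> 'v::complex_vector set) \<Rightarrow> bool" where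
  "independent_family n W \<longleftrightarrow>
     (\<forall>w. (\<forall>i<n. w i \<in> W i) \<longrightarrow> (\<Sum>i<n. w i) = 0 \<longrightarrow> (\<forall>i<n. w i = 0))"

text \<open>
  The multiplicity of \<open>\<tau>\<close> in the submodule \<open>M\<close> of \<open>\<sigma>\<close>: the supremum of all \<open>n\<close> such that \<open>M\<close>
  contains a direct sum of \<open>n\<close> copies of \<open>\<tau>\<close>.
\<close>

definition module_multiplicity ::
  "('v::super_vector_space \<Rightarrow> ('v, 'g::supercommutative_algebra) tensor) \<Rightarrow>
   ('w::super_vector_space \<Rightarrow> ('w, 'g) tensor) \<Rightarrow> 'w set \<Rightarrow> enat" where
  "module_multiplicity \<tau> \<sigma> M = (SUP n\<in>{n. \<exists>W. (\<forall>i<n. W i \<subseteq> M \<and> isomorphic_to_submodule \<tau> \<sigma> (W i)) \<and>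
     independent_family n W}. enat n)"


section \<open>The underlying even group\<close>

text \<open>
  A point \<open>\<complex>[G] \<rightarrow> \<complex>\<close> annihilates the odd functions, so the points of \<open>G\<close> are those of \<open>G\<^sub>0\<close>,
  whose coordinate ring is \<open>\<complex>[G]\<close> modulo the ideal generated by the odd functions.
\<close>

definition points :: "('a::supercommutative_algebra \<Rightarrow> complex) set" where
  "points = {x. superalgebra_hom x}"

definition points_topology :: "('a::supercommutative_algebra \<Rightarrow> complex) topology" where
  "points_topology = topology (\<lambda>U. \<exists>T. U = {x \<in> points. \<exists>f\<in>T. x f \<noteq> 0})"

lemma openin_points_topology:
  "openin points_topology U \<longleftrightarrow> (\<exists>T. U = {x \<in> points. \<exists>f\<in>T. x f \<noteq> 0})"
proof -
  let ?open = "\<lambda>U. \<exists>T. U = {x \<in> points :: ('a \<Rightarrow> complex) set. \<exists>f\<in>T. x f \<noteq> 0}"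
  have "istopology ?open"
    unfolding istopology_def
  proof (intro conjI allI impI)
    fix U V assume "?open U" "?open V"
    then obtain T T' where T: "U = {x \<in> points. \<exists>f\<in>T. x f \<noteq> 0}"
      and T': "V = {x \<in> points. \<exists>f\<in>T'. x f \<noteq> 0}"
      by blast
    have mult: "x (f * g) = x f * x g" if "x \<in> points" for x :: "'a \<Rightarrow> complex" and f g
      using that by (simp add: points_def superalgebra_hom_def)
    have "U \<inter> V = {x \<in> points. \<exists>f\<in>T. \<exists>g\<in>T'. x (f * g) \<noteq> 0}"
      unfolding T T' by (auto simp: mult)
    also have "\<dots> = {x \<in> points. \<exists>h\<in>{f * g | f g. f \<in> T \<and> g \<in> T'}. x h \<noteq> 0}"
      by blast
    finally show "?open (U \<inter> V)" by (rule exI)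
  next
    fix \<U> assume "\<forall>U\<in>\<U>. ?open U"
    from bchoice[OF this] obtain T where T: "\<forall>U\<in>\<U>. U = {x \<in> points. \<exists>f\<in>T U. x f \<noteq> 0}"
      by blast
    have "\<Union>\<U> = (\<Union>U\<in>\<U>. {x \<in> points. \<exists>f\<in>T U. x f \<noteq> 0})"
      using T by auto
    also have "\<dots> = {x \<in> points. \<exists>f\<in>\<Union>U\<in>\<U>. T U. x f \<noteq> 0}"
      by blast
    finally show "?open (\<Union>\<U>)" by (rule exI)
  qed
  then show ?thesis by (simp only: points_topology_def topology_inverse')
qed

definition point_group :: "('g::supercommutative_algebra \<Rightarrow> ('g, 'g) tensor) \<Rightarrow>
    ('g \<Rightarrow> complex) \<Rightarrow> ('g \<Rightarrow> complex) monoid" where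
  "point_group \<Delta> \<epsilon> = \<lparr>carrier = points,
     monoid.mult = (\<lambda>x y f. tlift (\<lambda>a b. x a * y b) (\<Delta> f)), one = \<epsilon>\<rparr>"

definition odd_ideal :: "'a::supercommutative_algebra set" where
  "odd_ideal = cspan {a * \<xi> * b | a \<xi> b. \<xi> \<in> homogeneous 1}"

text \<open>The operator \<open>f \<mapsto> f(\<cdot> x)\<close>.\<close>

definition right_translation :: "('g::supercommutative_algebra \<Rightarrow> ('g, 'g) tensor) \<Rightarrow>
    ('g \<Rightarrow> complex) \<Rightarrow> 'g \<Rightarrow> 'g" where
  "right_translation \<Delta> x f = tlift (\<lambda>a b. x b *\<^sub>C a) (\<Delta> f)"

definition unipotent_point :: "('g::supercommutative_algebra \<Rightarrow> ('g, 'g) tensor) \<Rightarrow>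
    ('g \<Rightarrow> complex) \<Rightarrow> bool" where
  "unipotent_point \<Delta> x \<longleftrightarrow>
     (\<forall>f. \<exists>n. ((\<lambda>h. right_translation \<Delta> x h - h) ^^ n) f \<in> odd_ideal)"

text \<open>The unipotent radical is trivial.\<close>

definition reductive_even_group :: "('g::supercommutative_algebra \<Rightarrow> ('g, 'g) tensor) \<Rightarrow>
    ('g \<Rightarrow> complex) \<Rightarrow> bool" where
  "reductive_even_group \<Delta> \<epsilon> \<longleftrightarrow>
     (\<forall>H. normal H (point_group \<Delta> \<epsilon>) \<and> closedin points_topology H \<and>
        connectedin points_topology H \<and> (\<forall>x\<in>H. unipotent_point \<Delta> x) \<longrightarrow> H = {\<epsilon>})"

definition quasireductive :: "('g::supercommutative_algebra \<Rightarrow> ('g, 'g) tensor) \<Rightarrow>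
    ('g \<Rightarrow> complex) \<Rightarrow> ('g \<Rightarrow> 'g) \<Rightarrow> bool" where
  "quasireductive \<Delta> \<epsilon> S \<longleftrightarrow> affine_supergroup \<Delta> \<epsilon> S \<and> reductive_even_group \<Delta> \<epsilon>"


section \<open>The Lie superalgebra\<close>

text \<open>
  The tangent space at \<open>x\<close> consists of the (even and odd) point derivations.  The sign
  \<open>(- 1) ^ (|\<delta>| |f|)\<close> of the super Leibniz rule would multiply \<open>x f\<close>, which vanishes for odd \<open>f\<close>.
\<close>

definition tangent_space :: "('a::supercommutative_algebra \<Rightarrow> complex) \<Rightarrow> ('a \<Rightarrow> complex) set"
  where "tangent_space x = {\<delta>. clinear \<delta> \<and> (\<forall>f h. \<delta> (f * h) = \<delta> f * x h + x f * \<delta> h)}"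

text \<open>
  The product \<open>(u \<otimes> v) \<circ> \<Delta>\<close> of functionals on \<open>\<complex>[G]\<close>, where
  \<open>(u \<otimes> v)(a \<otimes> b) = (- 1) ^ (|v| |a|) u(a) v(b)\<close>.
\<close>

definition convolution :: "('g::supercommutative_algebra \<Rightarrow> ('g, 'g) tensor) \<Rightarrow>
    ('g \<Rightarrow> complex) \<Rightarrow> ('g \<Rightarrow> complex) \<Rightarrow> 'g \<Rightarrow> complex" where
  "convolution \<Delta> u v f = tlift (\<lambda>a b. \<Sum>p\<in>{0, 1}. \<Sum>q\<in>{0, 1}.
     ksign p q * (u (hcomp p a) * v (hcomp q b))) (\<Delta> f)"

definition lie_bracket :: "('g::supercommutative_algebra \<Rightarrow> ('g, 'g) tensor) \<Rightarrow>
    ('g \<Rightarrow> complex) \<Rightarrow> ('g \<Rightarrow> complex) \<Rightarrow> 'g \<Rightarrow> complex" where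
  "lie_bracket \<Delta> u v = (\<Sum>p\<in>{0, 1}. \<Sum>q\<in>{0, 1}.
     convolution \<Delta> (u \<circ> hcomp p) (v \<circ> hcomp q)
     - ksign p q *\<^sub>C convolution \<Delta> (v \<circ> hcomp q) (u \<circ> hcomp p))"

text \<open>\<open>Lie G\<close> is \<open>tangent_space \<epsilon>\<close> with \<open>lie_bracket \<Delta>\<close>.\<close>

definition lie_component :: "bit \<Rightarrow> ('g::supercommutative_algebra \<Rightarrow> complex) set \<Rightarrow>
    ('g \<Rightarrow> complex) set" where
  "lie_component p L = {u \<in> L. u \<circ> hcomp p = u}"

definition bracket_span :: "('g::supercommutative_algebra \<Rightarrow> ('g, 'g) tensor) \<Rightarrow>
    ('g \<Rightarrow> complex) set \<Rightarrow> ('g \<Rightarrow> complex) set \<Rightarrow> ('g \<Rightarrow> complex) set" where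
  "bracket_span \<Delta> L M = cspan {lie_bracket \<Delta> u v | u v. u \<in> L \<and> v \<in> M}"

definition lie_subalgebra :: "('g::supercommutative_algebra \<Rightarrow> ('g, 'g) tensor) \<Rightarrow>
    ('g \<Rightarrow> complex) set \<Rightarrow> ('g \<Rightarrow> complex) set \<Rightarrow> bool" where
  "lie_subalgebra \<Delta> L M \<longleftrightarrow> csubspace M \<and> M \<subseteq> L \<and> (\<forall>u\<in>M. \<forall>p. u \<circ> hcomp p \<in> M) \<and>
     (\<forall>u\<in>M. \<forall>v\<in>M. lie_bracket \<Delta> u v \<in> M)"

definition solvable_lie :: "('g::supercommutative_algebra \<Rightarrow> ('g, 'g) tensor) \<Rightarrow>
    ('g \<Rightarrow> complex) set \<Rightarrow> bool" where
  "solvable_lie \<Delta> L \<longleftrightarrow> (\<exists>n. ((\<lambda>M. bracket_span \<Delta> M M) ^^ n) L = {0})"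

definition borel_subalgebra :: "('g::supercommutative_algebra \<Rightarrow> ('g, 'g) tensor) \<Rightarrow>
    ('g \<Rightarrow> complex) set \<Rightarrow> ('g \<Rightarrow> complex) set \<Rightarrow> bool" where
  "borel_subalgebra \<Delta> L b \<longleftrightarrow> lie_subalgebra \<Delta> L b \<and> solvable_lie \<Delta> b \<and>
     (\<forall>c. lie_subalgebra \<Delta> L c \<longrightarrow> solvable_lie \<Delta> c \<longrightarrow> b \<subseteq> c \<longrightarrow> c = b)"

definition prehyperborel :: "('g::supercommutative_algebra \<Rightarrow> ('g, 'g) tensor) \<Rightarrow>
    ('g \<Rightarrow> complex) set \<Rightarrow> ('g \<Rightarrow> complex) set \<Rightarrow> bool" where
  "prehyperborel \<Delta> L b \<longleftrightarrow> lie_subalgebra \<Delta> L b \<and>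
     borel_subalgebra \<Delta> (lie_component 0 L) (lie_component 0 b) \<and>
     bracket_span \<Delta> (lie_component 1 b) (lie_component 1 b)
       \<subseteq> bracket_span \<Delta> (lie_component 0 b) (lie_component 0 b)"

definition hyperborel_subalgebra :: "('g::supercommutative_algebra \<Rightarrow> ('g, 'g) tensor) \<Rightarrow>
    ('g \<Rightarrow> complex) set \<Rightarrow> ('g \<Rightarrow> complex) set \<Rightarrow> bool" where
  "hyperborel_subalgebra \<Delta> L b \<longleftrightarrow> prehyperborel \<Delta> L b \<and>
     (\<forall>c. prehyperborel \<Delta> L c \<longrightarrow> b \<subseteq> c \<longrightarrow> c = b)"


section \<open>Closed subgroups and spherical supervarieties\<close>

text \<open>
  Closed subgroups \<open>H\<close> of \<open>G\<close> correspond to Hopf ideals \<open>I\<close> of \<open>\<complex>[G]\<close>, with \<open>\<complex>[H] = \<complex>[G] / I\<close>.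
  The points of \<open>H\<close> in \<open>Spec \<complex>[G]\<close> are the primes that contain the even part of \<open>I\<close>, and
  \<open>Lie H\<close> consists of the elements of \<open>Lie G\<close> that vanish on \<open>I\<close>.
\<close>

definition closed_subgroup :: "('g::supercommutative_algebra \<Rightarrow> ('g, 'g) tensor) \<Rightarrow>
    ('g \<Rightarrow> complex) \<Rightarrow> ('g \<Rightarrow> 'g) \<Rightarrow> 'g set \<Rightarrow> bool" where
  "closed_subgroup \<Delta> \<epsilon> S I \<longleftrightarrow> csubspace I \<and> graded I \<and>
     (\<forall>x\<in>I. \<forall>a. a * x \<in> I \<and> x * a \<in> I) \<and>
     (\<forall>x\<in>I. \<Delta> x \<in> cspan {a \<otimes>\<^sub>C b | a b. a \<in> I \<or> b \<in> I}) \<and>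
     (\<forall>x\<in>I. \<epsilon> x = 0) \<and> (\<forall>x\<in>I. S x \<in> I)"

definition connected_subgroup :: "'g::supercommutative_algebra set \<Rightarrow> bool" where
  "connected_subgroup I \<longleftrightarrow> connectedin zariski {P \<in> spec. I \<inter> homogeneous 0 \<subseteq> P}"

definition lie_of_subgroup :: "('g::supercommutative_algebra \<Rightarrow> complex) \<Rightarrow> 'g set \<Rightarrow>
    ('g \<Rightarrow> complex) set" where
  "lie_of_subgroup \<epsilon> I = {u \<in> tangent_space \<epsilon>. \<forall>x\<in>I. u x = 0}"

definition hyperborel_subgroup :: "('g::supercommutative_algebra \<Rightarrow> ('g, 'g) tensor) \<Rightarrow>
    ('g \<Rightarrow> complex) \<Rightarrow> ('g \<Rightarrow> 'g) \<Rightarrow> 'g set \<Rightarrow> bool" where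
  "hyperborel_subgroup \<Delta> \<epsilon> S I \<longleftrightarrow> closed_subgroup \<Delta> \<epsilon> S I \<and> connected_subgroup I \<and>
     hyperborel_subalgebra \<Delta> (tangent_space \<epsilon>) (lie_of_subgroup \<epsilon> I)"

text \<open>The pullback \<open>\<complex>[X] \<rightarrow> \<complex>[G]\<close> along the orbit map \<open>g \<mapsto> g x\<close>.\<close>

definition orbit_pullback :: "('x::supercommutative_algebra \<Rightarrow>
    ('g::supercommutative_algebra, 'x) tensor) \<Rightarrow> ('x \<Rightarrow> complex) \<Rightarrow> 'x \<Rightarrow> 'g" where
  "orbit_pullback \<alpha> x f = tlift (\<lambda>g h. x h *\<^sub>C g) (\<alpha> f)"

text \<open>
  The differential at the identity of the orbit map of some point maps the Lie superalgebra of
  the subgroup \<open>I\<close> onto the tangent space of \<open>X\<close>.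
\<close>

definition has_open_orbit :: "('g::supercommutative_algebra \<Rightarrow> complex) \<Rightarrow>
    ('x::supercommutative_algebra \<Rightarrow> ('g, 'x) tensor) \<Rightarrow> 'g set \<Rightarrow> bool" where
  "has_open_orbit \<epsilon> \<alpha> I \<longleftrightarrow>
     (\<exists>x\<in>points. (\<lambda>u. u \<circ> orbit_pullback \<alpha> x) ` lie_of_subgroup \<epsilon> I = tangent_space x)"

definition spherical :: "('g::supercommutative_algebra \<Rightarrow> ('g, 'g) tensor) \<Rightarrow>
    ('g \<Rightarrow> complex) \<Rightarrow> ('g \<Rightarrow> 'g) \<Rightarrow>
    ('x::supercommutative_algebra \<Rightarrow> ('g, 'x) tensor) \<Rightarrow> bool" where
  "spherical \<Delta> \<epsilon> S \<alpha> \<longleftrightarrow> (\<exists>I. hyperborel_subgroup \<Delta> \<epsilon> S I \<and> has_open_orbit \<epsilon> \<alpha> I)"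

end

(*
  Let b = Lie B, where B is a hyperborel subgroup with an open orbit through the point x of X.
  Since [b1, b1] is contained in [b0, b0], Lie's theorem extends to b: an irreducible (hence
  finite-dimensional) G-module contains a homogeneous vector v that is an eigenvector of b0 and is
  killed by b1.  An equivariant map to C[X] maps v to an eigenfunction f for the derivations by which b
  acts.  An eigenfunction that vanishes at x is zero: since b spans the tangent space at x, an Euler
  derivation shows that f lies in all powers of the ideal m of x, so by Krull's intersection theorem f
  vanishes near x, and X is a supervariety.  Hence an odd eigenfunction is zero, and two even
  eigenfunctions of the same weight are proportional, because a linear combination vanishes at x.
*)
theory Submission
  imports Defs "HOL-Computational_Algebra.Fundamental_Theorem_Algebra"
begin

section \<open>Linear algebra\<close>

text \<open>The points of X do not see nilpotents, so an argument by density of the orbit would lose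
  the odd coordinates. Vanishing is therefore measured by powers of the full maximal ideal m at x,
  and the orbit enters only through its differential. In homogeneous coordinates x_i at x with
  fields D_i of b dual to them, the derivation E = sum x_i D_i acts on m^n / m^(n+1) as
  multiplication by n, while an eigenfunction in m^n is sent to m^(n+1); for n > 0 this raises the
  order of vanishing. As x_i and D_i have equal parity, E is even and satisfies the Leibniz rule
  without signs.

  A supercommutative algebra is not commutative, so the Noetherian arguments rest on homogeneous
  elements, which are normal: moving one across a factor at most applies the parity involution to
  that factor.

  Comodules carry no signs, but the bracket of Lie G does. Unsigned convolution separates the two
  and turns the bracket of odd elements into an anticommutator of operators, up to sign. The weight
  is read off from one vector of the abstract module, so all copies of that module in C[X] share
  it.\<close>

lemma clinearI:
  "(\<And>x y. f (x + y) = f x + f y) \<Longrightarrow> (\<And>c x. f (c *\<^sub>C x) = c *\<^sub>C f x) \<Longrightarrow> clinear f"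
  by (simp add: clinear_iff)

lemma clinear_simps:
  assumes "clinear f"
  shows "f (x + y) = f x + f y" "f (c *\<^sub>C x) = c *\<^sub>C f x" "f 0 = 0" "f (- x) = - f x"
    "f (x - y) = f x - f y" "f (sum g A) = (\<Sum>a\<in>A. f (g a))"
proof -
  interpret Vector_Spaces.linear cscale cscale f by (rule assms)
  show "f (x + y) = f x + f y" "f (c *\<^sub>C x) = c *\<^sub>C f x" "f 0 = 0" "f (- x) = - f x"
    "f (x - y) = f x - f y" "f (sum g A) = (\<Sum>a\<in>A. f (g a))"
    by (rule add scale zero neg diff sum)+
qed

lemma csubspaceI:
  "0 \<in> S \<Longrightarrow> (\<And>x y. x \<in> S \<Longrightarrow> y \<in> S \<Longrightarrow> x + y \<in> S) \<Longrightarrow> (\<And>c x. x \<in> S \<Longrightarrow> c *\<^sub>C x \<in> S) \<Longrightarrow> csubspace S"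
  by (simp add: cvs.subspace_def)

lemma csubspace_image: "clinear f \<Longrightarrow> csubspace S \<Longrightarrow> csubspace (f ` S)"
  by (rule csubspaceI)
    (auto simp: image_iff cvs.subspace_def clinear_simps(1,2)[symmetric]
      intro: bexI[of _ 0] simp: clinear_simps(3))

text \<open>Reduces claims about products and powers of ideals to generators; there \<open>f\<close>
  is multiplication by a ring element or an expression in a derivation.\<close>

lemma cspan_image_closed:
  assumes "clinear f" "csubspace S" "\<And>x. x \<in> B \<Longrightarrow> f x \<in> S" "x \<in> cspan B"
  shows "f x \<in> S"
  using assms(4)
  by (induction rule: cvs.span_induct_alt)
    (auto simp: clinear_simps[OF assms(1)] cvs.subspace_0[OF assms(2)] assms(3)
      intro!: cvs.subspace_add[OF assms(2)] cvs.subspace_scale[OF assms(2)])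

text \<open>Extend a basis of \<open>S\<close> by \<open>y\<close> and prescribe the values. The
  point derivations dual to a basis of the cotangent space arise in this way.\<close>

lemma separating_functional:
  assumes S: "csubspace S" and y: "y \<notin> S"
  obtains f :: "'a::complex_vector \<Rightarrow> complex" where "clinear f" "f y = 1" "\<And>x. x \<in> S \<Longrightarrow> f x = 0"
proof -
  interpret pair: vector_space_pair "cscale :: _ \<Rightarrow> 'a \<Rightarrow> _" "cscale :: _ \<Rightarrow> complex \<Rightarrow> _" ..
  obtain B where B: "B \<subseteq> S" "cvs.independent B" "S \<subseteq> cspan B"
    using cvs.maximal_independent_subset by blast
  have "y \<notin> cspan B" using y B(1) S cvs.span_minimal by blast
  then have "cvs.independent (insert y B)" by (rule cvs.independent_insertI[OF _ B(2)])
  from pair.linear_independent_extend[OF this, of "\<lambda>z. if z = y then 1 else 0"]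
  obtain f :: "'a \<Rightarrow> complex" where f: "clinear f" "\<forall>z\<in>insert y B. f z = (if z = y then 1 else 0)" by blast
  have "f z = 0" if "z \<in> S" for z
  proof -
    have "f z \<in> {0}"
      by (rule cspan_image_closed[OF f(1) _ _ subsetD[OF B(3) that]])
        (use f(2) y B(1) in \<open>auto simp: cvs.subspace_def cscale_complex_def\<close>)
    then show ?thesis by simp
  qed
  then show thesis using f by (intro that[of f]) auto
qed

text \<open>\<open>cvs.dim\<close> is 0 on sets of infinite dimension, so dimension counts carry
  this as a hypothesis. Containment in a span lets it pass to arbitrary subsets.\<close>

definition finite_dim :: "'a::complex_vector set \<Rightarrow> bool" where
  "finite_dim S \<longleftrightarrow> (\<exists>F. finite F \<and> S \<subseteq> cspan F)"

lemma finite_dim_subset: "finite_dim T \<Longrightarrow> S \<subseteq> T \<Longrightarrow> finite_dim S"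
  unfolding finite_dim_def by blast

lemma finite_dim_basis:
  assumes S: "finite_dim S" and B: "B \<subseteq> S" "cvs.independent B"
  obtains C where "B \<subseteq> C" "C \<subseteq> S" "cvs.independent C" "S \<subseteq> cspan C" "finite C"
    "card C = cvs.dim S"
proof -
  obtain C where C: "B \<subseteq> C" "C \<subseteq> S" "cvs.independent C" "S \<subseteq> cspan C"
    using cvs.maximal_independent_subset_extend[OF B] by blast
  obtain F where F: "finite F" "S \<subseteq> cspan F" using S finite_dim_def by blast
  have "finite C" using cvs.independent_span_bound[OF F(1) C(3)] C(2) F(2) by blast
  then show thesis using that C cvs.basis_card_eq_dim[OF C(2,4,3)] by blast
qed

lemma dim_strict_mono:
  assumes "csubspace S" "S \<subset> T" "finite_dim T"
  shows "cvs.dim S < cvs.dim T"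
proof -
  obtain B where B: "B \<subseteq> S" "cvs.independent B" "S \<subseteq> cspan B" "finite B" "card B = cvs.dim S"
    using finite_dim_basis[OF finite_dim_subset[OF assms(3)], of S "{}"] assms(2)
    by (metis cvs.independent_empty empty_subsetI psubset_imp_subset)
  obtain a where a: "a \<in> T" "a \<notin> S" using assms(2) by blast
  have "a \<notin> cspan B" using a B(1) assms(1) cvs.span_minimal by blast
  then have ind: "cvs.independent (insert a B)" by (rule cvs.independent_insertI[OF _ B(2)])
  have sub: "insert a B \<subseteq> T" using a B(1) assms(2) by blast
  obtain C where C: "insert a B \<subseteq> C" "finite C" "card C = cvs.dim T"
    by (rule finite_dim_basis[OF assms(3) sub ind])
  have "card (insert a B) \<le> card C" by (rule card_mono[OF C(2,1)])
  moreover have "a \<notin> B" using a B(1) by blast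
  ultimately show ?thesis using B(4,5) C(3) by simp
qed

text \<open>Extend the kernel vector \<open>s\<close> to a basis; the other basis vectors already
  span the image.\<close>

lemma dim_image_less:
  assumes "finite_dim S" "clinear T" "s \<in> S" "s \<noteq> 0" "T s = 0"
  shows "cvs.dim (T ` S) < cvs.dim S"
proof -
  obtain C where C: "{s} \<subseteq> C" "cvs.independent C" "S \<subseteq> cspan C" "finite C" "card C = cvs.dim S"
    by (rule finite_dim_basis[OF assms(1), of "{s}"]) (use assms(3,4) in simp_all)
  have "T x \<in> cspan (T ` (C - {s}))" if "x \<in> S" for x
  proof (rule cspan_image_closed[OF assms(2) cvs.subspace_span])
    show "T x \<in> cspan (T ` (C - {s}))" if "x \<in> C" for x
      using that assms(5) cvs.span_base[of "T x" "T ` (C - {s})"]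
      by (cases "x = s") (auto simp: cvs.span_zero)
  qed (use that C in auto)
  then have "cvs.dim (T ` S) \<le> card (T ` (C - {s}))"
    by (intro cvs.dim_le_card) (use C in auto)
  also have "\<dots> \<le> card (C - {s})" using C by (intro card_image_le) auto
  also have "\<dots> < card C" using C(1,4) by (intro card_Diff1_less) auto
  finally show ?thesis using C(5) by simp
qed

section \<open>Iterates of an operator and eigenvectors\<close>

lemma krylov:
  fixes T :: "'a::complex_vector \<Rightarrow> 'a"
  assumes "finite_dim S" "\<And>i. (T ^^ i) v \<in> S" "v \<noteq> 0"
  obtains n where "(T ^^ Suc n) v \<in> cspan ((\<lambda>i. (T ^^ i) v) ` {..<Suc n})"
    "(T ^^ n) v \<notin> cspan ((\<lambda>i. (T ^^ i) v) ` {..<n})"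
proof -
  let ?W = "\<lambda>n. (\<lambda>i. (T ^^ i) v) ` {..<n}"
  have "\<exists>n. (T ^^ n) v \<in> cspan (?W n)"
  proof (rule ccontr)
    assume *: "\<nexists>n. (T ^^ n) v \<in> cspan (?W n)"
    have ind: "cvs.independent (?W n) \<and> card (?W n) = n" for n
    proof (induction n)
      case (Suc n)
      have "(T ^^ n) v \<notin> cspan (?W n)" using * by blast
      moreover from this have "(T ^^ n) v \<notin> ?W n" by (rule contrapos_nn) (rule cvs.span_base)
      moreover have "?W (Suc n) = insert ((T ^^ n) v) (?W n)" by (simp only: lessThan_Suc image_insert)
      ultimately show ?case using Suc cvs.independent_insertI[of "(T ^^ n) v" "?W n"] by simp
    qed (simp add: cvs.independent_empty)
    obtain F where F: "finite F" "S \<subseteq> cspan F" using assms(1) finite_dim_def by blast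
    have "?W (Suc (card F)) \<subseteq> cspan F" using F(2) assms(2) by (auto simp del: funpow.simps)
    then have "card (?W (Suc (card F))) \<le> card F"
      using cvs.independent_span_bound[OF F(1) ind[THEN conjunct1]] by blast
    then show False using ind[THEN conjunct2, of "Suc (card F)"] by linarith
  qed
  \<comment> \<open>At the least such \<open>N\<close> the chain of spans stops growing. It is
    positive because \<open>v\<close> is nonzero, and the \<open>n\<close> of the conclusion is its
    predecessor.\<close>
  then obtain N where N: "(T ^^ N) v \<in> cspan (?W N)" "\<And>m. m < N \<Longrightarrow> (T ^^ m) v \<notin> cspan (?W m)"
    unfolding exists_least_iff[of "\<lambda>n. (T ^^ n) v \<in> cspan (?W n)"] by blast
  show thesis
  proof (cases N)
    case 0
    then show ?thesis using N(1) assms(3) by simp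
  next
    case (Suc n)
    show ?thesis using that[of n] N(1) N(2)[of n] unfolding Suc by blast
  qed
qed

lemma cspan_image_lessThan:
  assumes "x \<in> cspan ((f :: nat \<Rightarrow> 'a::complex_vector) ` {..<n})"
  obtains a where "x = (\<Sum>i<n. a i *\<^sub>C f i)"
proof -
  have "\<exists>a. x = (\<Sum>i<n. a i *\<^sub>C f i)"
    using assms
  proof (induction rule: cvs.span_induct_alt)
    case base
    show ?case by (intro exI[of _ "\<lambda>_. 0"]) simp
  next
    case (step c y z)
    then obtain a j where a: "z = (\<Sum>i<n. a i *\<^sub>C f i)" and j: "j < n" "y = f j" by blast
    have "c *\<^sub>C y = (\<Sum>i<n. (if i = j then c else 0) *\<^sub>C f i)"
      using j by (simp add: if_distrib[of "\<lambda>t. t *\<^sub>C _"] cong: if_cong)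
    then have "c *\<^sub>C y + z = (\<Sum>i<n. ((if i = j then c else 0) + a i) *\<^sub>C f i)"
      by (simp only: a cvs.scale_left_distrib sum.distrib)
    then show ?case by (intro exI)
  qed
  then show thesis using that by blast
qed

definition poly_op :: "('a::complex_vector \<Rightarrow> 'a) \<Rightarrow> complex poly \<Rightarrow> 'a \<Rightarrow> 'a" where
  "poly_op T p v = (\<Sum>i\<le>degree p. coeff p i *\<^sub>C (T ^^ i) v)"

lemma poly_op_eq:
  assumes "degree p \<le> n"
  shows "poly_op T p v = (\<Sum>i\<le>n. coeff p i *\<^sub>C (T ^^ i) v)"
  unfolding poly_op_def
  by (rule sum.mono_neutral_left) (use assms in \<open>auto simp: coeff_eq_0\<close>)

lemma poly_op_linear_factor:
  assumes "clinear T"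
  shows "poly_op T ([:- z, 1:] * q) v = T (poly_op T q v) - z *\<^sub>C poly_op T q v"
proof -
  let ?n = "degree q"
  have deg: "degree ([:- z, 1:] * q) \<le> Suc ?n"
    using degree_mult_le[of "[:- z, 1:]" q] by simp
  have c: "coeff ([:- z, 1:] * q) i = (if i = 0 then 0 else coeff q (i - 1)) - z * coeff q i" for i
    by (cases i) simp_all
  have "(\<Sum>i\<le>Suc ?n. (if i = 0 then 0 else coeff q (i - 1)) *\<^sub>C (T ^^ i) v) = T (poly_op T q v)"
    unfolding poly_op_def clinear_simps[OF assms]
    by (subst sum.atMost_Suc_shift) simp
  moreover have "(\<Sum>i\<le>Suc ?n. (z * coeff q i) *\<^sub>C (T ^^ i) v) = z *\<^sub>C poly_op T q v"
    unfolding poly_op_eq[OF le_SucI[OF order_refl]]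
    by (simp only: cvs.scale_sum_right cscale_cscale)
  ultimately show ?thesis
    by (simp only: poly_op_eq[OF deg] c cvs.scale_left_diff_distrib sum_subtractf)
qed

text \<open>Let \<open>p\<close> be the minimal polynomial of \<open>v\<close> under
  \<open>T\<close>, with a root \<open>z\<close> and \<open>p = (X - z) q\<close>. Then
  \<open>q(T) v\<close> is killed by \<open>T - z\<close>, and it is nonzero because
  \<open>q\<close> is monic of degree \<open>n\<close> and \<open>(T ^^ n) v\<close> is independent
  of the lower iterates.\<close>

lemma eigenvector_exists:
  assumes S: "finite_dim S" "csubspace S" "S \<noteq> {0}" and T: "clinear T" "\<And>v. v \<in> S \<Longrightarrow> T v \<in> S"
  obtains v c where "v \<in> S" "v \<noteq> 0" "T v = c *\<^sub>C v"
proof -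
  obtain v where v: "v \<in> S" "v \<noteq> 0" using S(2,3) cvs.subspace_0 by blast
  have orb: "(T ^^ i) v \<in> S" for i by (induction i) (auto simp: v T)
  obtain n where n: "(T ^^ Suc n) v \<in> cspan ((\<lambda>i. (T ^^ i) v) ` {..<Suc n})"
    "(T ^^ n) v \<notin> cspan ((\<lambda>i. (T ^^ i) v) ` {..<n})"
    using krylov[OF S(1) orb v(2)] by blast
  obtain a where a: "(T ^^ Suc n) v = (\<Sum>i<Suc n. a i *\<^sub>C (T ^^ i) v)"
    using cspan_image_lessThan[OF n(1)] by blast
  define p where "p = monom 1 (Suc n) - (\<Sum>i<Suc n. monom (a i) i)"
  have cp: "coeff p k = (if k = Suc n then 1 else if k < Suc n then - a k else 0)" for k
    by (simp add: p_def coeff_sum del: sum.lessThan_Suc)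
  have dp: "degree p = Suc n"
    by (rule antisym) (auto intro!: degree_le le_degree simp: cp)
  have pv: "poly_op T p v = 0"
  proof -
    have "poly_op T p v = (\<Sum>i<Suc n. coeff p i *\<^sub>C (T ^^ i) v) + coeff p (Suc n) *\<^sub>C (T ^^ Suc n) v"
      by (simp only: poly_op_def dp lessThan_Suc_atMost[symmetric] sum.lessThan_Suc)
    also have "(\<Sum>i<Suc n. coeff p i *\<^sub>C (T ^^ i) v) = - (\<Sum>i<Suc n. a i *\<^sub>C (T ^^ i) v)"
      by (simp add: cp sum_negf[symmetric] del: sum.lessThan_Suc)
    finally show ?thesis using a by (simp add: cp)
  qed
  have "\<not> constant (poly p)" by (simp add: constant_degree dp)
  then obtain z where "poly p z = 0" using fundamental_theorem_of_algebra by blast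
  then obtain q where q: "p = [:- z, 1:] * q" using poly_eq_0_iff_dvd by (metis dvdE)
  have "q \<noteq> 0" using q dp by auto
  then have "degree ([:- z, 1:] * q) = Suc (degree q)" by (subst degree_mult_eq) auto
  then have dq: "degree q = n" using q dp by simp
  have "lead_coeff p = 1" by (simp add: dp cp)
  then have cq: "coeff q n = 1" using q dq by (simp add: lead_coeff_mult del: mult_pCons_left)
  define w where "w = poly_op T q v"
  have w: "w = (\<Sum>i<n. coeff q i *\<^sub>C (T ^^ i) v) + (T ^^ n) v"
    by (simp add: w_def poly_op_def dq lessThan_Suc_atMost[symmetric] cq)
  have "w \<noteq> 0"
  proof
    assume "w = 0"
    then have "(T ^^ n) v = - (\<Sum>i<n. coeff q i *\<^sub>C (T ^^ i) v)"
      using w by (simp add: eq_neg_iff_add_eq_0 add.commute)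
    also have "\<dots> \<in> cspan ((\<lambda>i. (T ^^ i) v) ` {..<n})"
      by (intro cvs.span_neg cvs.span_sum cvs.span_scale cvs.span_base) auto
    finally show False using n(2) by blast
  qed
  moreover have "w \<in> S"
    unfolding w_def poly_op_def
    by (intro cvs.subspace_sum cvs.subspace_scale S orb)
  moreover have "T w = z *\<^sub>C w"
    using poly_op_linear_factor[OF T(1), of z q v] pv q by (simp add: w_def)
  ultimately show thesis using that by blast
qed


section \<open>Lie's theorem\<close>

text \<open>
  In the flag \<open>W i\<close> spanned by the \<open>w, y w, \<dots>, y\<^sup>i\<^sup>-\<^sup>1 w\<close> one has
  \<open>h y\<^sup>i w \<equiv> \<mu>(h) y\<^sup>i w + i \<mu>([h, y]) y\<^sup>i\<^sup>-\<^sup>1 w\<close> modulo \<open>W (i - 1)\<close>.  Comparison at the first \<open>i\<close> where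
  the flag is stationary replaces the usual trace argument.
\<close>

lemma weight_vanishes_on_commutators:
  fixes w :: "'v::complex_vector"
  assumes lin: "\<And>h. h \<in> K \<Longrightarrow> clinear h" "clinear y"
    and comm: "\<And>h. h \<in> K \<Longrightarrow> (\<lambda>v. h (y v) - y (h v)) \<in> K"
    and w: "w \<noteq> 0" "\<And>h. h \<in> K \<Longrightarrow> h w = \<mu> h *\<^sub>C w"
    and S: "finite_dim S" "\<And>i. (y ^^ i) w \<in> S"
    and h: "h \<in> K"
  shows "\<mu> (\<lambda>v. h (y v) - y (h v)) = 0"
proof -
  let ?z = "\<lambda>h v. h (y v) - y (h v)"
  define u where "u i = (y ^^ i) w" for i
  \<comment> \<open>\<open>W i\<close> stops before \<open>u i\<close>: the error terms in
    \<open>A\<close> and \<open>B\<close> lie strictly below \<open>u i\<close>.\<close>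
  define W where "W i = cspan (u ` {..<i})" for i
  have W: "csubspace (W i)" for i by (simp add: W_def cvs.subspace_span)
  have uW: "u j \<in> W i" if "j < i" for i j using that by (auto simp: W_def intro: cvs.span_base)
  have Wmono: "W i \<subseteq> W j" if "i \<le> j" for i j
    unfolding W_def using that by (intro cvs.span_mono) auto
  have yu: "y (u i) = u (Suc i)" for i by (simp add: u_def)
  have yW: "y x \<in> W (Suc i)" if "x \<in> W i" for x i
    by (rule cspan_image_closed[OF lin(2) W _ that[unfolded W_def]]) (auto simp: yu intro: uW)
  have A: "h (u i) - \<mu> h *\<^sub>C u i \<in> W i" if "h \<in> K" for i h
    using that
  proof (induction i arbitrary: h)
    case 0
    then show ?case using w(2) by (simp add: u_def W_def)
  next
    case (Suc i)
    have "h (u (Suc i)) - \<mu> h *\<^sub>C u (Suc i) =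
        y (h (u i) - \<mu> h *\<^sub>C u i) + ((?z h (u i) - \<mu> (?z h) *\<^sub>C u i) + \<mu> (?z h) *\<^sub>C u i)"
      by (simp add: clinear_simps[OF lin(2)] yu)
    also have "\<dots> \<in> W (Suc i)"
      by (intro cvs.subspace_add[OF W] yW Suc.IH Suc.prems comm cvs.subspace_scale[OF W] uW
          subsetD[OF Wmono[of i "Suc i"] Suc.IH]) simp_all
    finally show ?case .
  qed
  have B: "h (u (Suc i)) - \<mu> h *\<^sub>C u (Suc i) - (of_nat (Suc i) * \<mu> (?z h)) *\<^sub>C u i \<in> W i"
    if "h \<in> K" for i h
  proof (induction i)
    case 0
    have "h (u (Suc 0)) - \<mu> h *\<^sub>C u (Suc 0) - (of_nat (Suc 0) * \<mu> (?z h)) *\<^sub>C u 0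
        = y (h (u 0) - \<mu> h *\<^sub>C u 0) + (?z h (u 0) - \<mu> (?z h) *\<^sub>C u 0)"
      by (simp add: clinear_simps[OF lin(2)] yu)
    also have "\<dots> = 0"
      using w(2)[OF that] w(2)[OF comm[OF that]] by (simp add: u_def clinear_simps[OF lin(2)])
    finally show ?case by (simp add: cvs.subspace_0[OF W])
  next
    case (Suc i)
    let ?r = "h (u (Suc i)) - \<mu> h *\<^sub>C u (Suc i) - (of_nat (Suc i) * \<mu> (?z h)) *\<^sub>C u i"
    define a where "a = of_nat (Suc i) * \<mu> (?z h)"
    have "(of_nat (Suc (Suc i)) * \<mu> (?z h)) *\<^sub>C u (Suc i) = a *\<^sub>C u (Suc i) + \<mu> (?z h) *\<^sub>C u (Suc i)"
      unfolding a_def cvs.scale_left_distrib[symmetric] by (simp add: distrib_right add_ac)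
    then have "h (u (Suc (Suc i))) - \<mu> h *\<^sub>C u (Suc (Suc i))
          - (of_nat (Suc (Suc i)) * \<mu> (?z h)) *\<^sub>C u (Suc i)
        = y ?r + (?z h (u (Suc i)) - \<mu> (?z h) *\<^sub>C u (Suc i))"
      by (simp add: clinear_simps[OF lin(2)] yu a_def[symmetric] del: of_nat_Suc)
    also have "\<dots> \<in> W (Suc i)"
      by (rule cvs.subspace_add[OF W yW[OF Suc] A[OF comm[OF that]]])
    finally show ?case .
  qed
  obtain n where n: "u (Suc n) \<in> W (Suc n)" "u n \<notin> W n"
    using krylov[OF S w(1)] unfolding u_def W_def by metis
  have lh: "clinear (\<lambda>v. h v - \<mu> h *\<^sub>C v)"
    by (rule clinearI) (simp_all add: clinear_simps[OF lin(1)[OF h]] cscale_add_right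
        cvs.scale_right_diff_distrib cscale_cscale mult.commute)
  \<comment> \<open>By \<open>A\<close> the operator \<open>h - \<mu> h\<close> maps
    \<open>W (Suc n)\<close> into \<open>W n\<close>, and \<open>u (Suc n)\<close> lies in
    \<open>W (Suc n)\<close> by the choice of \<open>n\<close>. Subtracting \<open>B\<close> leaves
    a multiple of \<open>u n\<close>, which is outside \<open>W n\<close>, so its coefficient is
    zero.\<close>
  have "h (u (Suc n)) - \<mu> h *\<^sub>C u (Suc n) \<in> W n"
  proof (rule cspan_image_closed[OF lh W _ n(1)[unfolded W_def]])
    fix x assume "x \<in> u ` {..<Suc n}"
    then obtain j where "j \<le> n" "x = u j" by (auto simp: less_Suc_eq_le)
    then show "h x - \<mu> h *\<^sub>C x \<in> W n" using A[OF h, of j] Wmono[of j n] by blast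
  qed
  from cvs.subspace_diff[OF W this B[OF h, of n]]
  have *: "(of_nat (Suc n) * \<mu> (?z h)) *\<^sub>C u n \<in> W n" by simp
  show ?thesis
  proof (rule ccontr)
    assume "\<mu> (?z h) \<noteq> 0"
    then have ne: "of_nat (Suc n) * \<mu> (?z h) \<noteq> 0" by (simp del: of_nat_Suc)
    show False
      using cvs.subspace_scale[OF W *, of "inverse (of_nat (Suc n) * \<mu> (?z h))"] n(2)
      by (simp only: cscale_cscale left_inverse[OF ne] cscale_one)
  qed
qed

text \<open>The laws are imposed on the set \<open>b\<close> only, because
  \<open>lie_bracket\<close> and \<open>comodule_action\<close> are total functions that behave well
  on suitable functionals alone.\<close>

definition lie_rep :: "('l \<Rightarrow> 'l \<Rightarrow> 'l) \<Rightarrow> ('l::complex_vector \<Rightarrow> 'v::complex_vector \<Rightarrow> 'v) \<Rightarrow> 'l set \<Rightarrow> bool"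
  where "lie_rep br R b \<longleftrightarrow> csubspace b \<and> (\<forall>x\<in>b. \<forall>y\<in>b. br x y \<in> b) \<and> (\<forall>x\<in>b. clinear (R x)) \<and>
    (\<forall>x\<in>b. \<forall>y\<in>b. \<forall>v. R (br x y) v = R x (R y v) - R y (R x v)) \<and>
    (\<forall>x\<in>b. \<forall>y\<in>b. \<forall>v. R (x + y) v = R x v + R y v) \<and> (\<forall>c. \<forall>x\<in>b. \<forall>v. R (c *\<^sub>C x) v = c *\<^sub>C R x v)"

lemma lie_repD:
  assumes "lie_rep br R b"
  shows "csubspace b" "x \<in> b \<Longrightarrow> y \<in> b \<Longrightarrow> br x y \<in> b" "x \<in> b \<Longrightarrow> clinear (R x)"
    "x \<in> b \<Longrightarrow> y \<in> b \<Longrightarrow> R (br x y) v = R x (R y v) - R y (R x v)"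
    "x \<in> b \<Longrightarrow> y \<in> b \<Longrightarrow> R (x + y) v = R x v + R y v" "x \<in> b \<Longrightarrow> R (c *\<^sub>C x) v = c *\<^sub>C R x v"
  using assms unfolding lie_rep_def by blast+

definition derived :: "('l \<Rightarrow> 'l \<Rightarrow> 'l::complex_vector) \<Rightarrow> 'l set \<Rightarrow> 'l set" where
  "derived br b = cspan {br x y | x y. x \<in> b \<and> y \<in> b}"

lemma derived_bracket: "x \<in> b \<Longrightarrow> y \<in> b \<Longrightarrow> br x y \<in> derived br b"
  unfolding derived_def by (intro cvs.span_base) blast

lemma derived_subset: "lie_rep br R b \<Longrightarrow> derived br b \<subseteq> b"
  unfolding derived_def by (rule cvs.span_minimal) (auto simp: lie_repD)

lemma lie_rep_derived:
  assumes "lie_rep br R b"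
  shows "lie_rep br R (derived br b)"
proof -
  note sub = subsetD[OF derived_subset[OF assms]]
  show ?thesis
    unfolding lie_rep_def
  proof (intro conjI ballI allI)
    show "csubspace (derived br b)" by (simp add: derived_def)
  qed (simp_all add: sub derived_bracket lie_repD(3-6)[OF assms])
qed

lemma lie_rep_zero:
  assumes "lie_rep br R b"
  shows "R 0 v = 0"
  using lie_repD(6)[OF assms cvs.subspace_0[OF lie_repD(1)[OF assms]], of 0 v] by simp

text \<open>Commutators act by zero in a one-dimensional representation. Through the hyperborel
  condition this also covers the anticommutators of odd elements.\<close>

lemma derived_kills_eigenvector:
  assumes rep: "lie_rep br R b" and eig: "\<And>x. x \<in> b \<Longrightarrow> \<exists>c. R x v = c *\<^sub>C v" and z: "z \<in> derived br b"
  shows "R z v = 0"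
proof -
  have "z \<in> b \<and> R z v = 0"
    using z unfolding derived_def
  proof (induction rule: cvs.span_induct_alt)
    case base
    then show ?case using cvs.subspace_0[OF lie_repD(1)[OF rep]] lie_rep_zero[OF rep] by blast
  next
    case (step c a d)
    then obtain x y where xy: "x \<in> b" "y \<in> b" "a = br x y" by blast
    obtain e f where ef: "R x v = e *\<^sub>C v" "R y v = f *\<^sub>C v" using eig xy by metis
    have "R a v = 0"
      by (simp add: xy lie_repD(4)[OF rep] ef clinear_simps[OF lie_repD(3)[OF rep]]
          cscale_cscale mult.commute)
    moreover have "a \<in> b" using xy lie_repD(2)[OF rep] by blast
    ultimately show ?case
      using step lie_repD(1)[OF rep]
      by (auto simp: lie_repD(5,6)[OF rep] cvs.subspace_scale cvs.subspace_add)
  qed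
  then show ?thesis by blast
qed

text \<open>Induction on the derived length. In a nonzero stable subspace \<open>M\<close> of least
  dimension, the weight space of the derived algebra is stable and hence all of \<open>M\<close>;
  the same minimality then makes an eigenspace of each single \<open>x\<close> all of
  \<open>M\<close>. So every nonzero vector of \<open>M\<close> is a common eigenvector.\<close>

theorem lie_theorem:
  assumes "lie_rep br R b" "(derived br ^^ n) b = {0}"
    and "csubspace W" "finite_dim W" "W \<noteq> {0}" "\<And>x v. x \<in> b \<Longrightarrow> v \<in> W \<Longrightarrow> R x v \<in> W"
  shows "\<exists>v\<in>W. v \<noteq> 0 \<and> (\<forall>x\<in>b. \<exists>c. R x v = c *\<^sub>C v)"
  using assms
proof (induction n arbitrary: b W)
  case 0
  then have "b = {0}" by simp
  moreover obtain v where "v \<in> W" "v \<noteq> 0" using 0(5) cvs.subspace_0[OF 0(3)] by blast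
  moreover have "R 0 v = 0 *\<^sub>C v" using lie_rep_zero[OF 0(1)] by simp
  ultimately show ?case by blast
next
  case (Suc n)
  note rep = lie_repD[OF Suc.prems(1)]
  let ?D = "derived br b"
  let ?P = "\<lambda>X. csubspace X \<and> X \<noteq> {0} \<and> X \<subseteq> W \<and> (\<forall>x\<in>b. \<forall>v\<in>X. R x v \<in> X)"
  have "?P W" using Suc.prems(3,5,6) by simp
  from ex_has_least_nat[of ?P, OF this, of cvs.dim]
  obtain M where M: "?P M" and least: "\<And>X. ?P X \<Longrightarrow> cvs.dim M \<le> cvs.dim X" by blast
  have fin: "finite_dim M" using M Suc.prems(4) finite_dim_subset by blast
  have irr: "X = M" if "csubspace X" "v \<in> X" "v \<noteq> 0" "X \<subseteq> M" "\<And>x v. x \<in> b \<Longrightarrow> v \<in> X \<Longrightarrow> R x v \<in> X"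
    for X v
  proof (rule ccontr)
    assume "X \<noteq> M"
    then have less: "cvs.dim X < cvs.dim M" using that(4) by (intro dim_strict_mono[OF that(1) _ fin]) blast
    have "X \<noteq> {0}" using that(2,3) by blast
    moreover have "X \<subseteq> W" using that(4) M by blast
    ultimately have "?P X" using that(1,5) by simp
    then show False using least[of X] less by linarith
  qed
  have sub: "?D \<subseteq> b" by (rule derived_subset[OF Suc.prems(1)])
  have solv: "(derived br ^^ n) ?D = {0}" using Suc.prems(2) by (simp add: funpow_swap1)
  have "\<exists>v\<in>M. v \<noteq> 0 \<and> (\<forall>x\<in>?D. \<exists>c. R x v = c *\<^sub>C v)"
    by (rule Suc.IH[OF lie_rep_derived[OF Suc.prems(1)] solv _ fin]) (use M sub in auto)
  then obtain v where v: "v \<in> M" "v \<noteq> 0" "\<forall>x\<in>?D. \<exists>c. R x v = c *\<^sub>C v" by blast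
  have orb: "(R y ^^ i) u \<in> M" if "y \<in> b" "u \<in> M" for y u i
    by (induction i) (use that M in auto)
  \<comment> \<open>The weight takes the operator as argument, not the Lie algebra element, to fit
    \<open>weight_vanishes_on_commutators\<close>. Where there is no eigenvalue its value is
    arbitrary.\<close>
  define l where "l u h = (SOME c. h u = c *\<^sub>C u)" for u :: 'b and h
  have l: "R x u = l u (R x) *\<^sub>C u" if "\<exists>c. R x u = c *\<^sub>C u" for x u
    unfolding l_def by (rule someI_ex[OF that])
  have br_op: "(\<lambda>v. R x (R y v) - R y (R x v)) = R (br x y)" if "x \<in> b" "y \<in> b" for x y
    using rep(4) that by auto
  \<comment> \<open>Every \<open>J\<close> between \<open>?D\<close> and \<open>b\<close> is closed
    under bracketing with \<open>b\<close>. It is used for \<open>?D\<close> itself and for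
    \<open>?D\<close> enlarged by one element.\<close>
  have weight: "l u (R (br x y)) = 0"
    if "u \<in> M" "u \<noteq> 0" "\<forall>x\<in>J. \<exists>c. R x u = c *\<^sub>C u" "?D \<subseteq> J" "J \<subseteq> b" "x \<in> J" "y \<in> b" for u J x y
  proof -
    have "l u (\<lambda>v. R x (R y v) - R y (R x v)) = 0"
    proof (rule weight_vanishes_on_commutators[where K = "R ` J" and S = M and w = u])
      show "(\<lambda>v. h (R y v) - R y (h v)) \<in> R ` J" if "h \<in> R ` J" for h
        using that \<open>?D \<subseteq> J\<close> \<open>J \<subseteq> b\<close> \<open>y \<in> b\<close> derived_bracket[of _ b y br] by (auto simp: br_op subset_iff)
    qed (use that rep l fin orb in auto)
    then show ?thesis using that br_op by (simp add: subset_iff)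
  qed
  let ?X = "{u \<in> M. \<forall>x\<in>?D. R x u = l v (R x) *\<^sub>C u}"
  have X: "?X = M"
  proof (rule irr[of _ v])
    show "csubspace ?X"
      using M rep(3) sub
      by (intro csubspaceI)
        (auto simp: cvs.subspace_0 cvs.subspace_add cvs.subspace_scale clinear_simps subset_iff
          cscale_add_right cscale_cscale mult.commute)
    show "v \<in> ?X" using v l by blast
    fix y u assume y: "y \<in> b" and u: "u \<in> ?X"
    have "R x (R y u) = l v (R x) *\<^sub>C R y u" if x: "x \<in> ?D" for x
    proof -
      have "R x (R y u) = R y (R x u) + R (br x y) u"
        using x y sub rep(4)[of x y u] by (simp add: subset_iff)
      also have "R (br x y) u = l v (R (br x y)) *\<^sub>C u"
        using u x y sub derived_bracket[of x b y br] by blast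
      also have "l v (R (br x y)) = 0"
        by (rule weight[OF v(1,2,3) order_refl sub x y])
      also have "R y (R x u) = l v (R x) *\<^sub>C R y u"
        using u x clinear_simps[OF rep(3)[OF y]] by simp
      finally show ?thesis by simp
    qed
    then show "R y u \<in> ?X" using u y M by blast
  qed (use v in auto)
  have eig: "\<exists>c. R x u = c *\<^sub>C u" if x: "x \<in> b" and u: "u \<in> M" for x u
  proof -
    obtain e c where e: "e \<in> M" "e \<noteq> 0" "R x e = c *\<^sub>C e"
      by (rule eigenvector_exists[OF fin _ _ rep(3)[OF x]]) (use M x in blast)+
    \<comment> \<open>With \<open>x\<close> added to \<open>?D\<close>, the vector \<open>e\<close>
      shows that \<open>br x y\<close> has eigenvalue 0 on it. Since \<open>br x y\<close> acts on
      all of \<open>M\<close> by one scalar, that scalar is 0 and \<open>x\<close> commutes with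
      \<open>y\<close> on \<open>M\<close>.\<close>
    have "\<forall>t\<in>insert x ?D. \<exists>c. R t e = c *\<^sub>C e" using e X by blast
    from weight[OF e(1,2) this] have le: "l e (R (br x y)) = 0" if "y \<in> b" for y
      using sub x that by blast
    have comm: "R x (R y u') = R y (R x u')" if y: "y \<in> b" and u': "u' \<in> M" for y u'
    proof -
      have br: "br x y \<in> ?D" by (rule derived_bracket[OF x y])
      then have "R (br x y) e = l v (R (br x y)) *\<^sub>C e" using e X by blast
      moreover have "R (br x y) e = 0"
        using l[of "br x y" e] le[OF y] \<open>\<forall>t\<in>insert x ?D. _\<close> br by simp
      ultimately have "l v (R (br x y)) = 0" using e(2) by simp
      moreover have "R (br x y) u' = l v (R (br x y)) *\<^sub>C u'" using u' X br by blast
      ultimately show ?thesis using rep(4)[OF x y, of u'] by simp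
    qed
    have "{u \<in> M. R x u = c *\<^sub>C u} = M"
    proof (rule irr[of _ e])
      show "csubspace {u \<in> M. R x u = c *\<^sub>C u}"
        using M rep(3)[OF x]
        by (intro csubspaceI)
          (auto simp: cvs.subspace_0 cvs.subspace_add cvs.subspace_scale clinear_simps
            cscale_add_right cscale_cscale mult.commute)
      show "R y u \<in> {u \<in> M. R x u = c *\<^sub>C u}" if "y \<in> b" "u \<in> {u \<in> M. R x u = c *\<^sub>C u}" for y u
        using that M comm[of y u] clinear_simps[OF rep(3)[of y]] by auto
    qed (use e in auto)
    then show ?thesis using u by blast
  qed
  show ?case using v eig M by blast
qed

section \<open>Lie's theorem in the presence of odd operators\<close>

lemma double_eq_0:
  fixes x :: "'a::complex_vector"
  assumes "x + x = 0"
  shows "x = 0"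
proof -
  have "2 *\<^sub>C x = 0" using assms cscale_add_left[of 1 1 x] by (simp add: cscale_one)
  then show ?thesis by simp
qed

text \<open>
  An even eigenvector \<open>v\<close> with \<open>dim L v\<close> minimal is killed by \<open>L\<close>: otherwise \<open>L v\<close> contains an
  eigenvector \<open>\<xi> v\<close>, and \<open>L \<xi> v = \<xi> L v\<close> has smaller dimension, because anticommutators kill \<open>v\<close>.
\<close>

theorem super_lie_theorem:
  fixes R :: "'l::complex_vector \<Rightarrow> 'v::super_vector_space \<Rightarrow> 'v"
  assumes rep: "lie_rep br R b" and solv: "(derived br ^^ n) b = {0}"
    and V: "finite_dim (UNIV :: 'v set)" "(UNIV :: 'v set) \<noteq> {0}"
    and L: "csubspace L" "\<And>\<xi>. \<xi> \<in> L \<Longrightarrow> clinear \<xi>"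
    and comm: "\<And>x \<xi>. x \<in> b \<Longrightarrow> \<xi> \<in> L \<Longrightarrow> (\<lambda>v. R x (\<xi> v) - \<xi> (R x v)) \<in> L"
    and anti: "\<And>\<xi> \<eta>. \<xi> \<in> L \<Longrightarrow> \<eta> \<in> L \<Longrightarrow> \<exists>z\<in>derived br b. \<forall>v. \<xi> (\<eta> v) + \<eta> (\<xi> v) = R z v"
    and even: "\<And>x p v. x \<in> b \<Longrightarrow> hcomp p (R x v) = R x (hcomp p v)"
    and odd: "\<And>\<xi> p v. \<xi> \<in> L \<Longrightarrow> hcomp p (\<xi> v) = \<xi> (hcomp (p + 1) v)"
  obtains v p where "v \<noteq> 0" "hcomp p v = v" "\<And>x. x \<in> b \<Longrightarrow> \<exists>c. R x v = c *\<^sub>C v"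
    "\<And>\<xi>. \<xi> \<in> L \<Longrightarrow> \<xi> v = 0"
proof -
  let ?P = "\<lambda>v. v \<noteq> 0 \<and> (\<exists>p. hcomp p v = v) \<and> (\<forall>x\<in>b. \<exists>c. R x v = c *\<^sub>C v)"
  let ?E = "\<lambda>v. (\<lambda>\<xi>. \<xi> v) ` L"
  have ex: "\<exists>v. ?P v"
  proof -
    obtain u :: 'v where "u \<noteq> 0" using V(2) by blast
    then obtain p where p: "hcomp p u \<noteq> 0" by (metis hcomp_sum add_0_right)
    \<comment> \<open>Even operators preserve each component of the grading, so the ordinary theorem
      on a nonzero component yields a homogeneous eigenvector.\<close>
    let ?W = "homogeneous p :: 'v set"
    have "\<exists>v\<in>?W. v \<noteq> 0 \<and> (\<forall>x\<in>b. \<exists>c. R x v = c *\<^sub>C v)"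
    proof (rule lie_theorem[OF rep solv _ finite_dim_subset[OF V(1)]])
      show "csubspace ?W" by (rule csubspaceI) (simp_all add: homogeneous_def hcomp_add hcomp_cscale)
      have "hcomp p u \<in> ?W" by (simp add: homogeneous_def)
      then show "?W \<noteq> {0}" using p by blast
      show "R x v \<in> ?W" if "x \<in> b" "v \<in> ?W" for x v using that even by (simp add: homogeneous_def)
    qed simp
    then obtain v where "v \<in> ?W" "v \<noteq> 0" "\<forall>x\<in>b. \<exists>c. R x v = c *\<^sub>C v" by blast
    moreover from this have "\<exists>p. hcomp p v = v" by (auto simp: homogeneous_def)
    ultimately show ?thesis by (intro exI[of _ v] conjI)
  qed
  obtain u where "?P u" using ex by (elim exE)
  from ex_has_least_nat[of ?P, OF this, of "\<lambda>v. cvs.dim (?E v)"]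
  obtain v where v: "?P v" and least: "\<And>w. ?P w \<Longrightarrow> cvs.dim (?E v) \<le> cvs.dim (?E w)" by blast
  obtain p where p: "hcomp p v = v" using v by blast
  have neg: "- \<xi> \<in> L" if "\<xi> \<in> L" for \<xi> by (rule cvs.subspace_neg[OF L(1) that])
  have swap: "\<xi> (\<eta> v) = - \<eta> (\<xi> v)" if mem: "\<xi> \<in> L" "\<eta> \<in> L" for \<xi> \<eta>
  proof -
    obtain z where z: "z \<in> derived br b" "\<xi> (\<eta> v) + \<eta> (\<xi> v) = R z v" using anti[OF mem] by blast
    have "R z v = 0" by (rule derived_kills_eigenvector[OF rep _ z(1)]) (use v in blast)
    then show ?thesis using z(2) by (simp add: eq_neg_iff_add_eq_0)
  qed
  have "?E v = {0}"
  proof (rule ccontr)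
    assume ne: "?E v \<noteq> {0}"
    have sub: "csubspace (?E v)"
      by (rule csubspace_image[OF _ L(1)]) (simp add: clinear_iff cscale_fun_def)
    have stable: "R x u \<in> ?E v" if x: "x \<in> b" and u: "u \<in> ?E v" for x u
    proof -
      obtain \<xi> where \<xi>: "\<xi> \<in> L" "u = \<xi> v" using u by blast
      obtain c where c: "R x v = c *\<^sub>C v" using v x by blast
      have "R x u = (R x (\<xi> v) - \<xi> (R x v)) + c *\<^sub>C \<xi> v"
        by (simp add: \<xi> c clinear_simps[OF L(2)[OF \<xi>(1)]])
      moreover have "R x (\<xi> v) - \<xi> (R x v) \<in> ?E v"
        using comm[OF x \<xi>(1)] by (rule rev_image_eqI) simp
      moreover have "c *\<^sub>C \<xi> v \<in> ?E v" using \<xi> by (intro cvs.subspace_scale[OF sub]) blast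
      ultimately show ?thesis using cvs.subspace_add[OF sub] by metis
    qed
    have fin: "finite_dim (?E v)" using V(1) finite_dim_subset by blast
    obtain w where w: "w \<in> ?E v" "w \<noteq> 0" "\<forall>x\<in>b. \<exists>c. R x w = c *\<^sub>C w"
      using lie_theorem[OF rep solv sub fin ne stable] by blast
    obtain \<xi> where \<xi>: "\<xi> \<in> L" "w = \<xi> v" using w(1) by blast
    have "hcomp (p + 1) w = w" using odd[OF \<xi>(1), of "p + 1" v] p \<xi>(2) by (cases p) simp_all
    then have Pw: "?P w" using w by blast
    \<comment> \<open>\<open>swap\<close> for \<xi> with itself puts \<open>w\<close> into the
      kernel of \<xi>. As \<open>w\<close> lies in \<open>?E v\<close>, the image of
      \<open>?E v\<close> under \<xi> loses dimension.\<close>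
    have "\<xi> w + \<xi> w = 0"
      unfolding \<xi>(2) eq_neg_iff_add_eq_0[symmetric] by (rule swap[OF \<xi>(1) \<xi>(1)])
    then have "\<xi> w = 0" by (rule double_eq_0)
    then have "cvs.dim (\<xi> ` ?E v) < cvs.dim (?E v)"
      by (rule dim_image_less[OF fin L(2)[OF \<xi>(1)] w(1,2)])
    moreover have "?E w = \<xi> ` ?E v"
    proof (intro equalityI subsetI)
      fix u assume "u \<in> ?E w"
      then obtain \<eta> where \<eta>: "\<eta> \<in> L" "u = \<eta> w" by blast
      then have "u = \<xi> ((- \<eta>) v)"
        using swap[OF \<xi>(1) \<eta>(1)] \<xi> by (simp add: clinear_simps[OF L(2)[OF \<xi>(1)]])
      then show "u \<in> \<xi> ` ?E v" using neg[OF \<eta>(1)] by blast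
    next
      fix u assume "u \<in> \<xi> ` ?E v"
      then obtain \<eta> where \<eta>: "\<eta> \<in> L" "u = \<xi> (\<eta> v)" by blast
      then have "u = (- \<eta>) w" using swap[OF \<xi>(1) \<eta>(1)] \<xi> by simp
      then show "u \<in> ?E w" using neg[OF \<eta>(1)] by blast
    qed
    ultimately show False using least[OF Pw] by simp
  qed
  then show thesis using v p by (intro that[of v p]) auto
qed


section \<open>Comodules\<close>

lemma cscale_fun_apply [simp]: "(c *\<^sub>C f) x = c *\<^sub>C f x"
  by (simp add: cscale_fun_def)

lemma clinear_compose: "clinear f \<Longrightarrow> clinear g \<Longrightarrow> clinear (\<lambda>x. f (g x))"
  by (simp add: clinear_iff)

lemma clinear_comp: "clinear f \<Longrightarrow> clinear g \<Longrightarrow> clinear (f \<circ> g)"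
  by (simp add: clinear_iff)

lemma clinear_hcomp: "clinear (hcomp p)"
  by (simp add: clinear_iff hcomp_add hcomp_cscale)

lemma tensor_linear_ext:
  assumes "clinear F" "clinear G" "\<And>a b. F (a \<otimes>\<^sub>C b) = G (a \<otimes>\<^sub>C b)"
  shows "F t = G t"
  by (induction t rule: tensor_induct) (simp_all add: clinear_simps[OF assms(1)]
      clinear_simps[OF assms(2)] assms(3))

lemma tensor_homogeneous_ext:
  assumes "clinear F" "clinear G"
    "\<And>p q a b. hcomp p a = a \<Longrightarrow> hcomp q b = b \<Longrightarrow> F (a \<otimes>\<^sub>C b) = G (a \<otimes>\<^sub>C b)"
  shows "F t = G t"
  by (induction t rule: tensor_homogeneous_induct) (simp_all add: clinear_simps[OF assms(1)]
      clinear_simps[OF assms(2)] assms(3))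

section \<open>Contraction of tensors with functionals\<close>

lemma tlift_fun_add: "tlift (\<lambda>a b. f a b + g a b) t = tlift f t + tlift g t"
  by (simp add: tlift_def case_prod_unfold sum_mset.distrib)

lemma tlift_fun_zero: "tlift (\<lambda>a b. 0) t = 0"
  by (simp add: tlift_def case_prod_unfold)

lemma clinear_apply_tlift:
  assumes "clinear f"
  shows "f (tlift B t) = tlift (\<lambda>a b. f (B a b)) t"
proof -
  have "f (\<Sum>(a, b)\<in>#M. B a b) = (\<Sum>(a, b)\<in>#M. f (B a b))" for M
    by (induction M) (auto simp: clinear_simps[OF assms])
  then show ?thesis by (simp add: tlift_def)
qed

lemma tlift_fun_scale: "tlift (\<lambda>a b. c *\<^sub>C f a b) t = c *\<^sub>C tlift f t"
  by (rule clinear_apply_tlift[symmetric])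
    (simp add: clinear_iff cscale_add_right cscale_cscale mult.commute)

text \<open>The contraction id \<otimes> u. Through it the dual of C[G] acts on a right comodule, so
  that Lie algebra elements become operators.\<close>

definition slice :: "('g::complex_vector \<Rightarrow> complex) \<Rightarrow> ('v::complex_vector, 'g) tensor \<Rightarrow> 'v" where
  "slice u = tlift (\<lambda>w g. u g *\<^sub>C w)"

lemma slice_bilinear: "clinear u \<Longrightarrow> cbilinear (\<lambda>w g. u g *\<^sub>C w)"
  by (simp add: cbilinear_iff clinear_simps cscale_add_right cscale_add_left cscale_cscale
      cscale_complex_def mult.commute)

lemma slice_pure: "clinear u \<Longrightarrow> slice u (w \<otimes>\<^sub>C g) = u g *\<^sub>C w"
  by (simp add: slice_def tlift_pure slice_bilinear)

lemma clinear_slice: "clinear u \<Longrightarrow> clinear (slice u)"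
  by (simp add: slice_def clinear_tlift slice_bilinear)

lemma slice_functional_linear:
  "slice (u + u') t = slice u t + slice u' t" "slice (c *\<^sub>C u) t = c *\<^sub>C slice u t"
  by (simp_all add: slice_def cscale_add_left tlift_fun_add[symmetric]
      cscale_complex_def tlift_fun_scale[symmetric] cscale_cscale)

lemma tmap_bilinear: "clinear f \<Longrightarrow> clinear g \<Longrightarrow> cbilinear (\<lambda>a b. f a \<otimes>\<^sub>C g b)"
  by (simp add: cbilinear_iff clinear_simps pure_tensor_simps)

lemma tmap_pure: "clinear f \<Longrightarrow> clinear g \<Longrightarrow> tmap f g (a \<otimes>\<^sub>C b) = f a \<otimes>\<^sub>C g b"
  by (simp add: tmap_def tlift_pure tmap_bilinear)

lemma clinear_tmap: "clinear f \<Longrightarrow> clinear g \<Longrightarrow> clinear (tmap f g)"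
  by (simp add: tmap_def clinear_tlift tmap_bilinear)

lemma clinear_id: "clinear id"
  by (simp add: clinear_iff)

lemma slice_tmap:
  assumes "clinear f" "clinear g" "clinear u"
  shows "slice u (tmap f g t) = f (slice (u \<circ> g) t)"
  by (rule tensor_linear_ext[where t = t])
    (simp_all add: assms clinear_compose clinear_comp clinear_slice clinear_tmap tmap_pure
      slice_pure clinear_simps[OF assms(1)])

lemma tassoc_bilinear:
  "cbilinear (\<lambda>t (c :: 'c::complex_vector). tlift (\<lambda>(a :: 'a::complex_vector) (b :: 'b::complex_vector). a \<otimes>\<^sub>C (b \<otimes>\<^sub>C c)) t)"
proof -
  have bil: "cbilinear (\<lambda>(a :: 'a) (b :: 'b). a \<otimes>\<^sub>C (b \<otimes>\<^sub>C c))" for c :: 'c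
    by (simp add: cbilinear_iff pure_tensor_simps)
  show ?thesis
    using tlift_fun_add[of "\<lambda>a b. a \<otimes>\<^sub>C (b \<otimes>\<^sub>C _)" "\<lambda>a b. a \<otimes>\<^sub>C (b \<otimes>\<^sub>C _)"]
      tlift_fun_scale[of _ "\<lambda>a b. a \<otimes>\<^sub>C (b \<otimes>\<^sub>C _)"]
    by (auto simp: cbilinear_iff tlift_add[OF bil] tlift_cscale[OF bil] pure_tensor_simps)
qed

lemma clinear_tassoc: "clinear tassoc"
  unfolding tassoc_def by (rule clinear_tlift[OF tassoc_bilinear])

lemma tassoc_pure: "tassoc ((a \<otimes>\<^sub>C b) \<otimes>\<^sub>C c) = a \<otimes>\<^sub>C (b \<otimes>\<^sub>C c)"
proof -
  have bil: "cbilinear (\<lambda>a b. a \<otimes>\<^sub>C (b \<otimes>\<^sub>C c))"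
    by (simp add: cbilinear_iff pure_tensor_simps)
  show ?thesis unfolding tassoc_def by (simp add: tlift_pure[OF tassoc_bilinear] tlift_pure[OF bil])
qed

definition tprod :: "('a::complex_vector \<Rightarrow> complex) \<Rightarrow> ('b::complex_vector \<Rightarrow> complex) \<Rightarrow>
    ('a, 'b) tensor \<Rightarrow> complex" where
  "tprod u w = tlift (\<lambda>b c. u b * w c)"

lemma tprod_bilinear: "clinear u \<Longrightarrow> clinear w \<Longrightarrow> cbilinear (\<lambda>b c. u b * w c :: complex)"
  by (simp add: cbilinear_iff clinear_simps cscale_complex_def algebra_simps)

lemma tprod_pure: "clinear u \<Longrightarrow> clinear w \<Longrightarrow> tprod u w (a \<otimes>\<^sub>C b) = u a * w b"
  by (simp add: tprod_def tlift_pure tprod_bilinear)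

lemma clinear_tprod: "clinear u \<Longrightarrow> clinear w \<Longrightarrow> clinear (tprod u w)"
  by (simp add: tprod_def clinear_tlift tprod_bilinear)

lemma slice_tassoc:
  assumes u: "clinear u" and w: "clinear w"
  shows "slice (tprod u w) (tassoc t) = slice u (slice w t)"
proof (rule tensor_linear_ext[where t = t])
  show "clinear (\<lambda>t. slice (tprod u w) (tassoc t))" "clinear (\<lambda>t. slice u (slice w t))"
    by (rule clinear_compose[OF clinear_slice[OF clinear_tprod[OF u w]] clinear_tassoc]
        clinear_compose[OF clinear_slice[OF u] clinear_slice[OF w]])+
  fix s c
  show "slice (tprod u w) (tassoc (s \<otimes>\<^sub>C c)) = slice u (slice w (s \<otimes>\<^sub>C c))"
  proof (rule tensor_linear_ext[where t = s])
    have 1: "clinear (\<lambda>s. s \<otimes>\<^sub>C c)" by (simp add: clinear_iff pure_tensor_simps)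
    show "clinear (\<lambda>s. slice (tprod u w) (tassoc (s \<otimes>\<^sub>C c)))" "clinear (\<lambda>s. slice u (slice w (s \<otimes>\<^sub>C c)))"
      by (rule clinear_compose[OF clinear_compose[OF clinear_slice[OF clinear_tprod[OF u w]] clinear_tassoc] 1]
          clinear_compose[OF clinear_compose[OF clinear_slice[OF u] clinear_slice[OF w]] 1])+
  qed (simp add: tassoc_pure slice_pure u w clinear_tprod tprod_pure
      clinear_simps[OF clinear_slice[OF u]] cscale_cscale mult.commute)
qed

text \<open>
  The convolution product without the sign rule of \<^const>\<open>convolution\<close>, which makes the
  slices of a right comodule a representation.
\<close>

definition unsigned_convolution :: "('g::complex_vector \<Rightarrow> ('g, 'g) tensor) \<Rightarrow>
    ('g \<Rightarrow> complex) \<Rightarrow> ('g \<Rightarrow> complex) \<Rightarrow> 'g \<Rightarrow> complex" where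
  "unsigned_convolution \<Delta> u w = tprod u w \<circ> \<Delta>"

lemma clinear_unsigned_convolution:
  "clinear u \<Longrightarrow> clinear w \<Longrightarrow> clinear \<Delta> \<Longrightarrow> clinear (unsigned_convolution \<Delta> u w)"
  unfolding unsigned_convolution_def by (intro clinear_comp clinear_tprod)

definition comodule_action :: "('v::complex_vector \<Rightarrow> ('v, 'g::complex_vector) tensor) \<Rightarrow>
    ('g \<Rightarrow> complex) \<Rightarrow> 'v \<Rightarrow> 'v" where
  "comodule_action \<tau> u v = slice u (\<tau> v)"

lemma clinear_comodule_action: "clinear \<tau> \<Longrightarrow> clinear u \<Longrightarrow> clinear (comodule_action \<tau> u)"
  unfolding comodule_action_def by (rule clinear_compose[OF clinear_slice])

lemma comodule_action_functional:
  "comodule_action \<tau> (u + u') = comodule_action \<tau> u + comodule_action \<tau> u'"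
  "comodule_action \<tau> (c *\<^sub>C u) = c *\<^sub>C comodule_action \<tau> u"
  "comodule_action \<tau> (- u) = - comodule_action \<tau> u"
  "comodule_action \<tau> (u - u') = comodule_action \<tau> u - comodule_action \<tau> u'"
proof -
  have "clinear (comodule_action \<tau>)"
    by (rule clinearI)
      (simp_all add: comodule_action_def fun_eq_iff slice_functional_linear)
  from clinear_simps[OF this] show
    "comodule_action \<tau> (u + u') = comodule_action \<tau> u + comodule_action \<tau> u'"
    "comodule_action \<tau> (c *\<^sub>C u) = c *\<^sub>C comodule_action \<tau> u"
    "comodule_action \<tau> (- u) = - comodule_action \<tau> u"
    "comodule_action \<tau> (u - u') = comodule_action \<tau> u - comodule_action \<tau> u'"
    by blast+
qed

text \<open>This is coassociativity contracted with \<open>u\<close> and \<open>w\<close>: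
  composition of operators corresponds to the convolution without signs.\<close>

lemma comodule_action_action:
  assumes \<tau>: "clinear \<tau>" "\<And>v. tassoc (tmap \<tau> id (\<tau> v)) = tmap id \<Delta> (\<tau> v)"
    and \<Delta>: "clinear \<Delta>" and u: "clinear u" and w: "clinear w"
  shows "comodule_action \<tau> u (comodule_action \<tau> w v) = comodule_action \<tau> (unsigned_convolution \<Delta> u w) v"
proof -
  have "slice u (\<tau> (slice w (\<tau> v))) = slice u (slice w (tmap \<tau> id (\<tau> v)))"
    by (simp add: slice_tmap[OF \<tau>(1) clinear_id w])
  also have "\<dots> = slice (tprod u w) (tmap id \<Delta> (\<tau> v))"
    by (simp add: slice_tassoc[OF u w, symmetric] \<tau>(2))
  also have "\<dots> = slice (tprod u w \<circ> \<Delta>) (\<tau> v)"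
    by (simp add: slice_tmap[OF clinear_id \<Delta> clinear_tprod[OF u w]])
  finally show ?thesis by (simp add: comodule_action_def unsigned_convolution_def)
qed

section \<open>Parity of functionals and the signs of the bracket\<close>

lemma functional_parity:
  fixes u :: "'g::super_vector_space \<Rightarrow> complex"
  assumes "u \<circ> hcomp p = u" "clinear u" "hcomp q b = b" "q \<noteq> p"
  shows "u b = 0"
proof -
  have "u b = u (hcomp p b)" using assms(1) by (metis comp_apply)
  also have "hcomp p b = 0" using hcomp_homogeneous[OF assms(3), of p] assms(4) by simp
  finally show ?thesis by (simp add: clinear_simps(3)[OF assms(2)])
qed

lemma slice_parity:
  fixes t :: "('v::super_vector_space, 'g::super_vector_space) tensor"
  assumes "clinear u" "u \<circ> hcomp q = u"
  shows "slice u (hcomp p t) = hcomp (p + q) (slice u t)"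
proof (rule tensor_homogeneous_ext[where t = t])
  show "clinear (\<lambda>t. slice u (hcomp p t))" "clinear (\<lambda>t. hcomp (p + q) (slice u t))"
    by (rule clinear_compose[OF clinear_slice[OF assms(1)] clinear_hcomp]
        clinear_compose[OF clinear_hcomp clinear_slice[OF assms(1)]])+
  fix r s and a :: 'v and b :: 'g assume ab: "hcomp r a = a" "hcomp s b = b"
  show "slice u (hcomp p (a \<otimes>\<^sub>C b)) = hcomp (p + q) (slice u (a \<otimes>\<^sub>C b))"
  proof (cases "s = q")
    case True
    then show ?thesis
      by (cases p; cases q; cases r)
        (simp_all add: hcomp_pure_homogeneous[OF ab] slice_pure assms hcomp_cscale
          hcomp_homogeneous[OF ab(1)] clinear_simps[OF clinear_slice[OF assms(1)]])
  next
    case False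
    then have "u b = 0" using functional_parity assms ab by blast
    then show ?thesis
      by (simp add: hcomp_pure_homogeneous[OF ab] slice_pure assms clinear_simps[OF clinear_slice[OF assms(1)]])
  qed
qed

lemma tprod_parity:
  fixes t :: "('a::super_vector_space, 'b::super_vector_space) tensor"
  assumes u: "clinear u" "u \<circ> hcomp p = u" and w: "clinear w" "w \<circ> hcomp q = w"
  shows "tprod u w (hcomp r t) = (if r = p + q then tprod u w t else 0)"
proof (rule tensor_homogeneous_ext[where t = t])
  show "clinear (\<lambda>t. tprod u w (hcomp r t))" "clinear (\<lambda>t. if r = p + q then tprod u w t else 0)"
    using clinear_tprod[OF u(1) w(1)] by (auto simp: clinear_iff hcomp_add hcomp_cscale)
  fix m n and a :: 'a and b :: 'b assume ab: "hcomp m a = a" "hcomp n b = b"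
  show "tprod u w (hcomp r (a \<otimes>\<^sub>C b)) = (if r = p + q then tprod u w (a \<otimes>\<^sub>C b) else 0)"
  proof (cases "m = p \<and> n = q")
    case False
    then have "u a * w b = 0"
      using functional_parity[OF u(2,1) ab(1)] functional_parity[OF w(2,1) ab(2)] by auto
    then show ?thesis
      by (simp add: hcomp_pure_homogeneous[OF ab] tprod_pure u w
          clinear_simps[OF clinear_tprod[OF u(1) w(1)]])
  qed (simp add: hcomp_pure_homogeneous[OF ab] clinear_simps[OF clinear_tprod[OF u(1) w(1)]])
qed

lemma convolution_homogeneous:
  fixes \<Delta> :: "'g::supercommutative_algebra \<Rightarrow> ('g, 'g) tensor"
  assumes u: "clinear u" "u \<circ> hcomp p = u" and w: "clinear w" "w \<circ> hcomp q = w"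
  shows "convolution \<Delta> u w = ksign p q *\<^sub>C unsigned_convolution \<Delta> u w"
proof -
  have h: "u (hcomp p' a) = (if p' = p then u a else 0)" "w (hcomp p' a) = (if p' = q then w a else 0)"
    for p' a
    using functional_parity[OF u(2,1), of p' "hcomp p' a"] functional_parity[OF w(2,1), of p' "hcomp p' a"]
      fun_cong[OF u(2), of a] fun_cong[OF w(2), of a] by auto
  have "(\<Sum>p'\<in>{0, 1}. \<Sum>q'\<in>{0, 1}. ksign p' q' * (u (hcomp p' a) * w (hcomp q' b)))
      = ksign p q *\<^sub>C (u a * w b)" for a b
    unfolding h by (cases p; cases q) (simp_all add: cscale_complex_def)
  then show ?thesis
    by (simp add: convolution_def unsigned_convolution_def tprod_def fun_eq_iff tlift_fun_scale)
qed

lemma convolution_zero: "convolution \<Delta> 0 w = 0" "convolution \<Delta> u 0 = 0"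
  by (simp_all add: convolution_def fun_eq_iff tlift_fun_zero)

text \<open>In the second product the sign of \<open>convolution\<close> cancels the sign of the
  supercommutator; in the first one it survives. For two odd functionals the bracket is thus minus
  the unsigned anticommutator.\<close>

lemma lie_bracket_homogeneous:
  fixes \<Delta> :: "'g::supercommutative_algebra \<Rightarrow> ('g, 'g) tensor"
  assumes u: "clinear u" "u \<circ> hcomp p = u" and w: "clinear w" "w \<circ> hcomp q = w"
  shows "lie_bracket \<Delta> u w = ksign p q *\<^sub>C unsigned_convolution \<Delta> u w - unsigned_convolution \<Delta> w u"
proof -
  have h: "u \<circ> hcomp p' = (if p' = p then u else 0)" "w \<circ> hcomp p' = (if p' = q then w else 0)" for p'
    using functional_parity[OF u(2,1), of p'] functional_parity[OF w(2,1), of p'] u(2) w(2)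
    by (auto simp: fun_eq_iff)
  have "lie_bracket \<Delta> u w = convolution \<Delta> u w - ksign p q *\<^sub>C convolution \<Delta> w u"
    unfolding lie_bracket_def h
    by (cases p; cases q) (simp_all add: convolution_zero)
  also have "\<dots> = ksign p q *\<^sub>C unsigned_convolution \<Delta> u w - (ksign p q * ksign q p) *\<^sub>C unsigned_convolution \<Delta> w u"
    by (simp add: convolution_homogeneous[OF u w] convolution_homogeneous[OF w u] cscale_cscale)
  also have "ksign p q * ksign q p = 1" by (simp add: ksign_def)
  finally show ?thesis by (simp only: cscale_one)
qed

lemma lie_bracket_parity:
  fixes \<Delta> :: "'g::supercommutative_algebra \<Rightarrow> ('g, 'g) tensor"
  assumes u: "clinear u" "u \<circ> hcomp p = u" and w: "clinear w" "w \<circ> hcomp q = w"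
    and \<Delta>: "\<And>r x. \<Delta> (hcomp r x) = hcomp r (\<Delta> x)"
  shows "lie_bracket \<Delta> u w \<circ> hcomp (p + q) = lie_bracket \<Delta> u w"
proof -
  have "unsigned_convolution \<Delta> u w (hcomp (p + q) x) = unsigned_convolution \<Delta> u w x"
    "unsigned_convolution \<Delta> w u (hcomp (p + q) x) = unsigned_convolution \<Delta> w u x" for x
    unfolding unsigned_convolution_def comp_apply \<Delta> tprod_parity[OF u w] tprod_parity[OF w u]
      add.commute[of p q] by simp_all
  then show ?thesis by (simp add: lie_bracket_homogeneous[OF u w] fun_eq_iff)
qed

text \<open>Expand the second factor in a basis: the coefficients are the slices of \<open>t\<close>
  along the coordinate functionals. Submodules can therefore be recognized by slices.\<close>

lemma slice_mem_span:
  fixes t :: "('a::complex_vector, 'b::complex_vector) tensor"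
  assumes W: "csubspace W" and t: "\<And>u. clinear u \<Longrightarrow> slice u t \<in> W"
  shows "t \<in> cspan {w \<otimes>\<^sub>C g | w g. w \<in> W}"
proof -
  obtain B :: "'b set" where B: "cvs.independent B" "UNIV \<subseteq> cspan B"
    using cvs.maximal_independent_subset[of UNIV] by blast
  let ?r = "\<lambda>b g. cvs.representation B g b"
  have span: "x \<in> cspan B" for x using B(2) by blast
  have lin: "clinear (?r b)" for b
    by (intro clinearI) (simp_all add: B(1) span cvs.representation_add cvs.representation_scale cscale_complex_def)
  define E where "E D t = (\<Sum>b\<in>D. slice (?r b) t \<otimes>\<^sub>C b)" for D and t :: "('a, 'b) tensor"
  have zero_left: "(0 :: 'a) \<otimes>\<^sub>C b = 0" for b :: 'b
    using pure_tensor_simps(3)[of 0 "0 :: 'a" b] by simp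
  have E_linear: "E D 0 = 0" "E D (s + t) = E D s + E D t" for D s t
    by (simp_all add: E_def clinear_simps[OF clinear_slice[OF lin]] zero_left pure_tensor_simps sum.distrib)
  \<comment> \<open>The expansion is claimed for every finite \<open>D\<close> above some
    \<open>C\<close>, so that the finite sets belonging to two summands can be united.\<close>
  have "\<exists>C\<subseteq>B. finite C \<and> (\<forall>D\<subseteq>B. finite D \<longrightarrow> C \<subseteq> D \<longrightarrow> t = E D t)"
  proof (induction t rule: tensor_induct)
    case zero
    then show ?case by (auto simp: E_linear)
  next
    case (add a g t)
    then obtain C where C: "C \<subseteq> B" "finite C"
      "\<And>D. D \<subseteq> B \<Longrightarrow> finite D \<Longrightarrow> C \<subseteq> D \<Longrightarrow> t = E D t" by blast
    let ?S = "{b. ?r b g \<noteq> 0}"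
    have S: "finite ?S" "?S \<subseteq> B"
      using cvs.finite_representation cvs.representation_ne_zero by auto
    have "a \<otimes>\<^sub>C g + t = E D (a \<otimes>\<^sub>C g + t)" if D: "D \<subseteq> B" "finite D" "C \<union> ?S \<subseteq> D" for D
    proof -
      have "(\<Sum>b\<in>?S. ?r b g *\<^sub>C b) = g"
        by (rule cvs.sum_nonzero_representation_eq[OF B(1) span])
      also have "(\<Sum>b\<in>?S. ?r b g *\<^sub>C b) = (\<Sum>b\<in>D. ?r b g *\<^sub>C b)"
        by (rule sum.mono_neutral_left) (use D in auto)
      finally have g: "(\<Sum>b\<in>D. ?r b g *\<^sub>C b) = g" .
      have "clinear (\<lambda>g. a \<otimes>\<^sub>C g)" by (simp add: clinear_iff pure_tensor_simps)
      from clinear_simps(6)[OF this, of "\<lambda>b. ?r b g *\<^sub>C b" D]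
      have "a \<otimes>\<^sub>C g = (\<Sum>b\<in>D. (?r b g *\<^sub>C a) \<otimes>\<^sub>C b)"
        unfolding g by (simp add: pure_tensor_simps)
      then have "a \<otimes>\<^sub>C g = E D (a \<otimes>\<^sub>C g)"
        unfolding E_def slice_pure[OF lin] .
      moreover have "t = E D t" using C(3)[of D] D by blast
      ultimately show ?thesis by (simp add: E_linear)
    qed
    then show ?case using C(1,2) S by (intro exI[of _ "C \<union> ?S"]) auto
  qed
  then obtain C where "t = E C t" by blast
  moreover have "E C t \<in> cspan {w \<otimes>\<^sub>C g | w g. w \<in> W}"
    unfolding E_def by (intro cvs.span_sum cvs.span_base) (use t[OF lin] in blast)
  ultimately show ?thesis by simp
qed

text \<open>The source of local finiteness: all slices lie in the span of the finitely many first
  factors in one representation of \<open>t\<close>.\<close>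

lemma slice_finite_dim: "\<exists>F. finite F \<and> (\<forall>u. clinear u \<longrightarrow> slice u t \<in> cspan F)"
proof (induction t rule: tensor_induct)
  case zero
  then show ?case by (auto simp: clinear_simps(3)[OF clinear_slice])
next
  case (add a b t)
  then obtain F where F: "finite F" "\<And>u. clinear u \<Longrightarrow> slice u t \<in> cspan F" by blast
  have "slice u (a \<otimes>\<^sub>C b + t) \<in> cspan (insert a F)" if "clinear u" for u
  proof -
    have "slice u t \<in> cspan (insert a F)"
      using F(2)[OF that] cvs.span_mono[of F "insert a F"] by blast
    then show ?thesis
      by (simp add: clinear_simps[OF clinear_slice] slice_pure that cvs.span_add cvs.span_scale cvs.span_base)
  qed
  then show ?case using F by blast
qed

lemma hcomp_slice:
  fixes t :: "('v::super_vector_space, 'g::super_vector_space) tensor"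
  assumes u: "clinear u" and t: "hcomp s t = t"
  shows "hcomp q (slice u t) = slice (u \<circ> hcomp (q + s)) t"
proof -
  have "hcomp q (slice u t) = hcomp q (slice (u \<circ> hcomp 0) t) + hcomp q (slice (u \<circ> hcomp 1) t)"
  proof -
    have "u = (u \<circ> hcomp 0) + (u \<circ> hcomp 1)"
      by (simp add: fun_eq_iff clinear_simps(1)[OF u, symmetric] hcomp_sum)
    then have "slice u t = slice (u \<circ> hcomp 0) t + slice (u \<circ> hcomp 1) t"
        by (metis slice_functional_linear(1))
      then show ?thesis by (simp add: hcomp_add)
  qed
  moreover have "hcomp q (slice (u \<circ> hcomp r) t) = (if r = q + s then slice (u \<circ> hcomp r) t else 0)" for r
  proof -
    have lin: "clinear (u \<circ> hcomp r)" by (intro clinear_comp u clinear_hcomp)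
    have par: "u \<circ> hcomp r \<circ> hcomp r = u \<circ> hcomp r" by (simp add: fun_eq_iff)
    have "slice (u \<circ> hcomp r) (hcomp (q + r) t) = hcomp q (slice (u \<circ> hcomp r) t)"
      using slice_parity[OF lin par, of "q + r" t] by (cases q; cases r) simp_all
    then have "hcomp q (slice (u \<circ> hcomp r) t) = slice (u \<circ> hcomp r) (if s = q + r then t else 0)"
      by (simp only: hcomp_homogeneous[OF t])
    moreover have "s = q + r \<longleftrightarrow> r = q + s" by (cases q; cases r; cases s) simp_all
    ultimately show ?thesis by (simp add: clinear_simps(3)[OF clinear_slice[OF lin]])
  qed
  ultimately show ?thesis by (cases q; cases s) simp_all
qed

text \<open>The slices of \<open>\<tau> v\<close>, for a nonzero homogeneous \<open>v\<close>, form
  a submodule: coassociativity makes them stable and homogeneity makes them graded. The counit shows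
  that \<open>v\<close> is among them, so they exhaust the module.\<close>

lemma irreducible_finite_dim:
  fixes \<tau> :: "'v::super_vector_space \<Rightarrow> ('v, 'g::supercommutative_algebra) tensor"
  assumes irr: "irreducible_G_module \<Delta> \<epsilon> \<tau>" and \<Delta>: "clinear \<Delta>" and \<epsilon>: "clinear \<epsilon>"
  shows "finite_dim (UNIV :: 'v set)"
proof -
  have \<tau>: "clinear \<tau>" "\<And>p v. \<tau> (hcomp p v) = hcomp p (\<tau> v)"
    "\<And>v. tassoc (tmap \<tau> id (\<tau> v)) = tmap id \<Delta> (\<tau> v)" "\<And>v. tlift (\<lambda>w g. \<epsilon> g *\<^sub>C w) (\<tau> v) = v"
    using irr unfolding irreducible_G_module_def G_module_def by blast+
  have V: "(UNIV :: 'v set) \<noteq> {0}"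
    "\<And>U. submodule \<tau> U \<Longrightarrow> U = {0} \<or> U = UNIV"
    using irr unfolding irreducible_G_module_def irreducible_submodule_def by blast+
  obtain v' :: 'v where "v' \<noteq> 0" using V(1) by blast
  then obtain p where p: "hcomp p v' \<noteq> 0" by (metis hcomp_sum add_0_right)
  define v where "v = hcomp p v'"
  have v: "v \<noteq> 0" "hcomp p v = v" using p by (simp_all add: v_def)
  define W where "W = {comodule_action \<tau> u v | u. clinear u}"
  have W: "csubspace W"
  proof (rule csubspaceI)
    have "clinear (0 :: 'g \<Rightarrow> complex)" by (simp add: clinear_iff)
    moreover have "comodule_action \<tau> 0 v = 0" using comodule_action_functional(2)[of \<tau> 0 0] by simp
    ultimately show "0 \<in> W" by (force simp: W_def)
  next
    fix x y assume "x \<in> W" "y \<in> W"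
    then obtain u w where "clinear u" "clinear w" "x + y = comodule_action \<tau> (u + w) v"
      by (auto simp: W_def comodule_action_functional)
    then show "x + y \<in> W" by (auto simp: W_def clinear_iff cscale_add_right intro!: exI[of _ "u + w"])
  next
    fix c x assume "x \<in> W"
    then obtain u where u: "clinear u" "c *\<^sub>C x = comodule_action \<tau> (c *\<^sub>C u) v"
      by (auto simp: W_def comodule_action_functional)
    then show "c *\<^sub>C x \<in> W"
      by (auto simp: W_def clinear_iff cscale_add_right cscale_cscale mult.commute
          intro!: exI[of _ "c *\<^sub>C u"])
  qed
  have "submodule \<tau> W"
    unfolding submodule_def
  proof (intro conjI ballI W)
    have "hcomp p (\<tau> v) = \<tau> v" using v(2) \<tau>(2)[of p v] by simp
    then have "hcomp q (comodule_action \<tau> u v) \<in> W" if "clinear u" for q u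
      using hcomp_slice[OF that, of p "\<tau> v" q] clinear_comp[OF that clinear_hcomp]
      by (auto simp: W_def comodule_action_def)
    then show "graded W" by (auto simp: graded_def W_def)
    fix w assume "w \<in> W"
    then obtain u where u: "clinear u" "w = comodule_action \<tau> u v" by (auto simp: W_def)
    show "\<tau> w \<in> cspan {w \<otimes>\<^sub>C g | w g. w \<in> W}"
    proof (rule slice_mem_span[OF W])
      fix u' assume u': "clinear (u' :: 'g \<Rightarrow> complex)"
      have "slice u' (\<tau> w) = comodule_action \<tau> (unsigned_convolution \<Delta> u' u) v"
        using comodule_action_action[OF \<tau>(1,3) \<Delta> u' u(1), of v] u(2) by (simp add: comodule_action_def)
      then show "slice u' (\<tau> w) \<in> W"
        using clinear_unsigned_convolution[OF u' u(1) \<Delta>] by (auto simp: W_def)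
    qed
  qed
  moreover have "v \<in> W"
    using \<tau>(4)[of v] \<epsilon> by (auto simp: W_def comodule_action_def slice_def intro!: exI[of _ \<epsilon>])
  ultimately have W_UNIV: "W = UNIV" using V(2)[of W] v(1) by blast
  obtain F where F: "finite F" "\<forall>u. clinear u \<longrightarrow> slice u (\<tau> v) \<in> cspan F"
    using slice_finite_dim[of "\<tau> v"] by (elim exE conjE)
  have "W \<subseteq> cspan F" using F(2) by (auto simp: W_def comodule_action_def)
  then show ?thesis using F(1) by (auto simp: finite_dim_def W_UNIV)
qed

text \<open>An instance of \<open>super_lie_theorem\<close> in which \<open>L\<close> consists of
  the operators of the odd part of \<open>b\<close>. The inclusion of the odd brackets in the even
  ones is what its assumption on anticommutators asks for.\<close>

theorem prehyperborel_eigenvector: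
  fixes \<tau> :: "'v::super_vector_space \<Rightarrow> ('v, 'g::supercommutative_algebra) tensor"
  assumes irr: "irreducible_G_module \<Delta> \<epsilon> \<tau>" and \<Delta>: "superalgebra_hom \<Delta>" and \<epsilon>: "clinear \<epsilon>"
    and L: "\<And>u. u \<in> L \<Longrightarrow> clinear u" and b: "prehyperborel \<Delta> L b"
  obtains v p where "v \<noteq> 0" "hcomp p v = v"
    "\<forall>u\<in>lie_component 0 b. \<exists>c. comodule_action \<tau> u v = c *\<^sub>C v"
    "\<forall>u\<in>lie_component 1 b. comodule_action \<tau> u v = 0"
proof -
  let ?b0 = "lie_component 0 b" and ?b1 = "lie_component 1 b"
  let ?R = "comodule_action \<tau>" and ?br = "lie_bracket \<Delta>"
  have \<tau>: "clinear \<tau>" "\<And>p v. \<tau> (hcomp p v) = hcomp p (\<tau> v)"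
    "\<And>v. tassoc (tmap \<tau> id (\<tau> v)) = tmap id \<Delta> (\<tau> v)"
    using irr unfolding irreducible_G_module_def G_module_def by blast+
  have \<Delta>': "clinear \<Delta>" "\<And>p x. \<Delta> (hcomp p x) = hcomp p (\<Delta> x)"
    using \<Delta> unfolding superalgebra_hom_def by blast+
  have b': "csubspace b" "b \<subseteq> L" "\<And>u v. u \<in> b \<Longrightarrow> v \<in> b \<Longrightarrow> ?br u v \<in> b"
    "lie_subalgebra \<Delta> (lie_component 0 L) ?b0" "solvable_lie \<Delta> ?b0"
    "bracket_span \<Delta> ?b1 ?b1 \<subseteq> bracket_span \<Delta> ?b0 ?b0"
    using b unfolding prehyperborel_def borel_subalgebra_def lie_subalgebra_def by blast+
  have lin: "clinear u" if "u \<in> lie_component p b" for u p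
    using that b'(2) L by (auto simp: lie_component_def)
  have par: "u \<circ> hcomp p = u" if "u \<in> lie_component p b" for u p
    using that by (auto simp: lie_component_def)
  have br_mem: "?br u w \<in> lie_component (p + q) b"
    if "u \<in> lie_component p b" "w \<in> lie_component q b" for u w p q
    using b'(3)[of u w] lie_bracket_parity[OF lin par lin par \<Delta>'(2), OF that(1,1,2,2)] that
    by (simp add: lie_component_def)
  note act = comodule_action_action[OF \<tau>(1,3) \<Delta>'(1)]
  have br: "?R (?br u w) v = ksign p q *\<^sub>C ?R u (?R w v) - ?R w (?R u v)"
    if "u \<in> lie_component p b" "w \<in> lie_component q b" for u w p q v
    using that by (simp add: lie_bracket_homogeneous[OF lin par lin par, OF that(1,1,2,2)]
        comodule_action_functional act lin)
  have rep: "lie_rep ?br ?R ?b0"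
    unfolding lie_rep_def
  proof (intro conjI ballI allI)
    show "csubspace ?b0" using b'(4) by (simp add: lie_subalgebra_def)
  qed (use br_mem[of _ 0 _ 0] br[of _ 0 _ 0] in
      \<open>auto simp: lin clinear_comodule_action \<tau> ksign_def cscale_one comodule_action_functional\<close>)
  obtain n where n: "((\<lambda>M. bracket_span \<Delta> M M) ^^ n) ?b0 = {0}"
    using b'(5) unfolding solvable_lie_def by (elim exE)
  have D: "bracket_span \<Delta> M M = derived ?br M" for M by (simp add: bracket_span_def derived_def)
  have solv: "(derived ?br ^^ n) ?b0 = {0}" using n by (simp add: D)
  have fin: "finite_dim (UNIV :: 'v set)" by (rule irreducible_finite_dim[OF irr \<Delta>'(1) \<epsilon>])
  have ne: "(UNIV :: 'v set) \<noteq> {0}"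
    using irr unfolding irreducible_G_module_def irreducible_submodule_def by blast
  have b1: "csubspace ?b1"
    using b'(1) by (intro csubspaceI)
      (auto simp: lie_component_def cvs.subspace_0 cvs.subspace_add cvs.subspace_scale fun_eq_iff)
  have act_lin: "clinear ?R" by (simp add: clinear_iff comodule_action_functional)
  have act_par: "hcomp q (?R u v) = ?R u (hcomp (q + p) v)" if "u \<in> lie_component p b" for u p q v
    using slice_parity[OF lin[OF that] par[OF that], of "q + p" "\<tau> v"]
    by (cases p; cases q) (simp_all add: comodule_action_def \<tau>(2))
  note witness = that
  show thesis
  proof (rule super_lie_theorem[OF rep solv fin ne csubspace_image[OF act_lin b1]])
    show "clinear \<xi>" if "\<xi> \<in> ?R ` ?b1" for \<xi>
      using that lin clinear_comodule_action[OF \<tau>(1)] by auto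
    show "(\<lambda>v. ?R x (\<xi> v) - \<xi> (?R x v)) \<in> ?R ` ?b1" if x: "x \<in> ?b0" and \<xi>: "\<xi> \<in> ?R ` ?b1" for x \<xi>
    proof -
      obtain u where u: "u \<in> ?b1" "\<xi> = ?R u" using \<xi> by blast
      have "(\<lambda>v. ?R x (\<xi> v) - \<xi> (?R x v)) = ?R (?br x u)"
        using br[OF x u(1)] by (simp add: fun_eq_iff u ksign_def cscale_one)
      then show ?thesis using br_mem[OF x u(1)] by simp
    qed
    show "\<exists>z\<in>derived ?br ?b0. \<forall>v. \<xi> (\<eta> v) + \<eta> (\<xi> v) = ?R z v"
      if mem: "\<xi> \<in> ?R ` ?b1" "\<eta> \<in> ?R ` ?b1" for \<xi> \<eta>
    proof -
      obtain u w where u: "u \<in> ?b1" "\<xi> = ?R u" and w: "w \<in> ?b1" "\<eta> = ?R w" using mem by blast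
      \<comment> \<open>The minus sign is \<open>ksign 1 1\<close>, which the bracket keeps on its
        first product.\<close>
      have "\<xi> (\<eta> v) + \<eta> (\<xi> v) = ?R (- ?br u w) v" for v
        using br[OF u(1) w(1), of v]
        by (simp add: u w ksign_def comodule_action_functional cscale_one)
      moreover have "- ?br u w \<in> derived ?br ?b0"
      proof -
        have "?br u w \<in> derived ?br ?b0"
          using b'(6) unfolding D by (rule subsetD) (rule derived_bracket[OF u(1) w(1)])
        then show ?thesis unfolding derived_def by (rule cvs.span_neg)
      qed
      ultimately show ?thesis by (intro bexI[of _ "- ?br u w"] allI)
    qed
    show "hcomp p (?R x v) = ?R x (hcomp p v)" if "x \<in> ?b0" for x p v
      using act_par[OF that] by simp
    show "hcomp p (\<xi> v) = \<xi> (hcomp (p + 1) v)" if "\<xi> \<in> ?R ` ?b1" for \<xi> p v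
      using that act_par by auto
    show thesis if v: "v \<noteq> 0" "hcomp p v = v" "\<And>x. x \<in> ?b0 \<Longrightarrow> \<exists>c. ?R x v = c *\<^sub>C v"
      "\<And>\<xi>. \<xi> \<in> ?R ` ?b1 \<Longrightarrow> \<xi> v = 0" for v p
      by (rule witness[of v p]) (use v in auto)
  qed
qed


section \<open>Hilbert's basis theorem and Krull's intersection theorem\<close>

definition unital_subring :: "'a::ring_1 set \<Rightarrow> bool" where
  "unital_subring R \<longleftrightarrow> 0 \<in> R \<and> 1 \<in> R \<and> (\<forall>x\<in>R. \<forall>y\<in>R. x + y \<in> R \<and> x * y \<in> R) \<and> (\<forall>x\<in>R. - x \<in> R)"

lemma unital_subringD:
  assumes "unital_subring R"
  shows "0 \<in> R" "1 \<in> R" "x \<in> R \<Longrightarrow> y \<in> R \<Longrightarrow> x + y \<in> R" "x \<in> R \<Longrightarrow> y \<in> R \<Longrightarrow> x * y \<in> R"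
    "x \<in> R \<Longrightarrow> - x \<in> R"
  using assms by (auto simp: unital_subring_def)

lemma unital_subring_UNIV: "unital_subring UNIV"
  by (simp add: unital_subring_def)

text \<open>Ideals are relative to a subring \<open>R\<close>, because the chain condition climbs a
  tower of subrings of one algebra.\<close>

definition two_sided_ideal :: "'a::ring_1 set \<Rightarrow> 'a set \<Rightarrow> bool" where
  "two_sided_ideal R I \<longleftrightarrow> I \<subseteq> R \<and> 0 \<in> I \<and> (\<forall>x\<in>I. \<forall>y\<in>I. x + y \<in> I) \<and>
     (\<forall>r\<in>R. \<forall>x\<in>I. r * x \<in> I \<and> x * r \<in> I)"

lemma two_sided_idealI:
  "I \<subseteq> R \<Longrightarrow> 0 \<in> I \<Longrightarrow> (\<And>x y. x \<in> I \<Longrightarrow> y \<in> I \<Longrightarrow> x + y \<in> I) \<Longrightarrow>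
    (\<And>r x. r \<in> R \<Longrightarrow> x \<in> I \<Longrightarrow> r * x \<in> I) \<Longrightarrow> (\<And>r x. r \<in> R \<Longrightarrow> x \<in> I \<Longrightarrow> x * r \<in> I) \<Longrightarrow>
    two_sided_ideal R I"
  by (simp add: two_sided_ideal_def)

lemma two_sided_idealD:
  assumes "two_sided_ideal R I"
  shows "I \<subseteq> R" "0 \<in> I" "x \<in> I \<Longrightarrow> y \<in> I \<Longrightarrow> x + y \<in> I"
    "r \<in> R \<Longrightarrow> x \<in> I \<Longrightarrow> r * x \<in> I" "r \<in> R \<Longrightarrow> x \<in> I \<Longrightarrow> x * r \<in> I"
  using assms by (auto simp: two_sided_ideal_def)

lemma two_sided_ideal_minus:
  assumes R: "unital_subring R" and I: "two_sided_ideal R I" and "x \<in> I"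
  shows "- x \<in> I"
proof -
  have "(- 1) * x \<in> I"
    using assms(3) unital_subringD(5)[OF R unital_subringD(2)[OF R]] by (rule two_sided_idealD(4)[OF I, rotated])
  then show ?thesis by simp
qed

definition ideal_acc :: "'a::ring_1 set \<Rightarrow> bool" where
  "ideal_acc R \<longleftrightarrow> (\<forall>I :: nat \<Rightarrow> 'a set. (\<forall>n. two_sided_ideal R (I n)) \<longrightarrow> (\<forall>n. I n \<subseteq> I (Suc n)) \<longrightarrow>
     (\<exists>N. \<forall>n\<ge>N. I n = I N))"

text \<open>Values at \<open>x\<close> of polynomials of degree below \<open>n\<close> with
  coefficients on the left. Index 0 gives only 0, and the new coefficient of index
  \<open>Suc n\<close> stands at \<open>x ^ n\<close>.\<close>

fun pols :: "'a::ring_1 set \<Rightarrow> 'a \<Rightarrow> nat \<Rightarrow> 'a set" where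
  "pols R x 0 = {0}"
| "pols R x (Suc n) = {p + r * x ^ n | p r. p \<in> pols R x n \<and> r \<in> R}"

definition adjoin :: "'a::ring_1 set \<Rightarrow> 'a \<Rightarrow> 'a set" where
  "adjoin R x = (\<Union>n. pols R x n)"

text \<open>Normality of \<open>x\<close> over \<open>R\<close> replaces commutativity in Hilbert's
  basis theorem: a coefficient can be moved across a power of \<open>x\<close> if it is exchanged
  for another element of \<open>R\<close>.\<close>

context
  fixes R :: "'a::ring_1 set" and x :: 'a
  assumes R: "unital_subring R"
    and normal: "\<And>r. r \<in> R \<Longrightarrow> \<exists>r'\<in>R. x * r = r' * x" "\<And>r. r \<in> R \<Longrightarrow> \<exists>r'\<in>R. r * x = x * r'"
begin

lemma normal_power:
  "r \<in> R \<Longrightarrow> \<exists>r'\<in>R. x ^ n * r = r' * x ^ n" "r \<in> R \<Longrightarrow> \<exists>r'\<in>R. r * x ^ n = x ^ n * r'"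
proof (induction n arbitrary: r)
  case (Suc n)
  {
    case 1
    obtain r' where r': "r' \<in> R" "x * r = r' * x" using normal(1)[OF 1] by blast
    obtain s where s: "s \<in> R" "x ^ n * r' = s * x ^ n" using Suc.IH(1)[OF r'(1)] by blast
    have "x ^ Suc n * r = x ^ n * (x * r)" by (simp only: power_Suc2 mult.assoc)
    also have "\<dots> = s * x ^ Suc n" by (simp only: r' s mult.assoc[symmetric] power_Suc2)
    finally show ?case using s by blast
  next
    case 2
    obtain r' where r': "r' \<in> R" "r * x = x * r'" using normal(2)[OF 2] by blast
    obtain s where s: "s \<in> R" "r' * x ^ n = x ^ n * s" using Suc.IH(2)[OF r'(1)] by blast
    have "r * x ^ Suc n = (r * x) * x ^ n" by (simp only: power_Suc mult.assoc)
    also have "\<dots> = x ^ Suc n * s" by (simp only: r' s mult.assoc power_Suc)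
    finally show ?case using s by blast
  }
qed auto

lemma pols_Suc_iff: "p \<in> pols R x (Suc n) \<longleftrightarrow> (\<exists>q\<in>pols R x n. \<exists>r\<in>R. p = q + r * x ^ n)"
  by auto

lemma pols_zero: "0 \<in> pols R x n"
  by (induction n) (use unital_subringD(1)[OF R] in force)+

lemma pols_Suc_mono: "p \<in> pols R x n \<Longrightarrow> p \<in> pols R x (Suc n)"
  using unital_subringD(1)[OF R] by force

lemma pols_mono: "m \<le> n \<Longrightarrow> p \<in> pols R x m \<Longrightarrow> p \<in> pols R x n"
  by (induction rule: dec_induct) (blast intro: pols_Suc_mono)+

lemma pols_add: "p \<in> pols R x n \<Longrightarrow> q \<in> pols R x n \<Longrightarrow> p + q \<in> pols R x n"
proof (induction n arbitrary: p q)
  case (Suc n)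
  obtain p' r where p: "p' \<in> pols R x n" "r \<in> R" "p = p' + r * x ^ n" using Suc.prems(1) by auto
  obtain q' s where q: "q' \<in> pols R x n" "s \<in> R" "q = q' + s * x ^ n" using Suc.prems(2) by auto
  have "p + q = (p' + q') + (r + s) * x ^ n" by (simp add: p q algebra_simps)
  then show ?case
    unfolding pols_Suc_iff using Suc.IH[OF p(1) q(1)] unital_subringD(3)[OF R p(2) q(2)] by blast
qed simp

lemma pols_lmult: "r \<in> R \<Longrightarrow> p \<in> pols R x n \<Longrightarrow> r * p \<in> pols R x n"
proof (induction n arbitrary: p)
  case (Suc n)
  obtain p' s where p: "p' \<in> pols R x n" "s \<in> R" "p = p' + s * x ^ n" using Suc.prems(2) by auto
  have "r * p = r * p' + (r * s) * x ^ n" by (simp add: p algebra_simps)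
  then show ?case
    unfolding pols_Suc_iff using Suc.IH[OF Suc.prems(1) p(1)] unital_subringD(4)[OF R Suc.prems(1) p(2)] by blast
qed simp

lemma pols_rmult: "r \<in> R \<Longrightarrow> p \<in> pols R x n \<Longrightarrow> p * r \<in> pols R x n"
proof (induction n arbitrary: p)
  case (Suc n)
  obtain p' s where p: "p' \<in> pols R x n" "s \<in> R" "p = p' + s * x ^ n" using Suc.prems(2) by auto
  obtain r' where r': "r' \<in> R" "x ^ n * r = r' * x ^ n" using normal_power(1)[OF Suc.prems(1)] by blast
  have "p * r = p' * r + (s * r') * x ^ n" by (simp add: p distrib_right mult.assoc r')
  then show ?case
    unfolding pols_Suc_iff using Suc.IH[OF Suc.prems(1) p(1)] unital_subringD(4)[OF R p(2) r'(1)] by blast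
qed simp

lemma pols_shift: "p \<in> pols R x n \<Longrightarrow> p * x ^ m \<in> pols R x (n + m)"
proof (induction n arbitrary: p)
  case 0
  then show ?case using pols_zero by simp
next
  case (Suc n)
  obtain p' s where p: "p' \<in> pols R x n" "s \<in> R" "p = p' + s * x ^ n" using Suc.prems by auto
  have "p * x ^ m = p' * x ^ m + s * x ^ (n + m)"
    by (simp add: p distrib_right mult.assoc power_add)
  then show ?case unfolding add_Suc pols_Suc_iff using Suc.IH[OF p(1)] p(2) by blast
qed

lemma pols_mult: "p \<in> pols R x n \<Longrightarrow> q \<in> pols R x m \<Longrightarrow> p * q \<in> pols R x (n + m)"
proof (induction m arbitrary: q)
  case 0
  then show ?case using pols_zero by simp
next
  case (Suc m)
  obtain q' s where q: "q' \<in> pols R x m" "s \<in> R" "q = q' + s * x ^ m" using Suc.prems(2) by auto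
  have "p * q = p * q' + (p * s) * x ^ m" by (simp add: q distrib_left mult.assoc)
  moreover have "p * q' + (p * s) * x ^ m \<in> pols R x (n + m)"
    by (rule pols_add[OF Suc.IH[OF Suc.prems(1) q(1)] pols_shift[OF pols_rmult[OF q(2) Suc.prems(1)]]])
  ultimately show ?case using pols_Suc_mono by simp
qed

lemma base_subset_adjoin: "R \<subseteq> adjoin R x"
proof
  fix r assume "r \<in> R"
  then have "r \<in> pols R x (Suc 0)" by simp
  then show "r \<in> adjoin R x" unfolding adjoin_def by blast
qed

lemma generator_in_adjoin: "x \<in> adjoin R x"
proof -
  have "x \<in> pols R x (Suc (Suc 0))"
    using unital_subringD(1,2)[OF R] by force
  then show ?thesis unfolding adjoin_def by blast
qed

lemma pols_subset_adjoin: "p \<in> pols R x n \<Longrightarrow> p \<in> adjoin R x"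
  unfolding adjoin_def by blast

lemma unital_subring_adjoin: "unital_subring (adjoin R x)"
proof -
  have mono: "\<exists>k. p \<in> pols R x k \<and> q \<in> pols R x k" if "p \<in> adjoin R x" "q \<in> adjoin R x" for p q
    using that pols_mono[of _ "max _ _"] unfolding adjoin_def by (meson UN_E max.cobounded1 max.cobounded2 pols_mono)
  have "p + q \<in> adjoin R x \<and> p * q \<in> adjoin R x" if "p \<in> adjoin R x" "q \<in> adjoin R x" for p q
    using mono[OF that] pols_add pols_mult pols_subset_adjoin by blast
  moreover have "- p \<in> adjoin R x" if "p \<in> adjoin R x" for p
  proof -
    have "(- 1) * p \<in> adjoin R x"
      using that pols_lmult[OF unital_subringD(5)[OF R unital_subringD(2)[OF R]]]
      unfolding adjoin_def by blast
    then show ?thesis by simp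
  qed
  ultimately show ?thesis
    using base_subset_adjoin unital_subringD(1,2)[OF R] unfolding unital_subring_def by blast
qed

text \<open>Since \<open>x\<close> may satisfy relations over \<open>R\<close>, an element has
  several expressions; a coefficient counts as leading if some expression of an element of
  \<open>I\<close> has it at \<open>x ^ n\<close>.\<close>

definition leading :: "nat \<Rightarrow> 'a set \<Rightarrow> 'a set" where
  "leading n I = {r \<in> R. \<exists>p\<in>pols R x n. p + r * x ^ n \<in> I}"

lemma leadingI: "r \<in> R \<Longrightarrow> p \<in> pols R x n \<Longrightarrow> p + r * x ^ n \<in> I \<Longrightarrow> r \<in> leading n I"
  unfolding leading_def by blast

lemma leadingE:
  assumes "r \<in> leading n I"
  obtains p where "r \<in> R" "p \<in> pols R x n" "p + r * x ^ n \<in> I"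
  using assms unfolding leading_def by blast

lemma leading_ideal:
  assumes I: "two_sided_ideal (adjoin R x) I"
  shows "two_sided_ideal R (leading n I)"
proof (rule two_sided_idealI)
  show "leading n I \<subseteq> R" by (auto simp: leading_def)
  show "0 \<in> leading n I"
    by (rule leadingI[of _ 0]) (use unital_subringD(1)[OF R] pols_zero two_sided_idealD(2)[OF I] in auto)
next
  fix r s assume "r \<in> leading n I" "s \<in> leading n I"
  then obtain p q where p: "r \<in> R" "p \<in> pols R x n" "p + r * x ^ n \<in> I"
    and q: "s \<in> R" "q \<in> pols R x n" "q + s * x ^ n \<in> I" by (elim leadingE)
  have "(p + q) + (r + s) * x ^ n \<in> I"
    using two_sided_idealD(3)[OF I p(3) q(3)] by (simp add: algebra_simps)
  then show "r + s \<in> leading n I"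
    by (rule leadingI[OF unital_subringD(3)[OF R p(1) q(1)] pols_add[OF p(2) q(2)]])
next
  fix s r assume s: "s \<in> R" and "r \<in> leading n I"
  then obtain p where p: "r \<in> R" "p \<in> pols R x n" "p + r * x ^ n \<in> I" by (elim leadingE)
  have "s * (p + r * x ^ n) \<in> I"
    using two_sided_idealD(4)[OF I _ p(3)] s base_subset_adjoin by blast
  then have "s * p + (s * r) * x ^ n \<in> I" by (simp add: algebra_simps)
  then show "s * r \<in> leading n I"
    by (rule leadingI[OF unital_subringD(4)[OF R s p(1)] pols_lmult[OF s p(2)]])
  \<comment> \<open>The element of \<open>I\<close> must be multiplied by \<open>s'\<close> on the
    right, so that its coefficient at \<open>x ^ n\<close> becomes \<open>r * s\<close>.\<close>
  obtain s' where s': "s' \<in> R" "s * x ^ n = x ^ n * s'" using normal_power(2)[OF s] by blast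
  have "(p + r * x ^ n) * s' \<in> I"
    using two_sided_idealD(5)[OF I _ p(3)] s'(1) base_subset_adjoin by blast
  then have "p * s' + (r * s) * x ^ n \<in> I" by (simp add: distrib_right mult.assoc s'(2))
  then show "r * s \<in> leading n I"
    by (rule leadingI[OF unital_subringD(4)[OF R p(1) s] pols_rmult[OF s'(1) p(2)]])
qed

lemma leading_mono: "I \<subseteq> J \<Longrightarrow> leading n I \<subseteq> leading n J"
  unfolding leading_def by blast

lemma leading_Suc:
  assumes I: "two_sided_ideal (adjoin R x) I"
  shows "leading n I \<subseteq> leading (Suc n) I"
proof
  fix r assume "r \<in> leading n I"
  then obtain p where p: "r \<in> R" "p \<in> pols R x n" "p + r * x ^ n \<in> I" by (elim leadingE)
  have "(p + r * x ^ n) * x \<in> I" by (rule two_sided_idealD(5)[OF I generator_in_adjoin p(3)])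
  then have "p * x ^ 1 + r * x ^ Suc n \<in> I"
    by (simp add: distrib_right mult.assoc power_commutes)
  then show "r \<in> leading (Suc n) I"
    by (rule leadingI[OF p(1), rotated]) (use pols_shift[OF p(2), of 1] in simp)
qed

text \<open>From an element of \<open>J\<close> subtract an element of \<open>I\<close> with the
  same leading coefficient; the difference has smaller degree.\<close>

lemma eq_if_leading_eq:
  assumes I: "two_sided_ideal (adjoin R x) I" and J: "two_sided_ideal (adjoin R x) J"
    and sub: "I \<subseteq> J" and lead: "\<And>n. leading n J \<subseteq> leading n I"
  shows "J = I"
proof -
  have "p \<in> I" if "p \<in> pols R x n" "p \<in> J" for p n
    using that
  proof (induction n arbitrary: p)
    case 0
    then show ?case using two_sided_idealD(2)[OF I] by simp
  next
    case (Suc n)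
    obtain q r where q: "q \<in> pols R x n" "r \<in> R" "p = q + r * x ^ n" using Suc.prems(1) by auto
    have "r \<in> leading n J" by (rule leadingI[OF q(2,1)]) (use Suc.prems(2) q(3) in simp)
    then have "r \<in> leading n I" using lead by blast
    then obtain q' where q': "q' \<in> pols R x n" "q' + r * x ^ n \<in> I" by (elim leadingE)
    have neg: "- q' \<in> pols R x n"
      using pols_lmult[OF unital_subringD(5)[OF R unital_subringD(2)[OF R]] q'(1)] by simp
    have "q + - q' \<in> J"
      using two_sided_idealD(3)[OF J Suc.prems(2)
          two_sided_ideal_minus[OF unital_subring_adjoin J subsetD[OF sub q'(2)]]]
      by (simp add: q(3))
    then have "q + - q' \<in> I" by (rule Suc.IH[OF pols_add[OF q(1) neg]])
    from two_sided_idealD(3)[OF I this q'(2)] show ?case by (simp add: q(3))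
  qed
  then show ?thesis using sub two_sided_idealD(1)[OF J] unfolding adjoin_def by blast
qed

text \<open>The ideals \<open>leading n (I j)\<close> grow in both indices. The diagonal is constant
  from \<open>N\<close> on, which makes all rows beyond \<open>N\<close> stationary at once; each of
  the finitely many rows up to \<open>N\<close> is stationary by the chain condition in
  \<open>R\<close>.\<close>

theorem ideal_acc_adjoin:
  assumes acc: "ideal_acc R"
  shows "ideal_acc (adjoin R x)"
  unfolding ideal_acc_def
proof (intro allI impI)
  fix I :: "nat \<Rightarrow> 'a set"
  assume "\<forall>n. two_sided_ideal (adjoin R x) (I n)" and "\<forall>n. I n \<subseteq> I (Suc n)"
  then have I: "\<And>n. two_sided_ideal (adjoin R x) (I n)" and Suc: "\<And>n. I n \<subseteq> I (Suc n)" by blast+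
  have chain: "I m \<subseteq> I n" if "m \<le> n" for m n by (rule lift_Suc_mono_le[of I, OF Suc that])
  note ACC = acc[unfolded ideal_acc_def, rule_format]
  have lead_mono: "leading m (I i) \<subseteq> leading n (I j)" if "m \<le> n" "i \<le> j" for m n i j
  proof -
    have "leading m (I i) \<subseteq> leading n (I i)"
      by (rule lift_Suc_mono_le[of "\<lambda>k. leading k (I i)", OF _ that(1)]) (rule leading_Suc[OF I])
    then show ?thesis using leading_mono[OF chain[OF that(2)]] by blast
  qed
  obtain N where N: "\<And>n. n \<ge> N \<Longrightarrow> leading n (I n) = leading N (I N)"
    using ACC[of "\<lambda>n. leading n (I n)"] leading_ideal[OF I] lead_mono by (metis le_SucI order_refl)
  have "\<exists>k. \<forall>j\<ge>k. leading n (I j) = leading n (I k)" for n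
    using ACC[of "\<lambda>j. leading n (I j)"] leading_ideal[OF I] lead_mono by (metis le_SucI order_refl)
  then obtain K where K: "\<And>n j. j \<ge> K n \<Longrightarrow> leading n (I j) = leading n (I (K n))" by metis
  define M where "M = Max (insert N (K ` {..N}))"
  have M: "N \<le> M" "\<And>n. n \<le> N \<Longrightarrow> K n \<le> M" unfolding M_def by (rule Max_ge; simp)+
  have lead: "leading n (I j) \<subseteq> leading n (I M)" if j: "j \<ge> M" for n j
  proof (cases "n \<le> N")
    case True
    then show ?thesis using K[of n j] K[of n M] M(2)[OF True] j by simp
  next
    case False
    have "leading n (I j) \<subseteq> leading (max n j) (I (max n j))" by (rule lead_mono) auto
    also have "\<dots> = leading N (I N)" using False by (intro N) auto
    also have "\<dots> \<subseteq> leading n (I M)" using False M by (intro lead_mono) auto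
    finally show ?thesis .
  qed
  show "\<exists>N. \<forall>n\<ge>N. I n = I N"
    using eq_if_leading_eq[OF I I chain lead] by blast
qed

end

lemma ideal_acc_maximal:
  assumes acc: "ideal_acc R" and ideal: "\<And>I. I \<in> C \<Longrightarrow> two_sided_ideal R I" and "I0 \<in> C"
  shows "\<exists>M\<in>C. \<forall>I\<in>C. M \<subseteq> I \<longrightarrow> I = M"
proof (rule ccontr)
  assume "\<not> ?thesis"
  then have "\<forall>I\<in>C. \<exists>J. J \<in> C \<and> I \<subset> J" by blast
  then obtain g where g: "\<And>I. I \<in> C \<Longrightarrow> g I \<in> C" "\<And>I. I \<in> C \<Longrightarrow> I \<subset> g I" by metis
  define f where "f n = (g ^^ n) I0" for n
  have f: "f n \<in> C" for n
    unfolding f_def by (induction n) (simp_all add: \<open>I0 \<in> C\<close> g(1))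
  have less: "f n \<subset> f (Suc n)" for n using g(2)[OF f[of n]] by (simp add: f_def)
  have "\<exists>N. \<forall>n\<ge>N. f n = f N"
    by (rule acc[unfolded ideal_acc_def, rule_format]) (rule ideal[OF f], rule psubset_imp_subset[OF less])
  then obtain N where "\<forall>n\<ge>N. f n = f N" by (elim exE)
  then have "f (Suc N) = f N" by (elim allE[of _ "Suc N"]) simp
  then show False using less[of N] by simp
qed

section \<open>The parity involution and finitely generated superalgebras\<close>

definition parity_involution :: "'a::super_vector_space \<Rightarrow> 'a" where
  "parity_involution a = hcomp 0 a - hcomp 1 a"

lemma clinear_parity_involution: "clinear (parity_involution :: 'a::super_vector_space \<Rightarrow> 'a)"
  by (simp add: clinear_iff parity_involution_def hcomp_add hcomp_cscale cvs.scale_right_diff_distrib)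

lemma hcomp_diff: "hcomp p (x - y) = hcomp p x - hcomp p (y::'a::super_vector_space)"
  using hcomp_add[of p x "- y"] by (simp add: hcomp_uminus)

lemma parity_involution_homogeneous:
  assumes "hcomp p a = a"
  shows "parity_involution a = (if p = 0 then a else - a)"
  unfolding parity_involution_def
  by (simp only: hcomp_homogeneous[OF assms]) (cases p; simp)

lemma parity_involution_mult:
  fixes a b :: "'a::super_algebra"
  shows "parity_involution (a * b) = parity_involution a * parity_involution b"
proof -
  let ?s = "parity_involution :: 'a \<Rightarrow> 'a"
  note lin = clinear_simps[OF clinear_parity_involution]
  have "?s (hcomp p a * hcomp q b) = ?s (hcomp p a) * ?s (hcomp q b)" for p q
    using hcomp_mult[of p "hcomp p a" q "hcomp q b"]
    by (simp add: parity_involution_homogeneous[OF hcomp_idem] parity_involution_homogeneous[of "p + q"])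
  then have "?s ((hcomp 0 a + hcomp 1 a) * (hcomp 0 b + hcomp 1 b))
      = ?s (hcomp 0 a + hcomp 1 a) * ?s (hcomp 0 b + hcomp 1 b)"
    by (simp only: lin distrib_left distrib_right)
  then show ?thesis by (simp only: hcomp_sum)
qed

lemma parity_involution_involution: "parity_involution (parity_involution a) = a"
  by (simp add: parity_involution_def hcomp_diff hcomp_hcomp hcomp_sum)

lemma odd_commute:
  fixes x :: "'a::supercommutative_algebra"
  assumes "hcomp 1 x = x"
  shows "x * r = parity_involution r * x"
proof -
  have "x * hcomp 0 r = hcomp 0 r * x" "x * hcomp 1 r = - (hcomp 1 r * x)"
    using supercommute[OF assms, of 0 "hcomp 0 r"] supercommute[OF assms, of 1 "hcomp 1 r"]
    by (simp_all add: ksign_def cscale_one)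
  then have "x * (hcomp 0 r + hcomp 1 r) = parity_involution r * x"
    by (simp add: parity_involution_def distrib_left left_diff_distrib)
  then show ?thesis by (simp only: hcomp_sum)
qed

text \<open>The source of normality: passing a homogeneous element changes the other factor by an
  automorphism, either the identity or \<open>parity_involution\<close>.\<close>

lemma homogeneous_commute:
  fixes x :: "'a::supercommutative_algebra"
  assumes "hcomp p x = x"
  shows "x * r = (if p = 0 then r else parity_involution r) * x"
    "r * x = x * (if p = 0 then r else parity_involution r)"
proof -
  show *: "x * r = (if p = 0 then r else parity_involution r) * x" for r
    using assms odd_commute[of x r] even_commute[of x r] by (cases p) (simp_all add: homogeneous_def)
  show "r * x = x * (if p = 0 then r else parity_involution r)"
    using *[of "if p = 0 then r else parity_involution r"] by (simp add: parity_involution_involution)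
qed

lemma homogeneous_normal:
  fixes x :: "'a::supercommutative_algebra"
  assumes "hcomp p x = x"
  shows "\<exists>r'. x * r = r' * x" "\<exists>r'. r * x = x * r'"
  using homogeneous_commute[OF assms, of r] by blast+

text \<open>Generators are adjoined one at a time. Stability of \<open>R\<close> under
  \<open>parity_involution\<close> is carried along since it is what makes the next generator normal
  over \<open>R\<close> when that generator is odd.\<close>

lemma finitely_generated_subring_acc:
  fixes F :: "'a::supercommutative_algebra set"
  assumes "finite F" "\<And>x. x \<in> F \<Longrightarrow> \<exists>p. hcomp p x = x"
  shows "\<exists>R. unital_subring R \<and> ideal_acc R \<and> parity_involution ` R \<subseteq> R \<and> range (\<lambda>c. c *\<^sub>C 1) \<subseteq> R \<and> F \<subseteq> R"
  using assms
proof (induction F rule: finite_induct)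
  case empty
  let ?R = "range (\<lambda>c. c *\<^sub>C 1) :: 'a set"
  have "unital_subring ?R"
    unfolding unital_subring_def
  proof (intro conjI ballI)
    show "0 \<in> ?R" by (rule image_eqI[of _ _ 0]) simp_all
    show "1 \<in> ?R" by (rule image_eqI[of _ _ 1]) (simp_all add: cscale_one)
    fix x y assume "x \<in> ?R" "y \<in> ?R"
    then obtain c d where xy: "x = c *\<^sub>C 1" "y = d *\<^sub>C 1" by blast
    show "x + y \<in> ?R" by (rule image_eqI[of _ _ "c + d"]) (simp_all add: xy cscale_add_left)
    show "x * y \<in> ?R"
      by (rule image_eqI[of _ _ "c * d"]) (simp_all add: xy cscale_mult_left cscale_cscale)
    show "- x \<in> ?R" by (rule image_eqI[of _ _ "- c"]) (simp_all add: xy)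
  qed
  moreover have "ideal_acc ?R"
    unfolding ideal_acc_def
  proof (intro allI impI)
    fix I :: "nat \<Rightarrow> 'a set"
    assume "\<forall>n. two_sided_ideal ?R (I n)" and "\<forall>n. I n \<subseteq> I (Suc n)"
    then have I: "\<And>n. two_sided_ideal ?R (I n)" and Suc: "\<And>n. I n \<subseteq> I (Suc n)" by blast+
    have chain: "I m \<subseteq> I n" if "m \<le> n" for m n by (rule lift_Suc_mono_le[of I, OF Suc that])
    show "\<exists>N. \<forall>n\<ge>N. I n = I N"
    proof (cases "\<exists>N. I N \<noteq> {0}")
      case True
      then obtain N x where x: "x \<in> I N" "x \<noteq> 0" using two_sided_idealD(2)[OF I] by blast
      then have "x \<in> ?R" using two_sided_idealD(1)[OF I, of N] by blast
      then obtain c where c1: "x = c *\<^sub>C 1" by (elim imageE)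
      with x(2) have c: "x = c *\<^sub>C 1" "c \<noteq> 0" by auto
      have "?R \<subseteq> I N"
      proof (rule image_subsetI)
        fix d :: complex
        have "((d / c) *\<^sub>C 1) * x \<in> I N" by (rule two_sided_idealD(4)[OF I rangeI x(1)])
        then show "d *\<^sub>C 1 \<in> I N" using c(2) by (simp add: c(1) cscale_mult_left cscale_cscale)
      qed
      then have "I n = I N" if "n \<ge> N" for n
        using chain[OF that] two_sided_idealD(1)[OF I, of n] by blast
      then show ?thesis by (intro exI allI impI)
    next
      case False
      then show ?thesis by (intro exI[of _ 0]) simp
    qed
  qed
  moreover have "parity_involution ` ?R \<subseteq> ?R"
    by (auto simp: clinear_simps[OF clinear_parity_involution] parity_involution_homogeneous[OF hcomp_one])
  ultimately show ?case by (intro exI[of _ ?R]) simp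
next
  case (insert x F)
  then obtain R where R: "unital_subring R" "ideal_acc R" "parity_involution ` R \<subseteq> R"
    "range (\<lambda>c. c *\<^sub>C 1) \<subseteq> R" "F \<subseteq> R" by auto
  obtain p where p: "hcomp p x = x" using insert.prems by blast
  let ?\<sigma> = "parity_involution :: 'a \<Rightarrow> 'a"
  have normal: "\<exists>r'\<in>R. x * r = r' * x" "\<exists>r'\<in>R. r * x = x * r'" if "r \<in> R" for r
  proof -
    have "(if p = 0 then r else ?\<sigma> r) \<in> R" using that R(3) by auto
    then show "\<exists>r'\<in>R. x * r = r' * x" "\<exists>r'\<in>R. r * x = x * r'"
      using homogeneous_commute[OF p, of r] by blast+
  qed
  \<comment> \<open>The involution fixes \<open>x ^ n\<close> up to sign, and \<open>e\<close> is
    that sign as an element of \<open>R\<close>.\<close>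
  have power: "\<exists>e\<in>R. ?\<sigma> (x ^ n) = e * x ^ n" for n
  proof (induction n)
    case 0
    then show ?case
      using unital_subringD(2)[OF R(1)]
      by (intro bexI[of _ 1]) (simp_all add: parity_involution_homogeneous[OF hcomp_one])
  next
    case (Suc n)
    then obtain e where e: "e \<in> R" "?\<sigma> (x ^ n) = e * x ^ n" by blast
    have "?\<sigma> x = x \<or> ?\<sigma> x = - x" by (simp add: parity_involution_homogeneous[OF p])
    then have "?\<sigma> (x ^ Suc n) = e * x ^ Suc n \<or> ?\<sigma> (x ^ Suc n) = (- e) * x ^ Suc n"
      unfolding power_Suc2 parity_involution_mult e(2) by (auto simp: mult.assoc)
    then show ?case using e(1) unital_subringD(5)[OF R(1) e(1)] by blast
  qed
  have "?\<sigma> y \<in> pols R x n" if "y \<in> pols R x n" for y n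
    using that
  proof (induction n arbitrary: y)
    case 0
    then show ?case by (simp add: clinear_simps[OF clinear_parity_involution])
  next
    case (Suc n)
    obtain q r where q: "q \<in> pols R x n" "r \<in> R" "y = q + r * x ^ n" using Suc.prems by auto
    obtain e where e: "e \<in> R" "?\<sigma> (x ^ n) = e * x ^ n" using power by blast
    have "?\<sigma> y = ?\<sigma> q + (?\<sigma> r * e) * x ^ n"
      by (simp add: q(3) clinear_simps[OF clinear_parity_involution] parity_involution_mult e(2) mult.assoc)
    moreover have "?\<sigma> r * e \<in> R" using R(3) q(2) e(1) unital_subringD(4)[OF R(1)] by blast
    ultimately show ?case using Suc.IH[OF q(1)] by auto
  qed
  then have "?\<sigma> ` adjoin R x \<subseteq> adjoin R x" unfolding adjoin_def by blast
  moreover note unital_subring_adjoin[OF R(1) normal] ideal_acc_adjoin[OF R(1) normal R(2)]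
    base_subset_adjoin[OF R(1) normal] generator_in_adjoin[OF R(1) normal]
  ultimately show ?case using R(4,5) by (intro exI[of _ "adjoin R x"]) blast
qed

theorem finitely_generated_acc:
  fixes F :: "'a::supercommutative_algebra set"
  assumes "finite F" "subalgebra_generated F = UNIV"
  shows "ideal_acc (UNIV :: 'a set)"
proof -
  \<comment> \<open>Homogeneous components replace the generators, because normality comes from
    homogeneity.\<close>
  let ?F = "hcomp 0 ` F \<union> hcomp 1 ` F"
  have "\<exists>p. hcomp p x = x" if "x \<in> ?F" for x using that by (auto intro: hcomp_idem)
  then obtain R where R: "unital_subring R" "ideal_acc R" "range (\<lambda>c. c *\<^sub>C 1) \<subseteq> R" "?F \<subseteq> R"
    using finitely_generated_subring_acc[of ?F] assms(1) by auto
  have "x \<in> R" if "x \<in> subalgebra_generated F" for x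
    using that
  proof induction
    case (1 x)
    then have "hcomp 0 x + hcomp 1 x \<in> R" using R(4) by (intro unital_subringD(3)[OF R(1)]) auto
    then show ?case by (simp only: hcomp_sum)
  next
    case (5 x c)
    have "(c *\<^sub>C 1) * x \<in> R" using R(3) 5 by (intro unital_subringD(4)[OF R(1)]) auto
    then show ?case by (simp add: cscale_mult_left)
  qed (use unital_subringD[OF R(1)] in auto)
  then have "R = UNIV" using assms(2) by blast
  then show ?thesis using R(2) by simp
qed

section \<open>Products and powers of ideals\<close>

lemma clinear_mult: "clinear (\<lambda>y. r * y)" "clinear (\<lambda>y. y * r)" for r :: "'a::super_algebra"
  by (simp_all add: clinear_iff distrib_left distrib_right cscale_mult_left cscale_mult_right)

lemma two_sided_ideal_csubspace:
  fixes I :: "'a::super_algebra set"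
  assumes "two_sided_ideal UNIV I"
  shows "csubspace I"
proof (rule csubspaceI)
  fix c x assume "x \<in> I"
  then have "(c *\<^sub>C 1) * x \<in> I" by (rule two_sided_idealD(4)[OF assms UNIV_I])
  then show "c *\<^sub>C x \<in> I" by (simp add: cscale_mult_left)
qed (use two_sided_idealD[OF assms] in auto)

definition ideal_mult :: "'a::super_algebra set \<Rightarrow> 'a set \<Rightarrow> 'a set" where
  "ideal_mult I J = cspan {a * b | a b. a \<in> I \<and> b \<in> J}"

lemma ideal_mult_mem: "a \<in> I \<Longrightarrow> b \<in> J \<Longrightarrow> a * b \<in> ideal_mult I J"
  unfolding ideal_mult_def by (rule cvs.span_base) blast

lemma ideal_mult_subset:
  assumes "csubspace S" "\<And>a b. a \<in> I \<Longrightarrow> b \<in> J \<Longrightarrow> a * b \<in> S"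
  shows "ideal_mult I J \<subseteq> S"
  unfolding ideal_mult_def by (rule cvs.span_minimal) (use assms in auto)

lemma csubspace_ideal_mult: "csubspace (ideal_mult I J)"
  by (simp add: ideal_mult_def)

lemma ideal_mult_mono: "I \<subseteq> I' \<Longrightarrow> J \<subseteq> J' \<Longrightarrow> ideal_mult I J \<subseteq> ideal_mult I' J'"
  by (rule ideal_mult_subset[OF csubspace_ideal_mult]) (auto intro: ideal_mult_mem)

primrec ideal_power :: "'a::super_algebra set \<Rightarrow> nat \<Rightarrow> 'a set" where
  "ideal_power J 0 = UNIV"
| "ideal_power J (Suc n) = ideal_mult J (ideal_power J n)"

lemma csubspace_ideal_power: "csubspace (ideal_power J n)"
  by (cases n) (simp_all add: csubspace_ideal_mult)

lemma ideal_power_mono: "I \<subseteq> J \<Longrightarrow> ideal_power I n \<subseteq> ideal_power J n"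
  by (induction n) (simp_all add: ideal_mult_mono)

lemma ideal_power_add: "ideal_power J (m + k) \<subseteq> ideal_mult (ideal_power J m) (ideal_power J k)"
proof (induction m)
  case 0
  show ?case
  proof
    fix x assume "x \<in> ideal_power J (0 + k)"
    then have "1 * x \<in> ideal_mult (ideal_power J 0) (ideal_power J k)" by (intro ideal_mult_mem) simp_all
    then show "x \<in> ideal_mult (ideal_power J 0) (ideal_power J k)" by simp
  qed
next
  case (Suc m)
  have "a * b \<in> ideal_mult (ideal_power J (Suc m)) (ideal_power J k)"
    if a: "a \<in> J" and b: "b \<in> ideal_power J (m + k)" for a b
  proof (rule cspan_image_closed[OF clinear_mult(1)[of a] csubspace_ideal_mult])
    show "b \<in> cspan {c * d | c d. c \<in> ideal_power J m \<and> d \<in> ideal_power J k}"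
      using b Suc unfolding ideal_mult_def by blast
    fix y assume "y \<in> {c * d | c d. c \<in> ideal_power J m \<and> d \<in> ideal_power J k}"
    then obtain c d where cd: "y = c * d" "c \<in> ideal_power J m" "d \<in> ideal_power J k" by blast
    have "a * c \<in> ideal_power J (Suc m)" using a cd(2) by (simp add: ideal_mult_mem)
    then have "(a * c) * d \<in> ideal_mult (ideal_power J (Suc m)) (ideal_power J k)"
      using cd(3) by (rule ideal_mult_mem)
    then show "a * y \<in> ideal_mult (ideal_power J (Suc m)) (ideal_power J k)"
      by (simp only: cd(1) mult.assoc)
  qed
  then show ?case
    by (simp only: add_Suc ideal_power.simps(2)) (rule ideal_mult_subset[OF csubspace_ideal_mult], simp)
qed

lemma ideal_power_mult:
  assumes "ideal_power I k \<subseteq> M"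
  shows "ideal_power I (k * a) \<subseteq> ideal_power M a"
proof (induction a)
  case (Suc a)
  have "ideal_power I (k * Suc a) \<subseteq> ideal_mult (ideal_power I k) (ideal_power I (k * a))"
    using ideal_power_add[of I k "k * a"] by simp
  also have "\<dots> \<subseteq> ideal_power M (Suc a)"
    using ideal_mult_mono[OF assms Suc] by simp
  finally show ?case .
qed simp

lemma ideal_power_sum:
  assumes L: "two_sided_ideal UNIV L"
  shows "ideal_power {j + l | j l. j \<in> J \<and> l \<in> L} n \<subseteq> {x + l | x l. x \<in> ideal_power J n \<and> l \<in> L}"
proof (induction n)
  case 0
  show ?case
  proof
    fix x :: 'a
    have "x + 0 \<in> {x + l | x l. x \<in> ideal_power J 0 \<and> l \<in> L}"
      using two_sided_idealD(2)[OF L] unfolding ideal_power.simps(1) by blast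
    then show "x \<in> {x + l | x l. x \<in> ideal_power J 0 \<and> l \<in> L}" by simp
  qed
next
  case (Suc n)
  note D = two_sided_idealD[OF L]
  show ?case
    unfolding ideal_power.simps(2)
  proof (rule ideal_mult_subset)
    show "csubspace {x + l | x l. x \<in> ideal_mult J (ideal_power J n) \<and> l \<in> L}"
      by (rule cvs.subspace_sums[OF csubspace_ideal_mult two_sided_ideal_csubspace[OF L]])
    fix a b assume "a \<in> {j + l | j l. j \<in> J \<and> l \<in> L}"
      and "b \<in> ideal_power {j + l | j l. j \<in> J \<and> l \<in> L} n"
    then obtain j l x l' where a: "a = j + l" "j \<in> J" "l \<in> L"
      and b: "b = x + l'" "x \<in> ideal_power J n" "l' \<in> L"
      using Suc by blast
    have "a * b = j * x + (j * l' + l * b)" by (simp add: a(1) b(1) algebra_simps)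
    moreover have "j * x \<in> ideal_mult J (ideal_power J n)" using a(2) b(2) by (rule ideal_mult_mem)
    moreover have "j * l' + l * b \<in> L" by (rule D(3)[OF D(4)[OF UNIV_I b(3)] D(5)[OF UNIV_I a(3)]])
    ultimately show "a * b \<in> {x + l | x l. x \<in> ideal_mult J (ideal_power J n) \<and> l \<in> L}" by blast
  qed
qed

lemma homogeneous_normal_power:
  fixes y :: "'a::supercommutative_algebra"
  assumes "hcomp p y = y"
  shows "\<exists>a'. a * y ^ n = y ^ n * a'" "\<exists>a'. y ^ n * a = a' * y ^ n"
  using normal_power[OF unital_subring_UNIV, of y a n] homogeneous_normal[OF assms] by simp_all

text \<open>Modulo \<open>J\<close> a product of n multiples of \<open>y\<close> is a multiple of
  \<open>y ^ n\<close>, because normality collects the factors \<open>y\<close> on the left.\<close>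

lemma ideal_power_principal_sum:
  fixes y :: "'a::supercommutative_algebra"
  assumes J: "two_sided_ideal UNIV J" and y: "hcomp p y = y"
  shows "ideal_power {j + y * a | j a. j \<in> J} n \<subseteq> {j + y ^ n * a | j a. j \<in> J}"
proof (induction n)
  case 0
  show ?case
  proof
    fix x :: 'a
    have "0 + y ^ 0 * x \<in> {j + y ^ 0 * a | j a. j \<in> J}" using two_sided_idealD(2)[OF J] by blast
    then show "x \<in> {j + y ^ 0 * a | j a. j \<in> J}" by simp
  qed
next
  case (Suc n)
  note D = two_sided_idealD[OF J]
  show ?case
    unfolding ideal_power.simps(2)
  proof (rule ideal_mult_subset)
    have "{j + y ^ Suc n * a | j a. j \<in> J} = {j + z | j z. j \<in> J \<and> z \<in> (\<lambda>a. y ^ Suc n * a) ` UNIV}"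
      by blast
    then show "csubspace {j + y ^ Suc n * a | j a. j \<in> J}"
      using cvs.subspace_sums[OF two_sided_ideal_csubspace[OF J]
          csubspace_image[OF clinear_mult(1) cvs.subspace_UNIV, of "y ^ Suc n"]] by simp
    fix u v assume "u \<in> {j + y * a | j a. j \<in> J}"
      and "v \<in> ideal_power {j + y * a | j a. j \<in> J} n"
    then obtain j a j' b where u: "u = j + y * a" "j \<in> J" and v: "v = j' + y ^ n * b" "j' \<in> J"
      using Suc by blast
    obtain a' where a': "a * y ^ n = y ^ n * a'" using homogeneous_normal_power(1)[OF y] by blast
    have "u * v = (j * v + (y * a) * j') + y * (a * y ^ n) * b"
      by (simp add: u(1) v(1) algebra_simps)
    also have "y * (a * y ^ n) * b = y ^ Suc n * (a' * b)" by (simp add: a' mult.assoc)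
    finally have "u * v = (j * v + (y * a) * j') + y ^ Suc n * (a' * b)" .
    moreover have "j * v + (y * a) * j' \<in> J"
      by (rule D(3)[OF D(5)[OF UNIV_I u(2)] D(4)[OF UNIV_I v(2)]])
    ultimately show "u * v \<in> {j + y ^ Suc n * a | j a. j \<in> J}" by blast
  qed
qed

text \<open>Written as a right ideal, which is two-sided as soon as the generators are
  homogeneous.\<close>

definition ideal_gen :: "'a::super_algebra set \<Rightarrow> 'a set" where
  "ideal_gen Y = cspan {y * a | y a. y \<in> Y}"

lemma ideal_gen_base: "y \<in> Y \<Longrightarrow> y * a \<in> ideal_gen Y"
  unfolding ideal_gen_def by (rule cvs.span_base) blast

lemma two_sided_ideal_gen:
  fixes Y :: "'a::supercommutative_algebra set"
  assumes Y: "\<And>y. y \<in> Y \<Longrightarrow> \<exists>p. hcomp p y = y"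
  shows "two_sided_ideal UNIV (ideal_gen Y)"
proof (rule two_sided_idealI)
  have sub: "csubspace (ideal_gen Y)" by (simp add: ideal_gen_def)
  show "0 \<in> ideal_gen Y" "\<And>x y. x \<in> ideal_gen Y \<Longrightarrow> y \<in> ideal_gen Y \<Longrightarrow> x + y \<in> ideal_gen Y"
    by (rule cvs.subspace_0[OF sub], rule cvs.subspace_add[OF sub])
  fix r x assume x: "x \<in> ideal_gen Y"
  show "r * x \<in> ideal_gen Y"
  proof (rule cspan_image_closed[OF clinear_mult(1)[of r] sub _ x[unfolded ideal_gen_def]])
    fix z assume "z \<in> {y * a | y a. y \<in> Y}"
    then obtain y a where z: "z = y * a" "y \<in> Y" by blast
    obtain p where p: "hcomp p y = y" using Y[OF z(2)] by blast
    obtain r' where r': "r * y = y * r'" using homogeneous_normal(2)[OF p] by blast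
    have "r * z = y * (r' * a)" by (simp only: z(1) mult.assoc[symmetric] r')
    then show "r * z \<in> ideal_gen Y" using ideal_gen_base[OF z(2)] by simp
  qed
  show "x * r \<in> ideal_gen Y"
  proof (rule cspan_image_closed[OF clinear_mult(2)[of r] sub _ x[unfolded ideal_gen_def]])
    fix z assume "z \<in> {y * a | y a. y \<in> Y}"
    then obtain y a where z: "z = y * a" "y \<in> Y" by blast
    then show "z * r \<in> ideal_gen Y" using ideal_gen_base[OF z(2)] by (simp add: mult.assoc)
  qed
qed simp

text \<open>Let J be generated by the old generators, with J^a inside L, and let \<open>z\<close> be
  the new one. The k-th power of J + zA lies in J + z^k A, hence in J + L, and the a-th power of J +
  L lies in J^a + L, hence in L. This explains the exponent \<open>k * a\<close>.\<close>

lemma ideal_power_gen_subset: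
  fixes Y :: "'a::supercommutative_algebra set"
  assumes "finite Y" "\<And>y. y \<in> Y \<Longrightarrow> \<exists>p. hcomp p y = y"
    and L: "two_sided_ideal UNIV L" and "\<And>y. y \<in> Y \<Longrightarrow> \<exists>k. y ^ k \<in> L"
  shows "\<exists>K. ideal_power (ideal_gen Y) K \<subseteq> L"
  using assms(1,2,4)
proof (induction Y rule: finite_induct)
  case empty
  have "ideal_gen {} = ({0} :: 'a set)" by (simp add: ideal_gen_def)
  moreover have "ideal_mult {0} (ideal_power {0} 0) \<subseteq> L"
    by (rule ideal_mult_subset[OF two_sided_ideal_csubspace[OF L]]) (simp add: two_sided_idealD(2)[OF L])
  ultimately show ?case by (intro exI[of _ "Suc 0"]) simp
next
  case (insert z Y)
  let ?J = "ideal_gen Y"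
  obtain a where a: "ideal_power ?J a \<subseteq> L" using insert by auto
  obtain p where p: "hcomp p z = z" using insert.prems(1) by blast
  obtain k where k: "z ^ k \<in> L" using insert.prems(2) by blast
  have J: "two_sided_ideal UNIV ?J" by (rule two_sided_ideal_gen) (use insert.prems(1) in blast)
  note D = two_sided_idealD[OF J]
  have "ideal_gen (insert z Y) \<subseteq> {j + z * a | j a. j \<in> ?J}"
    unfolding ideal_gen_def[of "insert z Y"]
  proof (rule cvs.span_minimal)
    have "{j + z * a | j a. j \<in> ?J} = {j + w | j w. j \<in> ?J \<and> w \<in> (\<lambda>a. z * a) ` UNIV}" by blast
    then show "csubspace {j + z * a | j a. j \<in> ?J}"
      using cvs.subspace_sums[OF two_sided_ideal_csubspace[OF J]
          csubspace_image[OF clinear_mult(1) cvs.subspace_UNIV, of z]] by simp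
    show "{y * a | y a. y \<in> insert z Y} \<subseteq> {j + z * a | j a. j \<in> ?J}"
    proof clarify
      fix y b assume "y \<in> insert z Y"
      then consider "y = z" | "y \<in> Y" by blast
      then show "\<exists>j a. y * b = j + z * a \<and> j \<in> ?J"
      proof cases
        case 1
        then show ?thesis using D(2) by (intro exI[of _ 0] exI[of _ b]) simp
      next
        case 2
        then show ?thesis using ideal_gen_base[OF 2] by (intro exI[of _ "y * b"] exI[of _ 0]) simp
      qed
    qed
  qed
  then have "ideal_power (ideal_gen (insert z Y)) k \<subseteq> ideal_power {j + z * a | j a. j \<in> ?J} k"
    by (rule ideal_power_mono)
  also have "\<dots> \<subseteq> {j + z ^ k * a | j a. j \<in> ?J}" by (rule ideal_power_principal_sum[OF J p])
  also have "\<dots> \<subseteq> {j + l | j l. j \<in> ?J \<and> l \<in> L}" using two_sided_idealD(5)[OF L UNIV_I k] by blast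
  finally have "ideal_power (ideal_gen (insert z Y)) (k * a) \<subseteq> ideal_power {j + l | j l. j \<in> ?J \<and> l \<in> L} a"
    by (rule ideal_power_mult)
  also have "\<dots> \<subseteq> {x + l | x l. x \<in> ideal_power ?J a \<and> l \<in> L}" by (rule ideal_power_sum[OF L])
  also have "\<dots> \<subseteq> L" using a two_sided_idealD(3)[OF L] by blast
  finally show ?case by blast
qed

text \<open>
  A maximal ideal \<open>L\<close> with \<open>L \<inter> f A = f m\<close> contains a power of every generator \<open>y\<close> of \<open>m\<close>, since
  \<open>L + y\<^sup>k A\<close> satisfies the same condition once the colon ideals \<open>(L : y\<^sup>k)\<close> are stationary.
\<close>

theorem krull_intersection:
  fixes f :: "'a::supercommutative_algebra"
  assumes acc: "ideal_acc (UNIV :: 'a set)"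
    and Y: "finite Y" "\<And>y. y \<in> Y \<Longrightarrow> \<exists>p. hcomp p y = y"
    and f: "hcomp q f = f" "\<And>n. f \<in> ideal_power (ideal_gen Y) n"
  shows "\<exists>a\<in>ideal_gen Y. f = f * a"
proof -
  let ?m = "ideal_gen Y"
  let ?fm = "(\<lambda>a. f * a) ` ?m"
  have m: "two_sided_ideal UNIV ?m" by (rule two_sided_ideal_gen[OF Y(2)])
  have fm: "two_sided_ideal UNIV ?fm"
  proof (rule two_sided_idealI)
    show "0 \<in> ?fm" using two_sided_idealD(2)[OF m] by force
    show "x + y \<in> ?fm" if "x \<in> ?fm" "y \<in> ?fm" for x y
      using that two_sided_idealD(3)[OF m] by (auto simp: distrib_left[symmetric])
    fix r x assume "x \<in> ?fm"
    then obtain a where a: "x = f * a" "a \<in> ?m" by blast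
    obtain r' where r': "r * f = f * r'" using homogeneous_normal(2)[OF f(1)] by blast
    have "r * x = f * (r' * a)" by (simp only: a(1) mult.assoc[symmetric] r')
    then show "r * x \<in> ?fm" using two_sided_idealD(4)[OF m UNIV_I a(2)] by blast
    show "x * r \<in> ?fm"
      using two_sided_idealD(5)[OF m UNIV_I a(2), of r] by (simp add: a(1) mult.assoc)
  qed simp
  let ?C = "{L. two_sided_ideal UNIV L \<and> ?fm \<subseteq> L \<and> (\<forall>b. f * b \<in> L \<longrightarrow> f * b \<in> ?fm)}"
  have ideal: "two_sided_ideal UNIV L" if "L \<in> ?C" for L using that by simp
  have "?fm \<in> ?C" using fm by simp
  have "\<exists>L\<in>?C. \<forall>I\<in>?C. L \<subseteq> I \<longrightarrow> I = L"
    by (rule ideal_acc_maximal[OF acc _ \<open>?fm \<in> ?C\<close>]) (rule ideal)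
  then obtain L where "L \<in> ?C" and max: "\<forall>I\<in>?C. L \<subseteq> I \<longrightarrow> I = L" by (elim bexE)
  note L' = CollectD[OF \<open>L \<in> ?C\<close>]
  note L = L'[THEN conjunct1] L'[THEN conjunct2, THEN conjunct1]
    L'[THEN conjunct2, THEN conjunct2, rule_format]
  note D = two_sided_idealD[OF L(1)]
  have "\<exists>k. y ^ k \<in> L" if y: "y \<in> Y" for y
  proof -
    obtain p where p: "hcomp p y = y" using Y(2)[OF y] by blast
    define Q where "Q k = {a. y ^ k * a \<in> L}" for k
    have "two_sided_ideal UNIV (Q k)" for k
    proof (rule two_sided_idealI)
      show "0 \<in> Q k" "\<And>a b. a \<in> Q k \<Longrightarrow> b \<in> Q k \<Longrightarrow> a + b \<in> Q k"
        using D(2,3) by (simp_all add: Q_def distrib_left)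
      fix r a assume "a \<in> Q k"
      then have a: "y ^ k * a \<in> L" by (simp add: Q_def)
      obtain r' where r': "y ^ k * r = r' * y ^ k" using homogeneous_normal_power(2)[OF p] by blast
      have "y ^ k * (r * a) = r' * (y ^ k * a)" by (simp only: mult.assoc[symmetric] r')
      then show "r * a \<in> Q k" using D(4)[OF UNIV_I a] by (simp add: Q_def)
      show "a * r \<in> Q k" using D(5)[OF UNIV_I a, of r] by (simp add: Q_def mult.assoc)
    qed simp
    moreover have "Q k \<subseteq> Q (Suc k)" for k
      using D(4)[OF UNIV_I, of _ y] by (auto simp: Q_def mult.assoc)
    ultimately have "\<exists>k. \<forall>n\<ge>k. Q n = Q k" by (intro acc[unfolded ideal_acc_def, rule_format])
    then obtain k where k: "Q (Suc k) = Q k" by (meson le_SucI order_refl)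
    let ?L = "{l + y ^ k * a | l a. l \<in> L}"
    have "two_sided_ideal UNIV ?L"
    proof (rule two_sided_idealI)
      have "0 + y ^ k * 0 \<in> ?L" using D(2) by blast
      then show "0 \<in> ?L" by simp
    next
      fix u v assume "u \<in> ?L" "v \<in> ?L"
      then obtain l a l' b where "u = l + y ^ k * a" "l \<in> L" "v = l' + y ^ k * b" "l' \<in> L" by blast
      then have "u + v = (l + l') + y ^ k * (a + b)" "l + l' \<in> L" using D(3) by (simp_all add: algebra_simps)
      then show "u + v \<in> ?L" by blast
    next
      fix r u assume "u \<in> ?L"
      then obtain l a where u: "u = l + y ^ k * a" "l \<in> L" by blast
      obtain r' where r': "r * y ^ k = y ^ k * r'" using homogeneous_normal_power(1)[OF p] by blast
      have "r * u = r * l + y ^ k * (r' * a)"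
        by (simp only: u(1) distrib_left mult.assoc[symmetric] r')
      then show "r * u \<in> ?L" using D(4)[OF UNIV_I u(2)] by blast
      have "u * r = l * r + y ^ k * (a * r)" by (simp add: u(1) distrib_right mult.assoc)
      then show "u * r \<in> ?L" using D(5)[OF UNIV_I u(2)] by blast
    qed simp
    moreover have sub: "L \<subseteq> ?L"
    proof
      fix l assume "l \<in> L"
      then have "l + y ^ k * 0 \<in> ?L" by blast
      then show "l \<in> ?L" by simp
    qed
    moreover have "f * b \<in> ?fm" if "f * b \<in> ?L" for b
    proof -
      obtain l a where la: "f * b = l + y ^ k * a" "l \<in> L" using \<open>f * b \<in> ?L\<close> by blast
      have ym: "y \<in> ?m" using ideal_gen_base[OF y, of 1] by simp
      \<comment> \<open>Chosen with \<open>y * f = f * y'\<close>. Passing \<open>f\<close> changes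
        the generator at most by a sign, so \<open>y'\<close> stays in \<open>?m\<close> and
        \<open>y * (f * b)\<close> lies in \<open>?fm\<close>.\<close>
      define y' where "y' = (if q = 0 then y else parity_involution y)"
      have "y' \<in> ?m"
        using ym two_sided_ideal_minus[OF unital_subring_UNIV m ym]
        by (simp add: y'_def parity_involution_homogeneous[OF p])
      then have "f * (y' * b) \<in> ?fm" using two_sided_idealD(5)[OF m] by blast
      moreover have "y * (f * b) = f * (y' * b)"
        using homogeneous_commute(2)[OF f(1), of y] by (simp add: y'_def mult.assoc[symmetric])
      ultimately have "y * (f * b) \<in> L" using L(2) by auto
      moreover have "- (y * l) \<in> L"
        by (rule two_sided_ideal_minus[OF unital_subring_UNIV L(1) D(4)[OF UNIV_I la(2)]])
      ultimately have "y * (f * b) + - (y * l) \<in> L" by (rule D(3))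
      \<comment> \<open>Multiplying \<open>f * b = l + y ^ k * a\<close> by \<open>y\<close> shows
        that \<open>y ^ Suc k * a\<close> is in \<open>L\<close>. The stationary colon ideal removes
        one factor \<open>y\<close>, and \<open>f * b\<close> itself falls into
        \<open>L\<close>.\<close>
      then have "a \<in> Q (Suc k)" by (simp add: la(1) Q_def distrib_left mult.assoc)
      then have "y ^ k * a \<in> L" by (simp add: k) (simp add: Q_def)
      then have "f * b \<in> L" unfolding la(1) by (rule D(3)[OF la(2)])
      then show ?thesis by (rule L(3))
    qed
    ultimately have "?L \<in> ?C" using order_trans[OF L(2) sub] by (intro CollectI conjI allI impI)
    then have "?L = L" using sub by (rule max[THEN bspec, THEN mp])
    moreover have "0 + y ^ k * 1 \<in> ?L" using D(2) by blast
    ultimately show ?thesis by auto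
  qed
  \<comment> \<open>\<open>f\<close> lies in every power of \<open>?m\<close>, hence in
    \<open>L\<close>, and \<open>L\<close> meets f A only in f m.\<close>
  then obtain K where "ideal_power ?m K \<subseteq> L" using ideal_power_gen_subset[OF Y L(1)] by blast
  then have "f * 1 \<in> L" using f(2) by auto
  then show ?thesis using L(3)[of 1] by auto
qed

section \<open>The maximal ideal of a point\<close>

lemma superalgebra_homD:
  assumes "superalgebra_hom f"
  shows "clinear f" "f (a * b) = f a * f b" "f 1 = 1" "f (hcomp p a) = hcomp p (f a)"
  using assms by (auto simp: superalgebra_hom_def)

lemma point_odd: "superalgebra_hom x \<Longrightarrow> hcomp 1 a = a \<Longrightarrow> x a = (0 :: complex)"
  using superalgebra_homD(4)[of x 1 a] by (simp add: hcomp_complex_def)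

lemma point_hcomp_0: "superalgebra_hom x \<Longrightarrow> x (hcomp 0 a) = (x a :: complex)"
  by (simp add: superalgebra_homD(4) hcomp_complex_def)

lemma hcomp_scalar: "hcomp p (c *\<^sub>C 1 :: 'a::super_algebra) = (if p = 0 then c *\<^sub>C 1 else 0)"
  using hcomp_homogeneous[OF hcomp_one[where 'a = 'a], of p] by (simp add: hcomp_cscale)

text \<open>Take as generators g - g(x) for the homogeneous components g of algebra generators.
  Modulo the ideal they generate, every function is congruent to its value at x, since the functions
  with this property form a subalgebra.\<close>

lemma kernel_eq_ideal_gen:
  fixes x :: "'a::supercommutative_algebra \<Rightarrow> complex" and F :: "'a set"
  assumes F: "finite F" "subalgebra_generated F = UNIV" and x: "superalgebra_hom x"
  shows "\<exists>Y. finite Y \<and> (\<forall>y\<in>Y. \<exists>p. hcomp p y = y) \<and> ideal_gen Y = {a. x a = 0}"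
proof -
  note x' = superalgebra_homD[OF x] and lin = clinear_simps[OF superalgebra_homD(1)[OF x]]
  \<comment> \<open>A point kills odd functions, so the subtracted scalar is 0 for
    \<open>p = 1\<close> and \<open>y p g\<close> has parity \<open>p\<close>.\<close>
  define y where "y p g = hcomp p g - x (hcomp p g) *\<^sub>C 1" for p g
  define Y where "Y = y 0 ` F \<union> y 1 ` F"
  have y: "hcomp p (y p g) = y p g" for p g
    by (cases p) (simp_all add: y_def hcomp_diff hcomp_scalar x'(4) hcomp_complex_def)
  have ker_y: "x (y p g) = 0" for p g
    by (simp add: y_def lin x'(3) cscale_complex_def)
  have hom: "\<forall>z\<in>Y. \<exists>p. hcomp p z = z" using y unfolding Y_def by blast
  have I: "two_sided_ideal UNIV (ideal_gen Y)" by (rule two_sided_ideal_gen) (use hom in blast)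
  note D = two_sided_idealD[OF I]
  have sub: "csubspace (ideal_gen Y)" by (rule two_sided_ideal_csubspace[OF I])
  have "a - x a *\<^sub>C 1 \<in> ideal_gen Y" if "a \<in> subalgebra_generated F" for a
    using that
  proof induction
    case (1 g)
    have "y 0 g * 1 + y 1 g * 1 \<in> ideal_gen Y"
      using 1 by (intro D(3) ideal_gen_base) (auto simp: Y_def)
    moreover have "y 0 g + y 1 g = (hcomp 0 g + hcomp 1 g) - x (hcomp 0 g + hcomp 1 g) *\<^sub>C 1"
      by (simp add: y_def lin cscale_add_left)
    ultimately show ?case by (simp add: hcomp_sum)
  next
    case 2
    then show ?case by (simp add: x'(3) cscale_one D(2))
  next
    case (3 a b)
    then show ?case using D(3)[OF 3(3,4)] by (simp add: lin cscale_add_left algebra_simps)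
  next
    case (4 a b)
    have "(a - x a *\<^sub>C 1) * b + x a *\<^sub>C (b - x b *\<^sub>C 1) \<in> ideal_gen Y"
      by (intro D(3)[OF D(5)[OF UNIV_I 4(3)]] cvs.subspace_scale[OF sub] 4(4))
    then show ?case
      by (simp add: x'(2) left_diff_distrib cscale_mult_left cvs.scale_right_diff_distrib cscale_cscale)
  next
    case (5 a c)
    have "c *\<^sub>C (a - x a *\<^sub>C 1) \<in> ideal_gen Y" by (rule cvs.subspace_scale[OF sub 5(2)])
    then show ?case
      by (simp add: lin cvs.scale_right_diff_distrib cscale_cscale cscale_complex_def)
  qed
  then have "a - x a *\<^sub>C 1 \<in> ideal_gen Y" for a using F(2) by blast
  then have "a \<in> ideal_gen Y" if "x a = 0" for a using that by (metis cvs.scale_zero_left diff_zero)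
  moreover have "ideal_gen Y \<subseteq> {a. x a = 0}"
    unfolding ideal_gen_def
  proof (rule cvs.span_minimal)
    show "csubspace {a. x a = 0}" by (rule csubspaceI) (simp_all add: lin)
    show "{z * a |z a. z \<in> Y} \<subseteq> {a. x a = 0}"
      using ker_y by (auto simp: Y_def x'(2))
  qed
  moreover have "finite Y" using F(1) by (simp add: Y_def)
  ultimately show ?thesis using hom by (intro exI[of _ Y] conjI) blast+
qed

text \<open>Krull's theorem gives \<open>f = f * a\<close> with \<open>a\<close> vanishing at
  \<open>x\<close>, so \<open>1 - a\<close> kills \<open>f\<close>. As \<open>f\<close> is
  homogeneous, the even and the odd part of \<open>1 - a\<close> kill it separately, and the even
  part has value 1 at \<open>x\<close>.\<close>

lemma annihilated_near_point:
  fixes x :: "'a::supercommutative_algebra \<Rightarrow> complex" and F :: "'a set"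
  assumes F: "finite F" "subalgebra_generated F = UNIV" and x: "superalgebra_hom x"
    and f: "hcomp p f = f" "\<And>n. f \<in> ideal_power {a. x a = 0} n"
  obtains s where "s \<in> homogeneous 0" "x s \<noteq> 0" "s * f = 0"
proof -
  obtain Y where Y: "finite Y" "\<forall>y\<in>Y. \<exists>p. hcomp p y = y" "ideal_gen Y = {a. x a = 0}"
    using kernel_eq_ideal_gen[OF F x] by (elim exE conjE)
  have "\<exists>a\<in>ideal_gen Y. f = f * a"
    by (rule krull_intersection[OF finitely_generated_acc[OF F] Y(1) bspec[OF Y(2)] f(1)])
      (use f(2) Y(3) in simp_all)
  then obtain a where a: "x a = 0" "f = f * a" unfolding Y(3) by blast
  let ?c = "1 - a"
  have zero: "f * hcomp 0 ?c + f * hcomp 1 ?c = 0"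
    using a(2) by (simp add: distrib_left[symmetric] hcomp_sum right_diff_distrib)
  have "hcomp p (f * hcomp 0 ?c) = f * hcomp 0 ?c"
    using hcomp_mult[OF f(1) hcomp_idem[of 0 ?c]] by (simp only: add_0_right)
  moreover have "hcomp p (f * hcomp 1 ?c) = 0"
    using hcomp_homogeneous[OF hcomp_mult[OF f(1) hcomp_idem[of 1 ?c]], of p] by (cases p) simp_all
  ultimately have "hcomp p (f * hcomp 0 ?c + f * hcomp 1 ?c) = f * hcomp 0 ?c"
    by (simp only: hcomp_add add_0_right)
  then have "f * hcomp 0 ?c = 0" unfolding zero by simp
  moreover have s: "hcomp 0 ?c \<in> homogeneous 0" by (simp add: homogeneous_def)
  ultimately have "hcomp 0 ?c * f = 0" using even_commute[OF s, of f] by simp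
  moreover have "x (hcomp 0 ?c) = 1"
    using a(1) by (simp add: point_hcomp_0[OF x] clinear_simps[OF superalgebra_homD(1)[OF x]] superalgebra_homD(3)[OF x])
  ultimately show thesis using that[OF s] by simp
qed

section \<open>Primes, germs and global sections\<close>

lemma specI:
  fixes P :: "'a::supercommutative_algebra set"
  assumes sub: "P \<subseteq> homogeneous 0" and "0 \<in> P" and add: "\<And>a b. a \<in> P \<Longrightarrow> b \<in> P \<Longrightarrow> a + b \<in> P"
    and mult: "\<And>a b. a \<in> P \<Longrightarrow> b \<in> homogeneous 0 \<Longrightarrow> b * a \<in> P" and "1 \<notin> P"
    and prime: "\<And>a b. a \<in> homogeneous 0 \<Longrightarrow> b \<in> homogeneous 0 \<Longrightarrow> a * b \<in> P \<Longrightarrow> a \<in> P \<or> b \<in> P"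
  shows "P \<in> spec"
proof -
  interpret cring "even_ring :: 'a ring" by (rule cring_even_ring)
  have carr: "carrier even_ring = (homogeneous 0 :: 'a set)"
    "monoid.mult even_ring = ((*) :: 'a \<Rightarrow> 'a \<Rightarrow> 'a)" "add even_ring = ((+) :: 'a \<Rightarrow> 'a \<Rightarrow> 'a)"
    "zero even_ring = (0 :: 'a)" "one even_ring = (1 :: 'a)"
    by (simp_all add: even_ring_def)
  have minus: "- a \<in> P" if "a \<in> P" for a
    using mult[OF that, of "- 1"] even_intros(2,4)[where 'a = 'a] by simp
  have mult_right: "a * b \<in> P" if "a \<in> P" "b \<in> homogeneous 0" for a b
    using mult[OF that] unfolding even_commute[OF that(2), of a] .
  have "subgroup P (add_monoid even_ring)"
  proof (rule group.subgroupI[OF a_group])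
    show "P \<subseteq> carrier (add_monoid even_ring)" using sub by (simp add: carr)
    show "P \<noteq> {}" using \<open>0 \<in> P\<close> by blast
    fix a assume a: "a \<in> P"
    have "a_inv even_ring a = - a"
      by (rule minus_equality) (use a minus[OF a] sub in \<open>auto simp: carr\<close>)
    then show "inv\<^bsub>add_monoid even_ring\<^esub> a \<in> P" using minus[OF a] by (simp add: a_inv_def)
  qed (simp add: carr add)
  then have "ideal P even_ring"
    by (rule idealI[OF ring_axioms])
      (simp_all only: carr mult mult_right)
  moreover have "carrier even_ring \<noteq> P" unfolding carr using \<open>1 \<notin> P\<close> even_intros(2) by blast
  ultimately show ?thesis
    unfolding spec_def mem_Collect_eq
    by (rule primeidealI[OF _ cring_even_ring]) (simp only: carr prime)
qed

lemma topspace_zariski: "topspace (zariski :: 'a::supercommutative_algebra set topology) = spec"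
proof (rule antisym)
  show "topspace zariski \<subseteq> (spec :: 'a set set)"
    using openin_topspace[of "zariski :: 'a set topology"] unfolding openin_zariski by blast
  have "openin zariski (spec :: 'a set set)"
    unfolding openin_zariski
    by (intro exI[of _ "{1}"]) (use specD(3) even_intros(2)[where 'a = 'a] in auto)
  then show "spec \<subseteq> topspace (zariski :: 'a set topology)" by (rule openin_subset)
qed

text \<open>
  If \<open>f \<noteq> 0\<close>, a maximal annihilator of a nonzero even multiple of \<open>f\<close> is a prime at which the germ of
  \<open>f\<close> does not vanish.
\<close>

lemma exists_nonvanishing_germ:
  fixes f :: "'a::supercommutative_algebra"
  assumes acc: "ideal_acc (UNIV :: 'a set)" and f: "hcomp p f = f" "f \<noteq> 0"
  obtains P where "P \<in> spec" "\<And>u. u \<in> homogeneous 0 - P \<Longrightarrow> u * f \<noteq> 0"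
proof -
  define ann where "ann g = {a. a * g = 0}" for g :: 'a
  define G where "G = {v * f | v. v \<in> homogeneous 0 \<and> v * f \<noteq> 0}"
  have G_hom: "hcomp p g = g" if g: "g \<in> G" for g
  proof -
    obtain v where v: "g = v * f" "hcomp 0 v = v" using g by (auto simp: G_def homogeneous_def)
    show ?thesis using hcomp_mult[OF v(2) f(1)] by (simp only: v(1) add_0_left)
  qed
  have ideal: "two_sided_ideal UNIV (ann g)" if g: "g \<in> G" for g
  proof (rule two_sided_idealI)
    fix r a assume "a \<in> ann g"
    then have a: "a * g = 0" by (simp add: ann_def)
    then show "r * a \<in> ann g" by (simp add: ann_def mult.assoc)
    obtain r' where r': "r * g = g * r'" using homogeneous_normal(2)[OF G_hom[OF g]] by blast
    have "a * r * g = a * g * r'" by (simp only: mult.assoc r')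
    then show "a * r \<in> ann g" by (simp add: ann_def a)
  qed (auto simp: ann_def distrib_right)
  have "1 * f \<in> G" using f(2) even_intros(2)[where 'a = 'a] unfolding G_def by force
  then have "ann f \<in> ann ` G" by simp
  have "\<exists>M\<in>ann ` G. \<forall>I\<in>ann ` G. M \<subseteq> I \<longrightarrow> I = M"
    by (rule ideal_acc_maximal[OF acc _ \<open>ann f \<in> ann ` G\<close>]) (use ideal in auto)
  then obtain g where g: "g \<in> G" and max: "\<And>h. h \<in> G \<Longrightarrow> ann g \<subseteq> ann h \<Longrightarrow> ann h = ann g" by auto
  obtain v where v: "g = v * f" "v \<in> homogeneous 0" "g \<noteq> 0" using g by (auto simp: G_def)
  let ?P = "ann g \<inter> homogeneous 0"
  have "?P \<in> spec"
  proof (rule specI)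
    show "0 \<in> ?P" by (simp add: ann_def even_intros(1))
    show "a + b \<in> ?P" if "a \<in> ?P" "b \<in> ?P" for a b
      using that by (simp add: ann_def distrib_right even_intros(3))
    show "b * a \<in> ?P" if "a \<in> ?P" "b \<in> homogeneous 0" for a b
      using that by (simp add: ann_def mult.assoc even_mult)
    show "1 \<notin> ?P" using v(3) by (simp add: ann_def)
    fix a b assume a: "a \<in> homogeneous 0" and b: "b \<in> homogeneous 0" and ab: "a * b \<in> ?P"
    show "a \<in> ?P \<or> b \<in> ?P"
    proof (cases "b * g = 0")
      case False
      have "b * g = (b * v) * f" by (simp add: v(1) mult.assoc)
      then have "b * g \<in> G" using even_mult[OF b v(2)] False unfolding G_def by auto
      moreover have "ann g \<subseteq> ann (b * g)"
        unfolding ann_def using even_past(2)[OF b] by auto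
      ultimately have "ann (b * g) = ann g" by (rule max)
      moreover have "a \<in> ann (b * g)" using ab by (simp add: ann_def mult.assoc)
      ultimately show ?thesis using a by simp
    qed (use b in \<open>simp add: ann_def\<close>)
  qed simp
  moreover have "u * f \<noteq> 0" if u: "u \<in> homogeneous 0 - ?P" for u
  proof
    assume "u * f = 0"
    then have "u * g = 0"
      using even_past(2)[OF v(2), of u f] by (simp add: v(1))
    then show False using u by (simp add: ann_def)
  qed
  ultimately show thesis by (rule that)
qed

text \<open>The basic open set of \<open>s\<close> contains the prime of \<open>x\<close>, hence the
  generic point, so the germ of \<open>f\<close> there is zero. Injectivity into the generic stalk
  makes \<open>f\<close> zero as a global section, and then all its germs vanish, against
  \<open>exists_nonvanishing_germ\<close>.\<close>

theorem affine_supervariety_annihilated_zero: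
  fixes x :: "'a::supercommutative_algebra \<Rightarrow> complex"
  assumes X: "affine_supervariety TYPE('a)" and x: "superalgebra_hom x" and f: "hcomp p f = f"
    and s: "s \<in> homogeneous 0" "x s \<noteq> 0" "s * f = 0"
  shows "f = 0"
proof (rule ccontr)
  assume "f \<noteq> 0"
  obtain F :: "'a set" where F: "finite F" "subalgebra_generated F = UNIV"
    using X unfolding affine_supervariety_def by (elim conjE exE)
  obtain \<eta> :: "'a set" where gen: "generic_point zariski \<eta>"
    and inj: "\<forall>U. openin zariski U \<longrightarrow> U \<noteq> {} \<longrightarrow> inj_on (\<lambda>\<sigma>. \<sigma> \<eta>) (spec_sections U)"
    using X unfolding affine_supervariety_def by (elim conjE exE)
  note lin = clinear_simps[OF superalgebra_homD(1)[OF x]]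
  define P0 where "P0 = {a \<in> homogeneous 0. x a = 0}"
  have P0: "P0 \<in> spec"
    unfolding P0_def by (rule specI) (auto simp: lin superalgebra_homD[OF x] even_intros even_mult)
  have \<eta>: "\<eta> \<in> spec" using gen by (simp add: generic_point_def topspace_zariski)
  have "s \<notin> \<eta>"
  proof
    assume "s \<in> \<eta>"
    let ?U = "{Q \<in> spec. \<not> {s} \<subseteq> Q}"
    have U: "openin zariski ?U" unfolding openin_zariski using s(1) by (intro exI[of _ "{s}"]) simp
    have PU: "P0 \<in> ?U" using P0 s(2) by (simp add: P0_def)
    have "P0 \<in> Abstract_Topology.closure_of zariski {\<eta>}"
      using gen P0 unfolding generic_point_def topspace_zariski by simp
    then have "\<exists>y. y \<in> {\<eta>} \<and> y \<in> ?U"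
      unfolding in_closure_of using PU U by (elim conjE allE[of _ ?U]) (erule mp, rule conjI)
    then show False using \<open>s \<in> \<eta>\<close> by simp
  qed
  then have s\<eta>: "s \<in> homogeneous 0 - \<eta>" using s(1) by simp
  have one: "1 \<in> homogeneous 0 - Q" if "Q \<in> spec" for Q :: "'a set"
    using specD(3)[OF that] even_intros(2)[where 'a = 'a] by simp
  have germ: "fraction \<eta> f 1 = fraction \<eta> 0 1"
    by (rule fraction_eqI[OF \<eta> one[OF \<eta>] one[OF \<eta>] s\<eta>]) (simp add: s(3))
  define sec where "sec a = restrict (\<lambda>Q. fraction Q a 1) spec" for a :: 'a
  have open_spec: "openin zariski (spec :: 'a set set)"
    using openin_topspace[of "zariski :: 'a set topology"] by (simp add: topspace_zariski)
  have sec: "sec a \<in> spec_sections spec" for a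
    unfolding spec_sections_def
  proof (intro CollectI conjI ballI)
    show "sec a \<in> extensional spec" by (simp add: sec_def)
    fix Q :: "'a set" assume "Q \<in> spec"
    then show "\<exists>V b t. openin zariski V \<and> Q \<in> V \<and> V \<subseteq> spec \<and> t \<in> homogeneous 0 \<and>
        (\<forall>Q\<in>V. t \<notin> Q \<and> sec a Q = fraction Q b t)"
      using open_spec one by (intro exI[of _ spec] exI[of _ a] exI[of _ 1]) (auto simp: sec_def)
  qed
  have "sec f = sec 0"
    by (rule inj_onD[OF inj[rule_format, OF open_spec] _ sec sec]) (use \<eta> germ in \<open>auto simp: sec_def\<close>)
  obtain P where P: "P \<in> spec" "\<And>u. u \<in> homogeneous 0 - P \<Longrightarrow> u * f \<noteq> 0"
    using exists_nonvanishing_germ[OF finitely_generated_acc[OF F] f \<open>f \<noteq> 0\<close>] by blast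
  have "fraction P f 1 = fraction P 0 1"
    using fun_cong[OF \<open>sec f = sec 0\<close>, of P] P(1) by (simp add: sec_def)
  then have "(f, 1) \<in> fraction P 0 1" using fraction_self[OF P(1) one[OF P(1)], of f] by simp
  then obtain u where "u \<in> homogeneous 0 - P" "u * f = 0" by (auto simp: fraction_iff)
  then show False using P(2) by blast
qed


section \<open>The Lie superalgebra acts by derivations\<close>

text \<open>The sign (-1)^(p |a|) of moving something of parity \<open>p\<close> past
  \<open>a\<close>, extended linearly.\<close>

definition twist :: "bit \<Rightarrow> 'a::super_vector_space \<Rightarrow> 'a" where
  "twist p a = (if p = 0 then a else parity_involution a)"

lemma clinear_twist: "clinear (twist p)"
  unfolding twist_def by (cases p) (simp_all add: clinear_simps(1,2)[OF clinear_parity_involution] clinear_iff)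

lemma twist_twist [simp]: "twist p (twist p a) = a"
  by (simp add: twist_def parity_involution_involution)

lemma twist_homogeneous: "hcomp r a = a \<Longrightarrow> twist p a = ksign p r *\<^sub>C a"
  by (cases p; cases r) (simp_all add: twist_def parity_involution_homogeneous ksign_def cscale_one)

lemma twist_eq_sum: "twist p a = (\<Sum>q\<in>{0, 1}. ksign p q *\<^sub>C hcomp q a)"
  by (cases p) (simp_all add: twist_def ksign_def cscale_one hcomp_sum parity_involution_def)

lemma twist_commute:
  fixes f :: "'a::super_vector_space \<Rightarrow> 'b::super_vector_space"
  assumes "clinear f" "\<And>p a. f (hcomp p a) = hcomp p (f a)"
  shows "f (twist p a) = twist p (f a)"
  by (simp add: twist_def parity_involution_def clinear_simps[OF assms(1)] assms(2))

text \<open>The contraction u \<otimes> id, the mirror image of \<open>slice\<close> for the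
  coaction \<alpha>, which has C[G] on the left.\<close>

definition left_slice :: "('g::complex_vector \<Rightarrow> complex) \<Rightarrow> ('g, 'x::complex_vector) tensor \<Rightarrow> 'x" where
  "left_slice u = tlift (\<lambda>g h. u g *\<^sub>C h)"

lemma left_slice_bilinear: "clinear u \<Longrightarrow> cbilinear (\<lambda>g h. u g *\<^sub>C h)"
  by (simp add: cbilinear_iff clinear_simps cscale_add_right cscale_add_left cscale_cscale
      cscale_complex_def mult.commute)

lemma left_slice_pure: "clinear u \<Longrightarrow> left_slice u (g \<otimes>\<^sub>C h) = u g *\<^sub>C h"
  by (simp add: left_slice_def tlift_pure left_slice_bilinear)

lemma clinear_left_slice: "clinear u \<Longrightarrow> clinear (left_slice u)"
  by (simp add: left_slice_def clinear_tlift left_slice_bilinear)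

lemma tangent_spaceD:
  assumes "u \<in> tangent_space x"
  shows "clinear u" "u (f * h) = u f * x h + x f * u h"
  using assms by (auto simp: tangent_space_def)

lemma tangent_one:
  assumes "u \<in> tangent_space x" "x 1 = 1"
  shows "u 1 = 0"
  using tangent_spaceD(2)[OF assms(1), of 1 1] assms(2) by simp

text \<open>
  The signs match because \<open>\<epsilon>\<close> kills odd and \<open>u\<close> kills all but the degree \<open>p\<close> elements.
\<close>

lemma left_slice_mult:
  fixes s t :: "('g::supercommutative_algebra, 'x::supercommutative_algebra) tensor"
  assumes \<epsilon>: "superalgebra_hom \<epsilon>" and u: "u \<in> tangent_space \<epsilon>" "u \<circ> hcomp p = u"
  shows "left_slice u (s * t) = left_slice u s * left_slice \<epsilon> t + left_slice \<epsilon> (twist p s) * left_slice u t"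
proof (rule tensor_homogeneous_ext[where t = s])
  note ulin = tangent_spaceD(1)[OF u(1)] and elin = superalgebra_homD(1)[OF \<epsilon>]
  note lin = clinear_simps[OF clinear_left_slice[OF ulin]] clinear_simps[OF clinear_left_slice[OF elin]]
    clinear_simps[OF clinear_twist]
  have epar: "\<epsilon> \<circ> hcomp 0 = \<epsilon>" by (simp add: fun_eq_iff point_hcomp_0[OF \<epsilon>])
  show "clinear (\<lambda>s. left_slice u (s * t))"
    "clinear (\<lambda>s. left_slice u s * left_slice \<epsilon> t + left_slice \<epsilon> (twist p s) * left_slice u t)"
    by (rule clinearI; simp add: lin distrib_right cscale_mult_left cscale_add_right)+
  fix a b and g :: 'g and h :: 'x assume g: "hcomp a g = g" and h: "hcomp b h = h"
  let ?s = "g \<otimes>\<^sub>C h"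
  have tw: "twist p ?s = ksign p (a + b) *\<^sub>C ?s"
    by (rule twist_homogeneous) (simp add: hcomp_pure_homogeneous[OF g h])
  show "left_slice u (?s * t) = left_slice u ?s * left_slice \<epsilon> t + left_slice \<epsilon> (twist p ?s) * left_slice u t"
  proof (rule tensor_homogeneous_ext[where t = t])
    show "clinear (\<lambda>t. left_slice u (?s * t))"
      "clinear (\<lambda>t. left_slice u ?s * left_slice \<epsilon> t + left_slice \<epsilon> (twist p ?s) * left_slice u t)"
      by (rule clinearI; simp add: lin distrib_left cscale_mult_right cscale_add_right)+
    fix c d and g' :: 'g and h' :: 'x assume g': "hcomp c g' = g'" and h': "hcomp d h' = h'"
    have "left_slice u (?s * (g' \<otimes>\<^sub>C h')) = (ksign b c * (u g * \<epsilon> g' + \<epsilon> g * u g')) *\<^sub>C (h * h')"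
      by (simp add: times_pure_tensor[OF h g'] lin left_slice_pure[OF ulin] tangent_spaceD(2)[OF u(1)]
          cscale_cscale)
    also have "ksign b c * (u g * \<epsilon> g' + \<epsilon> g * u g') = u g * \<epsilon> g' + ksign p (a + b) * \<epsilon> g * u g'"
      using functional_parity[OF u(2) ulin g'] functional_parity[OF epar elin g']
        functional_parity[OF epar elin g]
      by (cases a; cases b; cases c; cases p) (simp_all add: ksign_def)
    finally show "left_slice u (?s * (g' \<otimes>\<^sub>C h')) =
        left_slice u ?s * left_slice \<epsilon> (g' \<otimes>\<^sub>C h') + left_slice \<epsilon> (twist p ?s) * left_slice u (g' \<otimes>\<^sub>C h')"
      by (simp add: tw lin left_slice_pure[OF ulin] left_slice_pure[OF elin] cscale_mult_left
          cscale_mult_right cscale_cscale cscale_add_left mult_ac)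
  qed
qed

definition vector_field :: "('x \<Rightarrow> ('g::complex_vector, 'x::complex_vector) tensor) \<Rightarrow>
    ('g \<Rightarrow> complex) \<Rightarrow> 'x \<Rightarrow> 'x" where
  "vector_field \<alpha> u f = left_slice u (\<alpha> f)"

lemma clinear_vector_field: "clinear \<alpha> \<Longrightarrow> clinear u \<Longrightarrow> clinear (vector_field \<alpha> u)"
  unfolding vector_field_def by (rule clinear_compose[OF clinear_left_slice])

text \<open>As \<alpha> is multiplicative, the Leibniz rule of \<open>u\<close> at the identity
  spreads over X, with \<open>twist p\<close> as the sign of passing \<open>f\<close>. The unit law
  turns contraction with \<epsilon> into the identity.\<close>

lemma vector_field_mult:
  fixes \<alpha> :: "'x::supercommutative_algebra \<Rightarrow> ('g::supercommutative_algebra, 'x) tensor"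
  assumes \<epsilon>: "superalgebra_hom \<epsilon>" and \<alpha>: "superalgebra_hom \<alpha>" "\<And>f. left_slice \<epsilon> (\<alpha> f) = f"
    and u: "u \<in> tangent_space \<epsilon>" "u \<circ> hcomp p = u"
  shows "vector_field \<alpha> u (f * h) = vector_field \<alpha> u f * h + twist p f * vector_field \<alpha> u h"
proof -
  have "left_slice \<epsilon> (twist p (\<alpha> f)) = twist p f"
    using twist_commute[OF superalgebra_homD(1,4)[OF \<alpha>(1)], of p f] \<alpha>(2)[of "twist p f"] by simp
  then show ?thesis
    unfolding vector_field_def superalgebra_homD(2)[OF \<alpha>(1)] left_slice_mult[OF \<epsilon> u] \<alpha>(2) by simp
qed

text \<open>The value of the field at \<open>x\<close> is the differential of the orbit map applied
  to \<open>u\<close>; in this form the open orbit becomes a statement about derivations of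
  C[X].\<close>

lemma point_vector_field:
  assumes "clinear x" "clinear u"
  shows "x (vector_field \<alpha> u f) = u (orbit_pullback \<alpha> x f)"
  by (simp add: vector_field_def left_slice_def orbit_pullback_def clinear_apply_tlift[OF assms(1)]
      clinear_apply_tlift[OF assms(2)] clinear_simps[OF assms(1)] clinear_simps[OF assms(2)]
      cscale_complex_def mult.commute)

lemma orbit_pullback_parity:
  fixes \<alpha> :: "'x::supercommutative_algebra \<Rightarrow> ('g::supercommutative_algebra, 'x) tensor"
  assumes \<alpha>: "\<And>p f. \<alpha> (hcomp p f) = hcomp p (\<alpha> f)" and x: "superalgebra_hom x"
  shows "orbit_pullback \<alpha> x (hcomp p f) = hcomp p (orbit_pullback \<alpha> x f)"
proof -
  note xlin = superalgebra_homD(1)[OF x]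
  have bil: "cbilinear (\<lambda>(g :: 'g) h. x h *\<^sub>C g)"
    by (simp add: cbilinear_iff clinear_simps[OF xlin] cscale_add_right cscale_add_left cscale_cscale
        cscale_complex_def mult.commute)
  let ?F = "tlift (\<lambda>(g :: 'g) h. x h *\<^sub>C g)"
  have "?F (hcomp p t) = hcomp p (?F t)" for t
  proof (rule tensor_homogeneous_ext[where t = t])
    show "clinear (\<lambda>t. ?F (hcomp p t))" "clinear (\<lambda>t. hcomp p (?F t))"
      by (rule clinear_compose[OF clinear_tlift[OF bil] clinear_hcomp]
          clinear_compose[OF clinear_hcomp clinear_tlift[OF bil]])+
    fix r s and g :: 'g and h :: 'x assume g: "hcomp r g = g" and h: "hcomp s h = h"
    have "s = 0 \<or> x h = 0" using point_odd[OF x, of h] h by (cases s) auto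
    then show "?F (hcomp p (g \<otimes>\<^sub>C h)) = hcomp p (?F (g \<otimes>\<^sub>C h))"
      by (cases p; cases r) (auto simp: hcomp_pure_homogeneous[OF g h] tlift_pure[OF bil] tlift_0[OF bil]
          hcomp_cscale hcomp_homogeneous[OF g])
  qed
  then show ?thesis by (simp add: orbit_pullback_def \<alpha>)
qed

section \<open>Euler derivations and the order of vanishing\<close>

lemma euler_derivation_power:
  fixes E :: "'a::super_algebra \<Rightarrow> 'a"
  assumes lin: "clinear E" and deriv: "\<And>a b. E (a * b) = E a * b + a * E b"
    and Em: "\<And>a. E a \<in> m" and euler: "\<And>a. a \<in> m \<Longrightarrow> E a - a \<in> ideal_mult m m"
    and "f \<in> ideal_power m n"
  shows "E f - of_nat n *\<^sub>C f \<in> ideal_power m (Suc n)"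
  using assms(5)
proof (induction n arbitrary: f)
  case 0
  have "E f * 1 \<in> ideal_mult m UNIV" by (rule ideal_mult_mem[OF Em UNIV_I])
  then show ?case by simp
next
  case (Suc n)
  have lin': "clinear (\<lambda>f. E f - of_nat (Suc n) *\<^sub>C f)"
    by (rule clinearI) (simp_all add: clinear_simps[OF lin] cscale_add_right
        cvs.scale_right_diff_distrib cscale_cscale mult.commute del: of_nat_Suc)
  show ?case
  proof (rule cspan_image_closed[OF lin' csubspace_ideal_power])
    show "f \<in> cspan {a * b | a b. a \<in> m \<and> b \<in> ideal_power m n}"
      using Suc.prems by (simp add: ideal_mult_def)
    fix y assume "y \<in> {a * b | a b. a \<in> m \<and> b \<in> ideal_power m n}"
    then obtain a b where y: "y = a * b" and a: "a \<in> m" and b: "b \<in> ideal_power m n" by blast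
    \<comment> \<open>The product rule adds the eigenvalue 1 on m / m^2 to the eigenvalue n on m^n /
      m^(n+1); both error terms land in m^(n+2).\<close>
    have "E y - of_nat (Suc n) *\<^sub>C y = (E a - a) * b + a * (E b - of_nat n *\<^sub>C b)"
      by (simp add: y deriv cscale_add_left cscale_one algebra_simps cscale_mult_right)
    moreover have "a * (E b - of_nat n *\<^sub>C b) \<in> ideal_power m (Suc (Suc n))"
      using ideal_mult_mem[OF a Suc.IH[OF b]] by simp
    moreover have "(E a - a) * b \<in> ideal_power m (Suc (Suc n))"
    proof (rule cspan_image_closed[OF clinear_mult(2) csubspace_ideal_power])
      show "E a - a \<in> cspan {c * d | c d. c \<in> m \<and> d \<in> m}"
        using euler[OF a] by (simp add: ideal_mult_def)
      fix z assume "z \<in> {c * d | c d. c \<in> m \<and> d \<in> m}"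
      then obtain c d where z: "z = c * d" "c \<in> m" "d \<in> m" by blast
      have "c * (d * b) \<in> ideal_mult m (ideal_mult m (ideal_power m n))"
        by (intro ideal_mult_mem z b)
      then show "z * b \<in> ideal_power m (Suc (Suc n))" by (simp add: z(1) mult.assoc)
    qed
    ultimately show "E y - of_nat (Suc n) *\<^sub>C y \<in> ideal_power m (Suc (Suc n))"
      using cvs.subspace_add[OF csubspace_ideal_power] by metis
  qed
qed

text \<open>Among the homogeneous generators of m take a subset \<open>Z\<close> of least size that
  spans m modulo m^2. Least size means independence modulo m^2, which allows dual functionals that
  also vanish on m^2 and on constants; these are point derivations.\<close>

lemma cotangent_basis:
  fixes x :: "'a::supercommutative_algebra \<Rightarrow> complex" and F :: "'a set"
  assumes F: "finite F" "subalgebra_generated F = UNIV" and x: "superalgebra_hom x"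
  defines "m \<equiv> {a. x a = 0}"
  obtains Z \<delta> where "finite Z" "Z \<subseteq> m" "\<And>z. z \<in> Z \<Longrightarrow> \<exists>p. hcomp p z = z"
    "m \<subseteq> cspan (Z \<union> ideal_mult m m)" "\<And>y. y \<in> Z \<Longrightarrow> \<delta> y \<in> tangent_space x"
    "\<And>y z. y \<in> Z \<Longrightarrow> z \<in> Z \<Longrightarrow> \<delta> y z = (if z = y then 1 else 0)"
proof -
  note x' = superalgebra_homD[OF x] and lin = clinear_simps[OF superalgebra_homD(1)[OF x]]
  let ?Q = "ideal_mult m m"
  have msub: "csubspace m" unfolding m_def by (rule csubspaceI) (simp_all add: lin)
  have Qm: "?Q \<subseteq> m" by (rule ideal_mult_subset[OF msub]) (simp add: m_def x'(2))
  obtain Y where Y: "finite Y" "\<forall>y\<in>Y. \<exists>p. hcomp p y = y" "ideal_gen Y = m"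
    using kernel_eq_ideal_gen[OF F x] unfolding m_def by (elim exE conjE)
  have Ym: "Y \<subseteq> m" using ideal_gen_base[of _ Y 1] Y(3) by auto
  let ?P = "\<lambda>Z. Z \<subseteq> Y \<and> m \<subseteq> cspan (Z \<union> ?Q)"
  have "m \<subseteq> cspan (Y \<union> ?Q)"
    unfolding Y(3)[symmetric] ideal_gen_def[of Y]
  proof (rule cvs.span_minimal[OF _ cvs.subspace_span], clarify)
    fix y a assume y: "y \<in> Y"
    have "y * (a - x a *\<^sub>C 1) \<in> ?Q"
      using y Ym by (intro ideal_mult_mem) (auto simp: m_def lin x'(3) cscale_complex_def)
    moreover have "y * a = x a *\<^sub>C y + y * (a - x a *\<^sub>C 1)"
      by (simp add: right_diff_distrib cscale_mult_right)
    ultimately show "y * a \<in> cspan (Y \<union> ideal_mult (cspan {y * a |y a. y \<in> Y}) (cspan {y * a |y a. y \<in> Y}))"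
      unfolding Y(3)[unfolded ideal_gen_def] using y
      by (simp add: cvs.span_add cvs.span_scale cvs.span_base)
  qed
  then have "?P Y" by simp
  from ex_has_least_nat[of ?P, OF this, of card]
  obtain Z where Z: "Z \<subseteq> Y" "m \<subseteq> cspan (Z \<union> ?Q)" and least: "\<And>Z'. ?P Z' \<Longrightarrow> card Z \<le> card Z'"
    by (elim exE conjE) simp
  have finZ: "finite Z" using Z(1) Y(1) finite_subset by blast
  let ?S = "\<lambda>y. (Z - {y}) \<union> ?Q"
  have ind: "y \<notin> cspan (?S y)" if y: "y \<in> Z" for y
  proof
    assume "y \<in> cspan (?S y)"
    then have "cspan (insert y (?S y)) = cspan (?S y)" by (rule cvs.span_redundant)
    moreover have "insert y (?S y) = Z \<union> ?Q" using y by blast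
    ultimately have "?P (Z - {y})" using Z by auto
    then have "card Z \<le> card (Z - {y})" by (rule least)
    moreover have "card (Z - {y}) < card Z" using finZ y by (rule card_Diff1_less)
    ultimately show False by linarith
  qed
  have "\<exists>d. d \<in> tangent_space x \<and> (\<forall>z\<in>Z. d z = (if z = y then 1 else 0))" if y: "y \<in> Z" for y
  proof -
    have Sm: "cspan (?S y) \<subseteq> m" using Z(1) Ym Qm by (intro cvs.span_minimal[OF _ msub]) blast
    \<comment> \<open>Evaluation at \<open>x\<close> kills \<open>y\<close> and
      \<open>cspan (?S y)\<close> but not constants, so adding 1 creates no new relation.\<close>
    have "y \<notin> cspan (insert 1 (?S y))"
    proof
      assume "y \<in> cspan (insert 1 (?S y))"
      then obtain k where k: "y - k *\<^sub>C 1 \<in> cspan (?S y)" by (auto simp: cvs.span_breakdown_eq)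
      then have "x (y - k *\<^sub>C 1) = 0" using Sm by (auto simp: m_def)
      moreover have "x y = 0" using y Z(1) Ym by (auto simp: m_def)
      ultimately have "k = 0" by (simp add: lin x'(3) cscale_complex_def)
      then show False using k ind[OF y] by simp
    qed
    from separating_functional[OF cvs.subspace_span this]
    obtain d :: "'a \<Rightarrow> complex" where d: "clinear d" "d y = 1"
      "\<And>z. z \<in> cspan (insert 1 (?S y)) \<Longrightarrow> d z = 0" by metis
    note dlin = clinear_simps[OF d(1)]
    have d1: "d 1 = 0" by (rule d(3)[OF cvs.span_base]) simp
    have dQ: "d z = 0" if "z \<in> ?Q" for z by (rule d(3)[OF cvs.span_base]) (simp add: that)
    have "d (f * h) = d f * x h + x f * d h" for f h
    proof -
      \<comment> \<open>\<open>d\<close> vanishes on m^2 and on constants; expanding this product of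
        two elements of m gives the Leibniz rule.\<close>
      have zero: "d ((f - x f *\<^sub>C 1) * (h - x h *\<^sub>C 1)) = 0"
        by (intro dQ ideal_mult_mem) (simp_all add: m_def lin x'(3) cscale_complex_def)
      have expand: "(f - x f *\<^sub>C 1) * (h - x h *\<^sub>C 1)
          = f * h - x h *\<^sub>C f - x f *\<^sub>C h + (x f * x h) *\<^sub>C 1"
        by (simp add: algebra_simps cscale_mult_left cscale_mult_right cscale_cscale)
      show ?thesis
        using zero unfolding expand by (simp add: dlin d1 cscale_complex_def algebra_simps)
    qed
    then have "d \<in> tangent_space x" using d(1) by (simp add: tangent_space_def)
    moreover have "d z = 0" if "z \<in> Z" "z \<noteq> y" for z by (rule d(3)[OF cvs.span_base]) (simp add: that)
    ultimately show ?thesis using d(2) by (intro exI[of _ d]) auto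
  qed
  then obtain \<delta> where "\<And>y. y \<in> Z \<Longrightarrow> \<delta> y \<in> tangent_space x \<and> (\<forall>z\<in>Z. \<delta> y z = (if z = y then 1 else 0))"
    by metis
  then show thesis
    using finZ Z Ym Y(2) by (intro that[of Z \<delta>]) auto
qed

text \<open>
  With \<open>x\<^sub>i\<close> a basis of \<open>m / m\<^sup>2\<close> and \<open>u\<^sub>i\<close> in \<open>L\<close> dual to it, \<open>\<Sum> x\<^sub>i u\<^sub>i\<close> is an Euler derivation that maps
  an eigenfunction in \<open>m\<^sup>n\<close> to \<open>m\<^sup>n\<^sup>+\<^sup>1\<close>.
\<close>

theorem eigenfunction_vanishing_at_orbit_point:
  fixes \<alpha> :: "'x::supercommutative_algebra \<Rightarrow> ('g::supercommutative_algebra, 'x) tensor"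
  assumes X: "affine_supervariety TYPE('x)" and \<epsilon>: "superalgebra_hom \<epsilon>"
    and \<alpha>: "superalgebra_hom \<alpha>" "\<And>f. left_slice \<epsilon> (\<alpha> f) = f"
    and x: "superalgebra_hom x"
    and L: "L \<subseteq> tangent_space \<epsilon>" "\<And>u p. u \<in> L \<Longrightarrow> u \<circ> hcomp p \<in> L"
    and orbit: "(\<lambda>u. u \<circ> orbit_pullback \<alpha> x) ` L = tangent_space x"
    and f: "hcomp q f = f" "x f = 0"
    and eig: "\<And>u p. u \<in> L \<Longrightarrow> u \<circ> hcomp p = u \<Longrightarrow> \<exists>c. vector_field \<alpha> u f = c *\<^sub>C f"
  shows "f = 0"
proof -
  obtain F :: "'x set" where F: "finite F" "subalgebra_generated F = UNIV"
    using X unfolding affine_supervariety_def by (elim conjE exE)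
  note x' = superalgebra_homD[OF x] and xlin = clinear_simps[OF superalgebra_homD(1)[OF x]]
  define m where "m = {a. x a = 0}"
  have msub: "csubspace m" unfolding m_def by (rule csubspaceI) (simp_all add: xlin)
  obtain Z \<delta> where Z: "finite Z" "Z \<subseteq> m" "\<And>z. z \<in> Z \<Longrightarrow> \<exists>p. hcomp p z = z"
    "m \<subseteq> cspan (Z \<union> ideal_mult m m)" and \<delta>: "\<And>y. y \<in> Z \<Longrightarrow> \<delta> y \<in> tangent_space x"
    "\<And>y z. y \<in> Z \<Longrightarrow> z \<in> Z \<Longrightarrow> \<delta> y z = (if z = y then 1 else 0)"
    using cotangent_basis[OF F x] unfolding m_def[symmetric] by metis
  obtain par where par: "\<And>z. z \<in> Z \<Longrightarrow> hcomp (par z) z = z" using Z(3) by metis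
  have "\<exists>u\<in>L. u \<circ> hcomp (par y) = u \<and> (\<forall>z\<in>Z. x (vector_field \<alpha> u z) = (if z = y then 1 else 0))"
    if y: "y \<in> Z" for y
  proof -
    obtain u where u: "u \<in> L" "\<delta> y = u \<circ> orbit_pullback \<alpha> x" using \<delta>(1)[OF y] orbit by blast
    \<comment> \<open>Only the component of \<open>u\<close> with the parity of \<open>y\<close> is
      kept. It kills the coordinates of the other parity and has the same values on the rest, so
      duality at \<open>x\<close> survives.\<close>
    let ?u = "u \<circ> hcomp (par y)"
    have u': "?u \<in> L" by (rule L(2)[OF u(1)])
    have lin: "clinear ?u" using L(1) u' tangent_spaceD(1) by blast
    have "x (vector_field \<alpha> ?u z) = (if z = y then 1 else 0)" if z: "z \<in> Z" for z
    proof -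
      have "x (vector_field \<alpha> ?u z) = u (hcomp (par y) (orbit_pullback \<alpha> x z))"
        by (simp add: point_vector_field[OF x'(1) lin])
      also have "\<dots> = \<delta> y (hcomp (par y) z)"
        by (simp add: orbit_pullback_parity[OF superalgebra_homD(4)[OF \<alpha>(1)] x] u(2))
      also have "\<dots> = (if z = y then 1 else 0)"
      proof (cases "par z = par y")
        case True
        then show ?thesis using par[OF z] \<delta>(2)[OF y z] by simp
      next
        case False
        then have "hcomp (par y) z = 0" using hcomp_homogeneous[OF par[OF z], of "par y"] by simp
        then show ?thesis using False clinear_simps(3)[OF tangent_spaceD(1)[OF \<delta>(1)[OF y]]] by auto
      qed
      finally show ?thesis .
    qed
    moreover have "?u \<circ> hcomp (par y) = ?u" by (simp add: fun_eq_iff)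
    ultimately show ?thesis using u' by (intro bexI[of _ ?u] conjI ballI)
  qed
  then obtain u where u: "\<And>y. y \<in> Z \<Longrightarrow> u y \<in> L" "\<And>y. y \<in> Z \<Longrightarrow> u y \<circ> hcomp (par y) = u y"
    "\<And>y z. y \<in> Z \<Longrightarrow> z \<in> Z \<Longrightarrow> x (vector_field \<alpha> (u y) z) = (if z = y then 1 else 0)"
    by metis
  have utan: "u y \<in> tangent_space \<epsilon>" if "y \<in> Z" for y using L(1) u(1)[OF that] by blast
  let ?D = "\<lambda>y. vector_field \<alpha> (u y)"
  \<comment> \<open>Coordinate and field have the same parity in each summand, so \<open>E\<close>
    is even; duality makes it the identity on m / m^2.\<close>
  define E where "E f = (\<Sum>y\<in>Z. y * ?D y f)" for f
  have Dlin: "clinear (?D y)" if "y \<in> Z" for y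
    by (rule clinear_vector_field[OF superalgebra_homD(1)[OF \<alpha>(1)] tangent_spaceD(1)[OF utan[OF that]]])
  have Elin: "clinear E"
  proof (rule clinearI)
    show "E (a + b) = E a + E b" for a b
      unfolding E_def sum.distrib[symmetric]
      by (rule sum.cong[OF refl]) (simp add: clinear_simps[OF Dlin] distrib_left)
    show "E (c *\<^sub>C a) = c *\<^sub>C E a" for c a
      unfolding E_def cvs.scale_sum_right
      by (rule sum.cong[OF refl]) (simp add: clinear_simps[OF Dlin] cscale_mult_right)
  qed
  have deriv: "E (a * b) = E a * b + a * E b" for a b
    unfolding E_def sum_distrib_right sum_distrib_left sum.distrib[symmetric]
  proof (rule sum.cong[OF refl])
    fix y assume y: "y \<in> Z"
    \<comment> \<open>The sign made by the field in passing \<open>a\<close> is undone by the sign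
      of moving \<open>y\<close> past \<open>a\<close>.\<close>
    have "y * twist (par y) a = a * y"
      using homogeneous_commute(1)[OF par[OF y], of "twist (par y) a"] twist_twist[of "par y" a]
      by (simp only: twist_def)
    then show "y * ?D y (a * b) = y * ?D y a * b + a * (y * ?D y b)"
      unfolding vector_field_mult[OF \<epsilon> \<alpha> utan[OF y] u(2)[OF y]]
      by (simp add: distrib_left mult.assoc[symmetric])
  qed
  have Em: "E a \<in> m" for a
    using Z(2) unfolding E_def m_def by (auto simp: xlin x'(2) intro!: sum.neutral)
  have ED: "E z - z \<in> ideal_mult m m" if z: "z \<in> Z" for z
  proof -
    \<comment> \<open>Writing \<open>z\<close> with Kronecker coefficients makes
      \<open>E z - z\<close> a sum of products of \<open>y\<close> with \<open>?D y z\<close> minus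
      its value at \<open>x\<close>, both of which vanish at \<open>x\<close>.\<close>
    have "z = (\<Sum>y\<in>Z. y * ((if z = y then 1 else 0) *\<^sub>C 1))"
    proof -
      have "(\<Sum>y\<in>Z. y * ((if z = y then 1 else 0) *\<^sub>C 1)) = (\<Sum>y\<in>Z. if z = y then y else 0)"
        by (rule sum.cong[OF refl]) (simp add: cscale_one)
      then show ?thesis using Z(1) z by simp
    qed
    then have "E z - z = (\<Sum>y\<in>Z. y * (?D y z - (if z = y then 1 else 0) *\<^sub>C 1))"
      unfolding right_diff_distrib sum_subtractf E_def by simp
    also have "\<dots> \<in> ideal_mult m m"
      using Z(2) z
      by (intro cvs.subspace_sum[OF csubspace_ideal_mult] ideal_mult_mem)
        (auto simp: m_def xlin u(3) x'(3) cscale_complex_def)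
    finally show ?thesis .
  qed
  have euler: "E a - a \<in> ideal_mult m m" if a: "a \<in> m" for a
  proof (rule cspan_image_closed[where f = "\<lambda>a. E a - a", OF _ csubspace_ideal_mult])
    show "clinear (\<lambda>a. E a - a)"
      by (rule clinearI) (simp_all add: clinear_simps[OF Elin] cvs.scale_right_diff_distrib)
    show "a \<in> cspan (Z \<union> ideal_mult m m)" using Z(4) a by blast
    fix z assume "z \<in> Z \<union> ideal_mult m m"
    moreover have "E z \<in> ideal_mult m m" if "z \<in> ideal_mult m m"
    proof (rule cspan_image_closed[OF Elin csubspace_ideal_mult _ that[unfolded ideal_mult_def]])
      fix w assume "w \<in> {a * b | a b. a \<in> m \<and> b \<in> m}"
      then obtain a b where w: "w = a * b" "a \<in> m" "b \<in> m" by blast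
      show "E w \<in> ideal_mult m m"
        unfolding w(1) deriv
        by (intro cvs.subspace_add[OF csubspace_ideal_mult] ideal_mult_mem Em w)
    qed
    ultimately show "E z - z \<in> ideal_mult m m"
      using ED cvs.subspace_diff[OF csubspace_ideal_mult, of "E z" m m z] by blast
  qed
  have "f \<in> ideal_power m n" for n
  proof (induction n)
    case (Suc n)
    show ?case
    proof (cases n)
      \<comment> \<open>Here the Euler argument is void, as the eigenvalue is 0; the assumption
        \<open>x f = 0\<close> starts the induction. In the other case \<open>n\<close> can be
        inverted.\<close>
      case 0
      have "f * 1 \<in> ideal_mult m UNIV" by (rule ideal_mult_mem) (simp_all add: m_def f(2))
      then show ?thesis using 0 by simp
    next
      case (Suc k)
      have "E f \<in> ideal_power m (Suc n)"
        unfolding E_def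
      proof (rule cvs.subspace_sum[OF csubspace_ideal_power])
        fix y assume y: "y \<in> Z"
        obtain c where "?D y f = c *\<^sub>C f" using eig[OF u(1)[OF y] u(2)[OF y]] by blast
        moreover have "c *\<^sub>C f \<in> ideal_power m n"
          by (rule cvs.subspace_scale[OF csubspace_ideal_power Suc.IH])
        ultimately show "y * ?D y f \<in> ideal_power m (Suc n)"
          using y Z(2) by (auto intro: ideal_mult_mem)
      qed
      from cvs.subspace_diff[OF csubspace_ideal_power this
          euler_derivation_power[OF Elin deriv Em euler Suc.IH]]
      have "of_nat n *\<^sub>C f \<in> ideal_power m (Suc n)" by simp
      from cvs.subspace_scale[OF csubspace_ideal_power this, of "inverse (of_nat n)"]
      show ?thesis using Suc by (simp add: cscale_cscale cscale_one del: of_nat_Suc)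
    qed
  qed simp
  then obtain s where "s \<in> homogeneous 0" "x s \<noteq> 0" "s * f = 0"
    using annihilated_near_point[OF F x f(1)] unfolding m_def by metis
  then show ?thesis by (rule affine_supervariety_annihilated_zero[OF X x f(1)])
qed

section \<open>The action of the Lie superalgebra on functions\<close>

lemma tangent_antipode:
  fixes \<Delta> :: "'g::supercommutative_algebra \<Rightarrow> ('g, 'g) tensor"
  assumes G: "affine_supergroup \<Delta> \<epsilon> S" and u: "u \<in> tangent_space \<epsilon>"
  shows "u (S f) = - u f"
proof -
  have \<epsilon>: "superalgebra_hom \<epsilon>" and S: "superalgebra_hom S"
    and left: "\<And>x. tlift (\<lambda>a b. \<epsilon> a *\<^sub>C b) (\<Delta> x) = x"
    and right: "\<And>x. tlift (\<lambda>a b. \<epsilon> b *\<^sub>C a) (\<Delta> x) = x"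
    and anti: "\<And>x. tlift (\<lambda>a b. S a * b) (\<Delta> x) = \<epsilon> x *\<^sub>C 1"
    using G unfolding affine_supergroup_def by blast+
  note e = superalgebra_homD[OF \<epsilon>] and s = superalgebra_homD[OF S]
  note elin = clinear_simps[OF e(1)] and slin = clinear_simps[OF s(1)]
    and ulin = clinear_simps[OF tangent_spaceD(1)[OF u]]
  have uS: "tlift (\<lambda>a b. v (S a) * \<epsilon> b) (\<Delta> x) = v (S x)" if "clinear v" for v :: "'g \<Rightarrow> complex" and x
  proof -
    have "v (S (tlift (\<lambda>a b. \<epsilon> b *\<^sub>C a) (\<Delta> x))) = tlift (\<lambda>a b. v (S (\<epsilon> b *\<^sub>C a))) (\<Delta> x)"
      by (rule clinear_apply_tlift[where f = "\<lambda>a. v (S a)"]) (rule clinear_compose[OF that s(1)])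
    then show ?thesis
      by (simp add: right slin clinear_simps[OF that] cscale_complex_def mult.commute)
  qed
  \<comment> \<open>The inverse fixes the identity: apply \<epsilon> to the antipode law.\<close>
  have \<epsilon>S: "\<epsilon> (S x) = \<epsilon> x" for x
    using clinear_apply_tlift[OF e(1), of "\<lambda>a b. S a * b" "\<Delta> x"] uS[OF e(1), of x]
    by (simp add: anti e(2,3) elin cscale_complex_def)
  \<comment> \<open>This differentiates g^-1 g = 1 at the identity: the Leibniz rule splits the
    result into \<open>u (S f)\<close> and \<open>u f\<close>, and \<open>u\<close> kills
    constants.\<close>
  have "u (\<epsilon> f *\<^sub>C 1) = tlift (\<lambda>a b. u (S a * b)) (\<Delta> f)"
    by (simp only: anti[symmetric] clinear_apply_tlift[OF tangent_spaceD(1)[OF u]])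
  also have "\<dots> = tlift (\<lambda>a b. u (S a) * \<epsilon> b) (\<Delta> f) + tlift (\<lambda>a b. \<epsilon> a * u b) (\<Delta> f)"
    by (simp add: tangent_spaceD(2)[OF u] \<epsilon>S tlift_fun_add)
  also have "tlift (\<lambda>a b. u (S a) * \<epsilon> b) (\<Delta> f) = u (S f)" by (rule uS[OF tangent_spaceD(1)[OF u]])
  also have "tlift (\<lambda>a b. \<epsilon> a * u b) (\<Delta> f) = u f"
    using clinear_apply_tlift[OF tangent_spaceD(1)[OF u], of "\<lambda>a b. \<epsilon> a *\<^sub>C b" "\<Delta> f"]
    by (simp add: left ulin cscale_complex_def)
  finally show ?thesis
    using tangent_one[OF u e(3)] by (simp add: ulin cscale_complex_def eq_neg_iff_add_eq_0)
qed

text \<open>The group acts on functions through the inverse: the antipode gives the minus sign, and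
  the sign rule for exchanging the factors gives \<open>twist r\<close>.\<close>

lemma slice_function_module:
  fixes \<alpha> :: "'x::supercommutative_algebra \<Rightarrow> ('g::supercommutative_algebra, 'x) tensor"
  assumes G: "affine_supergroup \<Delta> \<epsilon> S" and u: "u \<in> tangent_space \<epsilon>" "u \<circ> hcomp r = u"
  shows "slice u (function_module S \<alpha> f) = - twist r (vector_field \<alpha> u f)"
proof -
  note ulin = tangent_spaceD(1)[OF u(1)]
  have uh: "u (hcomp p g) = (if p = r then u g else 0)" for p g
    using functional_parity[OF u(2) ulin, of p "hcomp p g"] fun_cong[OF u(2), of g] by auto
  have "slice u (function_module S \<alpha> f) = tlift (\<lambda>g h. slice u (\<Sum>p\<in>{0, 1}. \<Sum>q\<in>{0, 1}.
      ksign p q *\<^sub>C (hcomp q h \<otimes>\<^sub>C S (hcomp p g)))) (\<alpha> f)"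
    unfolding function_module_def by (rule clinear_apply_tlift[OF clinear_slice[OF ulin]])
  also have "(\<lambda>g (h :: 'x). slice u (\<Sum>p\<in>{0, 1}. \<Sum>q\<in>{0, 1}. ksign p q *\<^sub>C (hcomp q h \<otimes>\<^sub>C S (hcomp p g))))
      = (\<lambda>g h. - twist r (u g *\<^sub>C h))"
  proof (intro ext)
    fix g :: 'g and h :: 'x
    have "slice u (\<Sum>p\<in>{0, 1}. \<Sum>q\<in>{0, 1}. ksign p q *\<^sub>C (hcomp q h \<otimes>\<^sub>C S (hcomp p g)))
        = (\<Sum>p\<in>{0, 1}. \<Sum>q\<in>{0, 1}. - ((ksign p q * u (hcomp p g)) *\<^sub>C hcomp q h))"
      unfolding clinear_simps[OF clinear_slice[OF ulin]] slice_pure[OF ulin]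
        tangent_antipode[OF G u(1)] cscale_cscale by simp
    also have "\<dots> = - (\<Sum>q\<in>{0, 1}. ksign r q *\<^sub>C hcomp q (u g *\<^sub>C h))"
      unfolding uh by (cases r) (simp_all add: hcomp_cscale cscale_cscale)
    finally show "slice u (\<Sum>p\<in>{0, 1}. \<Sum>q\<in>{0, 1}. ksign p q *\<^sub>C (hcomp q h \<otimes>\<^sub>C S (hcomp p g)))
        = - twist r (u g *\<^sub>C h)"
      by (simp only: twist_eq_sum)
  qed
  also have "tlift (\<lambda>g h. - twist r (u g *\<^sub>C h)) (\<alpha> f) = - twist r (vector_field \<alpha> u f)"
  proof -
    have "clinear (\<lambda>a :: 'x. - twist r a)"
      by (rule clinearI) (simp_all add: clinear_simps[OF clinear_twist])
    then show ?thesis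
      unfolding vector_field_def left_slice_def by (rule clinear_apply_tlift[symmetric])
  qed
  finally show ?thesis .
qed

section \<open>Comparison of two copies of an irreducible module\<close>

theorem corollary5p8:
  fixes \<Delta> :: "'g::supercommutative_algebra \<Rightarrow> ('g, 'g) tensor"
    and \<epsilon> :: "'g \<Rightarrow> complex"
    and S :: "'g \<Rightarrow> 'g"
    and \<alpha> :: "'x::supercommutative_algebra \<Rightarrow> ('g, 'x) tensor"
    and \<tau> :: "'v::super_vector_space \<Rightarrow> ('v, 'g) tensor"
  assumes "quasireductive \<Delta> \<epsilon> S"
    and "affine_G_supervariety \<Delta> \<epsilon> \<alpha>"
    and "spherical \<Delta> \<epsilon> S \<alpha>"
    and "irreducible_G_module \<Delta> \<epsilon> \<tau>"
  shows "module_multiplicity \<tau> (function_module S \<alpha>) (socle (function_module S \<alpha>)) \<le> 1"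
proof -
  let ?\<sigma> = "function_module S \<alpha>"
  have G: "affine_supergroup \<Delta> \<epsilon> S" using assms(1) by (simp add: quasireductive_def)
  then have \<Delta>: "superalgebra_hom \<Delta>" and \<epsilon>: "superalgebra_hom \<epsilon>"
    by (simp_all add: affine_supergroup_def)
  have X: "affine_supervariety TYPE('x)" and \<alpha>: "superalgebra_hom \<alpha>" "\<And>f. left_slice \<epsilon> (\<alpha> f) = f"
    using assms(2) by (simp_all add: affine_G_supervariety_def left_slice_def)
  obtain I where I: "hyperborel_subgroup \<Delta> \<epsilon> S I" "has_open_orbit \<epsilon> \<alpha> I"
    using assms(3) unfolding spherical_def by (elim exE conjE)
  let ?b = "lie_of_subgroup \<epsilon> I"
  have b: "prehyperborel \<Delta> (tangent_space \<epsilon>) ?b"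
    using I(1) by (simp add: hyperborel_subgroup_def hyperborel_subalgebra_def)
  then have bsub: "?b \<subseteq> tangent_space \<epsilon>" and bpar: "\<And>u p. u \<in> ?b \<Longrightarrow> u \<circ> hcomp p \<in> ?b"
    by (simp_all add: prehyperborel_def lie_subalgebra_def)
  obtain x where x: "superalgebra_hom x"
    and orbit: "(\<lambda>u. u \<circ> orbit_pullback \<alpha> x) ` ?b = tangent_space x"
    using I(2) unfolding has_open_orbit_def points_def by blast
  obtain v p where v: "v \<noteq> 0" "hcomp p v = v"
    and even: "\<forall>u\<in>lie_component 0 ?b. \<exists>c. comodule_action \<tau> u v = c *\<^sub>C v"
    and odd: "\<forall>u\<in>lie_component 1 ?b. comodule_action \<tau> u v = 0"
    by (rule prehyperborel_eigenvector[OF assms(4) \<Delta> superalgebra_homD(1)[OF \<epsilon>] tangent_spaceD(1) b])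
  \<comment> \<open>Odd elements kill \<open>v\<close>, which counts as eigenvalue 0; this gives one
    weight for homogeneous elements of both parities.\<close>
  have "\<exists>c. comodule_action \<tau> u v = c *\<^sub>C v" if "u \<in> ?b" "u \<circ> hcomp r = u" for u r
    using even odd that by (cases r) (auto simp: lie_component_def intro: exI[of _ 0])
  then obtain c where c: "\<And>u r. u \<in> ?b \<Longrightarrow> u \<circ> hcomp r = u \<Longrightarrow> comodule_action \<tau> u v = c u *\<^sub>C v"
    by metis
  \<comment> \<open>The left side is the module action on C[X] as computed by
    \<open>slice_function_module\<close>. The weight \<open>c\<close> belongs to \<open>v\<close>
    and is fixed before any copy of the module is considered.\<close>
  define weight where "weight f \<longleftrightarrow> (\<forall>u\<in>?b. \<forall>r. u \<circ> hcomp r = u \<longrightarrow>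
      - twist r (vector_field \<alpha> u f) = c u *\<^sub>C f)" for f
  have vanish: "f = 0" if f: "weight f" "hcomp q f = f" "x f = 0" for f q
  proof (rule eigenfunction_vanishing_at_orbit_point[OF X \<epsilon> \<alpha> x bsub bpar orbit f(2,3)])
    fix u r assume u: "u \<in> ?b" "u \<circ> hcomp r = u"
    have "- twist r (vector_field \<alpha> u f) = c u *\<^sub>C f"
      using f(1) u unfolding weight_def by blast
    then have "twist r (vector_field \<alpha> u f) = (- c u) *\<^sub>C f" by (simp add: minus_equation_iff)
    \<comment> \<open>\<open>twist r\<close> is an involution and acts on the homogeneous
      \<open>f\<close> by a sign, so eigenvectors of the module action are eigenfunctions of the
      field.\<close>
    then have "vector_field \<alpha> u f = twist r ((- c u) *\<^sub>C f)" by (metis twist_twist)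
    also have "\<dots> = (- c u * ksign r q) *\<^sub>C f"
      by (simp only: clinear_simps(2)[OF clinear_twist] twist_homogeneous[OF f(2)] cscale_cscale)
    finally show "\<exists>c. vector_field \<alpha> u f = c *\<^sub>C f" by (rule exI)
  qed
  have copy: "\<exists>f\<in>W. f \<noteq> 0 \<and> weight f \<and> hcomp 0 f = f \<and> x f \<noteq> 0"
    if W: "isomorphic_to_submodule \<tau> ?\<sigma> W" for W
  proof -
    obtain \<phi> r where \<phi>: "clinear \<phi>" "bij_betw \<phi> UNIV W" "\<forall>q v. \<phi> (hcomp q v) = hcomp (q + r) (\<phi> v)"
      "\<forall>v. ?\<sigma> (\<phi> v) = tmap \<phi> id (\<tau> v)"
      using W unfolding isomorphic_to_submodule_def by (elim conjE exE)
    let ?f = "\<phi> v"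
    have fW: "?f \<in> W" using \<phi>(2) by (auto simp: bij_betw_def)
    have ne: "?f \<noteq> 0"
      using v(1) inj_onD[OF bij_betw_imp_inj_on[OF \<phi>(2)], of v 0] clinear_simps(3)[OF \<phi>(1)] by auto
    have w: "weight ?f"
      unfolding weight_def
    proof (intro ballI allI impI)
      fix u r assume u: "u \<in> ?b" "u \<circ> hcomp r = u"
      then have t: "u \<in> tangent_space \<epsilon>" using bsub by blast
      show "- twist r (vector_field \<alpha> u ?f) = c u *\<^sub>C ?f"
        unfolding slice_function_module[OF G t u(2), symmetric]
        using c[OF u] by (simp add: \<phi>(4) slice_tmap[OF \<phi>(1) clinear_id tangent_spaceD(1)[OF t]]
            comodule_action_def clinear_simps[OF \<phi>(1)])
    qed
    have hom: "hcomp (p + r) ?f = ?f" using \<phi>(3)[rule_format, of p v] v(2) by simp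
    have xf: "x ?f \<noteq> 0" using vanish[OF w hom] ne by blast
    \<comment> \<open>A point kills odd functions, so a nonzero value at \<open>x\<close> forces the
      image of \<open>v\<close> to be even and fixes the parity of the isomorphism.\<close>
    have pr: "p + r = 0"
    proof (rule ccontr)
      assume "p + r \<noteq> 0"
      then have "p + r = 1" by (cases "p + r") simp_all
      then show False using point_odd[OF x] hom xf by metis
    qed
    show ?thesis using fW ne w hom[unfolded pr] xf by (intro bexI[of _ ?f] conjI)
  qed
  have "n \<le> 1" if W: "\<forall>i<n. W i \<subseteq> socle ?\<sigma> \<and> isomorphic_to_submodule \<tau> ?\<sigma> (W i)"
    and ind: "independent_family n W" for n and W :: "nat \<Rightarrow> 'x set"
  proof (rule ccontr)
    assume "\<not> n \<le> 1"
    then have n: "0 < n" "1 < n" by simp_all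
    have iso: "isomorphic_to_submodule \<tau> ?\<sigma> (W i)" if "i < n" for i
      using W[rule_format, OF that] by (rule conjunct2)
    have sub: "csubspace (W i)" if "i < n" for i
      using iso[OF that] unfolding isomorphic_to_submodule_def submodule_def by (elim conjE)
    obtain f where f: "f \<in> W 0" "f \<noteq> 0" "weight f" "hcomp 0 f = f" "x f \<noteq> 0"
      using copy[OF iso[OF n(1)]] by (elim bexE conjE)
    obtain h where h: "h \<in> W 1" "h \<noteq> 0" "weight h" "hcomp 0 h = h" "x h \<noteq> 0"
      using copy[OF iso[OF n(2)]] by (elim bexE conjE)
    note xlin = clinear_simps[OF superalgebra_homD(1)[OF x]]
    \<comment> \<open>The combination that cancels the values at \<open>x\<close>; both coefficients
      are nonzero.\<close>
    let ?g = "x h *\<^sub>C f - x f *\<^sub>C h"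
    have "weight ?g"
      unfolding weight_def
    proof (intro ballI allI impI)
      fix u r assume u: "u \<in> ?b" "u \<circ> hcomp r = u"
      then have "clinear u" using bsub tangent_spaceD(1) by blast
      note D = clinear_simps[OF clinear_vector_field[OF superalgebra_homD(1)[OF \<alpha>(1)] this]]
      have eq: "- twist r (vector_field \<alpha> u f) = c u *\<^sub>C f" "- twist r (vector_field \<alpha> u h) = c u *\<^sub>C h"
        using f(3) h(3) u unfolding weight_def by blast+
      have "- twist r (vector_field \<alpha> u ?g)
          = x h *\<^sub>C (- twist r (vector_field \<alpha> u f)) - x f *\<^sub>C (- twist r (vector_field \<alpha> u h))"
        by (simp add: D clinear_simps[OF clinear_twist])
      then show "- twist r (vector_field \<alpha> u ?g) = c u *\<^sub>C ?g"
        unfolding eq by (simp add: cvs.scale_right_diff_distrib cscale_cscale mult.commute)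
    qed
    moreover have "hcomp 0 ?g = ?g" by (simp add: hcomp_diff hcomp_cscale f(4) h(4))
    moreover have "x ?g = 0" by (simp add: xlin cscale_complex_def)
    ultimately have zero: "?g = 0" by (rule vanish)
    \<comment> \<open>Spreads the relation \<open>?g = 0\<close> over the family: one vector in each
      of the first two copies, zero in all others.\<close>
    let ?w = "\<lambda>i :: nat. if i = 0 then x h *\<^sub>C f else if i = 1 then - (x f *\<^sub>C h) else 0"
    have "(\<Sum>i<n. ?w i) = (\<Sum>i\<in>{0, 1}. ?w i)"
      by (rule sum.mono_neutral_right) (use n in auto)
    also have "\<dots> = 0" using zero by simp
    finally have "(\<Sum>i<n. ?w i) = 0" .
    moreover have "\<forall>i<n. ?w i \<in> W i"
      using cvs.subspace_scale[OF sub[OF n(1)] f(1)]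
        cvs.subspace_neg[OF sub[OF n(2)] cvs.subspace_scale[OF sub[OF n(2)] h(1)]]
        cvs.subspace_0[OF sub] by simp
    ultimately have "\<forall>i<n. ?w i = 0"
      by (intro ind[unfolded independent_family_def, THEN spec, THEN mp, THEN mp])
    then have "x h *\<^sub>C f = 0" using n(1) by auto
    then show False using f(2) h(5) by simp
  qed
  then show ?thesis
    unfolding module_multiplicity_def by (intro SUP_least) (auto simp: one_enat_def)
qed

end
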